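(* Let $h:\mathbb{R}^n\to(-\infty,\infty]$ be a proper, lower semicontinuous, prox-bounded and semialgebraic function which is prox-regular at some local minimizer $\bar x$ of $h$ for $\bar v=0$. Then there is $\bar\lambda>0$ such that for every $\lambda\in(0,\bar\lambda]$ one can select $r_\lambda>0$ (with $\mathrm{Prox}_{\lambda h}$ single-valued and $e_\lambda h$ of class $C^1$ on $X=\mathbb{B}(\bar x,r_\lambda)$) and, for given $\nu\in(0,1)$ and $\bar\delta\in[0,\infty)$, numbers $\xi>0$ and $T>0$ so that the following holds. Let $x^0=x^1\in\mathbb{B}(\bar x,\xi)$, $\tau\in(0,T]$, and let $\{\beta_k\},\{\gamma_k\}\subset[0,\infty)$ satisfy $\bar\beta:=\sup_k\beta_k\in[0,1-\nu)$ and $\sup_k|\beta_k-\gamma_k|=\bar\delta$. Then for any sequence $\{x^k\}$ generated by the inexact proximal point method with momentum (IPPm, see context) with these data and $X=\mathbb{B}(\bar x,r_\lambda)$, such that $0\notin\partial h(x^k_{\rm ex})$ for all $k\in\mathbb{N}$: (i) $\{x^k\},\{x^k_{\rm in}\},\{x^k_{\rm ex}\}$ converge to some local minimizer $\tilde x$ of $h$ with $h(\tilde x)=h(\bar x)$. (ii) If $e_\lambda h$ satisfies the PLK condition at $\bar x$ with the desingularizing function $\psi(t)=Mt^{1-q}$, where $M>0$ and $q\in[0,1)$, then: - for $q\in[0,1/2]$, the sequences $\{x^k\}$ and $\{x^k-\mathrm{Prox}_{\lambda h}(x^k)\}$ converge linearly to $\tilde x$ and $0$, respectively; - for $q\in(1/2,1)$,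 $\|x^k-\tilde x\|=\mathcal{O}\big(k^{-\frac{1-q}{2q-1}}\big)$ and $\|x^k-\mathrm{Prox}_{\lambda h}(x^k)\|=\mathcal{O}\big(k^{-\frac{1-q}{2q-1}}\big)$ as $k\to\infty$.
   Context: $\|\cdot\|$ is the Euclidean norm, $\mathbb{B}(x,r)$ the open ball, $\mathbb{N}=\{1,2,\dots\}$. Regular subdifferential at $\bar x\in\mathrm{dom}\,h$: $\widehat\partial h(\bar x)=\{v:\liminf_{x\to\bar x}\frac{h(x)-h(\bar x)-\langle v,x-\bar x\rangle}{\|x-\bar x\|}\ge0\}$. Limiting subdifferential: $\partial h(\bar x)=\{v:\exists\,x^k\to\bar x,\ h(x^k)\to h(\bar x),\ v^k\in\widehat\partial h(x^k),\ v^k\to v\}$ (empty if $\bar x\notin\mathrm{dom}\,h$). Moreau envelope and proximal mapping: $e_\lambda h(x)=\inf_y\{h(y)+\frac1{2\lambda}\|y-x\|^2\}$, $\mathrm{Prox}_{\lambda h}(x)=\mathrm{argmin}_y\{h(y)+\frac1{2\lambda}\|y-x\|^2\}$. $h$ is prox-bounded if $e_\lambda h(x)>-\infty$ for some $\lambda>0$ and some $x\in\mathbb{R}^n$. A proper l.s.c. function $h$ is prox-regular at $\bar x\in\mathrm{dom}\,h$ for $\bar v\in\partial h(\bar x)$ if there are $\varepsilon>0$ and $\rho\ge0$ such that $h(x)\ge h(u)+\langle v,x-u\rangle-\frac{\rho}{2}\|x-u\|^2$ whenever $x\in\mathbb{B}(\bar x,\varepsilon)$, $u\in\mathbb{B}(\bar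 x,\varepsilon)$, $v\in\partial h(u)\cap\mathbb{B}(\bar v,\varepsilon)$ and $h(u)<h(\bar x)+\varepsilon$. IPPm: given $x^0=x^1\in X$, $\nu\in(0,1)$, $\{\beta_k\},\{\gamma_k\}\subset[0,\infty)$, $\lambda>0$, $\tau>0$ with $\sup_k\beta_k<1$, $\sup_k|\beta_k-\gamma_k|<\infty$, for each $k\ge1$ put $x^k_{\rm in}:=x^k+\beta_k(x^k-x^{k-1})$, $x^k_{\rm ex}:=x^k+\gamma_k(x^k-x^{k-1})$, $g^k:=\lambda^{-1}(x^k_{\rm ex}-p^k)$, where $p^k$ is any point with $\|p^k-\mathrm{Prox}_{\lambda h}(x^k_{\rm ex})\|\le\nu\|p^k-x^k_{\rm ex}\|$, and $x^{k+1}:=x^k_{\rm in}-\tau g^k$. The inequality on $p^k$ is required whenever $x^k_{\rm ex}\in X$ (where $\mathrm{Prox}_{\lambda h}$ is single-valued); $p^k$ is otherwise arbitrary. PLK (Polyak-Łojasiewicz-Kurdyka) condition for a function $f$ that is $C^1$ around $\bar x$, with desingularizing function $\varphi$: there are $\eta\in(0,\infty]$, a neighborhood $U$ of $\bar x$ on which $f$ is $C^1$, and a concave function $\varphi:[0,\eta)\to[0,\infty)$ such that $\varphi(0)=0$, $\varphi$ is $C^1$ on $(0,\eta)$, $\varphi'>0$ on $(0,\eta)$, and $\varphi'(f(x)-f(\bar x))\|\nabla f(x)\|\ge1$ for all $x\in U$ with $f(\bar x)<f(x)<f(\bar x)+\eta$. A sequence $\{u^k\}$ converges linearly to $u$ if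 $\|u^k-u\|=\mathcal{O}(\mu^k)$ for some $\mu\in(0,1)$ (R-linear convergence). In (ii), the statements about $x^k-\mathrm{Prox}_{\lambda h}(x^k)$ concern $k$ large enough that $\mathrm{Prox}_{\lambda h}(x^k)$ is single-valued. *)

theory Defs
  imports "HOL-Analysis.Analysis" "HOL-Library.Landau_Symbols"
begin

section \<open>Extended-real-valued functions\<close>

definition edom :: "('a \<Rightarrow> ereal) \<Rightarrow> 'a set" where
  "edom h = {x. h x < \<infinity>}"

definition proper :: "('a \<Rightarrow> ereal) \<Rightarrow> bool" where
  "proper h \<longleftrightarrow> (\<forall>x. h x \<noteq> -\<infinity>) \<and> edom h \<noteq> {}"

definition lsc :: "('a::topological_space \<Rightarrow> ereal) \<Rightarrow> bool" where
  "lsc h \<longleftrightarrow> (\<forall>x. h x \<le> Liminf (at x) h)"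

definition local_minimizer :: "('a::topological_space \<Rightarrow> ereal) \<Rightarrow> 'a \<Rightarrow> bool" where
  "local_minimizer h x \<longleftrightarrow> x \<in> edom h \<and> (\<forall>\<^sub>F y in nhds x. h x \<le> h y)"


section \<open>Semialgebraic sets and functions\<close>

definition basic_semialgebraic_set :: "'a::euclidean_space set \<Rightarrow> bool" where
  "basic_semialgebraic_set S \<longleftrightarrow>
     (\<exists>P Q. finite P \<and> finite Q \<and> (\<forall>p\<in>P \<union> Q. real_polynomial_function p) \<and>
        S = {z. (\<forall>p\<in>P. p z = 0) \<and> (\<forall>q\<in>Q. q z < 0)})"

definition semialgebraic_set :: "'a::euclidean_space set \<Rightarrow> bool" where
  "semialgebraic_set S \<longleftrightarrow>
     (\<exists>\<B>. finite \<B> \<and> (\<forall>B\<in>\<B>. basic_semialgebraic_set B) \<and> S = \<Union>\<B>)"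

text \<open>The graph of an extended-real-valued function lies over its domain only: points
  with an infinite value do not contribute.\<close>

definition semialgebraic_function :: "('a::euclidean_space \<Rightarrow> ereal) \<Rightarrow> bool" where
  "semialgebraic_function h \<longleftrightarrow> semialgebraic_set {(x, t::real). h x = ereal t}"


section \<open>Subdifferentials and prox-regularity\<close>

definition regular_subdiff :: "('a::euclidean_space \<Rightarrow> ereal) \<Rightarrow> 'a \<Rightarrow> 'a set" where
  "regular_subdiff h x =
     {v. x \<in> edom h \<and>
         Liminf (at x) (\<lambda>y. (h y - h x - ereal (v \<bullet> (y - x))) / ereal (norm (y - x))) \<ge> 0}"

definition limiting_subdiff :: "('a::euclidean_space \<Rightarrow> ereal) \<Rightarrow> 'a \<Rightarrow> 'a set" where
  "limiting_subdiff h x =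
     {v. x \<in> edom h \<and>
         (\<exists>u w. u \<longlonglongrightarrow> x \<and> (\<lambda>k. h (u k)) \<longlonglongrightarrow> h x \<and>
                (\<forall>k::nat. w k \<in> regular_subdiff h (u k)) \<and> w \<longlonglongrightarrow> v)}"

definition prox_regular :: "('a::euclidean_space \<Rightarrow> ereal) \<Rightarrow> 'a \<Rightarrow> 'a \<Rightarrow> bool" where
  "prox_regular h xbar vbar \<longleftrightarrow>
     proper h \<and> lsc h \<and> xbar \<in> edom h \<and> vbar \<in> limiting_subdiff h xbar \<and>
     (\<exists>\<epsilon>>0. \<exists>\<rho>\<ge>0. \<forall>x\<in>ball xbar \<epsilon>. \<forall>u\<in>ball xbar \<epsilon>. \<forall>v\<in>limiting_subdiff h u \<inter> ball vbar \<epsilon>.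
        h u < h xbar + ereal \<epsilon> \<longrightarrow>
        h x \<ge> h u + ereal (v \<bullet> (x - u) - \<rho> / 2 * (norm (x - u))\<^sup>2))"


section \<open>Moreau envelope and proximal mapping\<close>

definition prox_objective :: "('a::euclidean_space \<Rightarrow> ereal) \<Rightarrow> real \<Rightarrow> 'a \<Rightarrow> 'a \<Rightarrow> ereal" where
  "prox_objective h lam x y = h y + ereal (1 / (2 * lam) * (norm (y - x))\<^sup>2)"

definition moreau_env :: "('a::euclidean_space \<Rightarrow> ereal) \<Rightarrow> real \<Rightarrow> 'a \<Rightarrow> ereal" where
  "moreau_env h lam x = (INF y. prox_objective h lam x y)"

definition Prox :: "('a::euclidean_space \<Rightarrow> ereal) \<Rightarrow> real \<Rightarrow> 'a \<Rightarrow> 'a set" where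
  "Prox h lam x = {y. \<forall>z. prox_objective h lam x y \<le> prox_objective h lam x z}"

text \<open>The single element of the proximal mapping; meaningful only where
  \<^const>\<open>Prox\<close> is single-valued.\<close>

definition prox_point :: "('a::euclidean_space \<Rightarrow> ereal) \<Rightarrow> real \<Rightarrow> 'a \<Rightarrow> 'a" where
  "prox_point h lam x = the_elem (Prox h lam x)"

definition prox_bounded :: "('a::euclidean_space \<Rightarrow> ereal) \<Rightarrow> bool" where
  "prox_bounded h \<longleftrightarrow> (\<exists>lam>0. \<exists>x. moreau_env h lam x > -\<infinity>)"


section \<open>Continuous differentiability and the PLK condition\<close>

definition gradient :: "('a::euclidean_space \<Rightarrow> real) \<Rightarrow> 'a \<Rightarrow> 'a" where
  "gradient f x = (THE D. GDERIV f x :> D)"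

definition C1_on :: "('a::euclidean_space \<Rightarrow> real) \<Rightarrow> 'a set \<Rightarrow> bool" where
  "C1_on f U \<longleftrightarrow> open U \<and> (\<forall>x\<in>U. \<exists>D. GDERIV f x :> D) \<and> continuous_on U (gradient f)"

definition PLK :: "('a::euclidean_space \<Rightarrow> real) \<Rightarrow> 'a \<Rightarrow> (real \<Rightarrow> real) \<Rightarrow> bool" where
  "PLK f xbar \<phi> \<longleftrightarrow>
     (\<exists>(\<eta>::ereal) U. 0 < \<eta> \<and> xbar \<in> U \<and> C1_on f U \<and>
        concave_on {t. 0 \<le> t \<and> ereal t < \<eta>} \<phi> \<and>
        (\<forall>t. 0 \<le> t \<and> ereal t < \<eta> \<longrightarrow> 0 \<le> \<phi> t) \<and>
        \<phi> 0 = 0 \<and>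
        (\<forall>t. 0 < t \<and> ereal t < \<eta> \<longrightarrow> \<phi> field_differentiable (at t)) \<and>
        continuous_on {t. 0 < t \<and> ereal t < \<eta>} (deriv \<phi>) \<and>
        (\<forall>t. 0 < t \<and> ereal t < \<eta> \<longrightarrow> 0 < deriv \<phi> t) \<and>
        (\<forall>x\<in>U. f xbar < f x \<and> ereal (f x) < ereal (f xbar) + \<eta> \<longrightarrow>
           deriv \<phi> (f x - f xbar) * norm (gradient f x) \<ge> 1))"


section \<open>The inexact proximal point method with momentum\<close>

text \<open>\<open>momentum \<beta> x\<close> is the sequence of inertial points and \<open>momentum \<gamma> x\<close> that of
  extrapolated points; both are meaningful for indices \<open>k \<ge> 1\<close> only.\<close>

definition momentum :: "(nat \<Rightarrow> real) \<Rightarrow> (nat \<Rightarrow> 'a::euclidean_space) \<Rightarrow> nat \<Rightarrow> 'a" where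
  "momentum b x k = x k + b k *\<^sub>R (x k - x (k - 1))"

definition IPPm ::
  "('a::euclidean_space \<Rightarrow> ereal) \<Rightarrow> 'a set \<Rightarrow> real \<Rightarrow> real \<Rightarrow> real \<Rightarrow>
   (nat \<Rightarrow> real) \<Rightarrow> (nat \<Rightarrow> real) \<Rightarrow> (nat \<Rightarrow> 'a) \<Rightarrow> bool" where
  "IPPm h X lam \<tau> \<nu> \<beta> \<gamma> x \<longleftrightarrow>
     0 < lam \<and> 0 < \<tau> \<and> 0 < \<nu> \<and> \<nu> < 1 \<and>
     (\<forall>k\<ge>1. 0 \<le> \<beta> k \<and> 0 \<le> \<gamma> k) \<and>
     bdd_above (\<beta> ` {1..}) \<and> (SUP k\<in>{1..}. \<beta> k) < 1 \<and>
     bdd_above ((\<lambda>k. \<bar>\<beta> k - \<gamma> k\<bar>) ` {1..}) \<and>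
     x 0 = x 1 \<and> x 0 \<in> X \<and>
     (\<exists>p. \<forall>k\<ge>1.
        (momentum \<gamma> x k \<in> X \<longrightarrow>
           norm (p k - prox_point h lam (momentum \<gamma> x k)) \<le> \<nu> * norm (p k - momentum \<gamma> x k)) \<and>
        (let g = inverse lam *\<^sub>R (momentum \<gamma> x k - p k)
         in x (k + 1) = momentum \<beta> x k - \<tau> *\<^sub>R g))"

definition converges_linearly :: "(nat \<Rightarrow> 'a::euclidean_space) \<Rightarrow> 'a \<Rightarrow> bool" where
  "converges_linearly u l \<longleftrightarrow> (\<exists>\<mu>. 0 < \<mu> \<and> \<mu> < 1 \<and> (\<lambda>k. norm (u k - l)) \<in> O(\<lambda>k. \<mu> ^ k))"

end

theory Submission
  imports Defs "HOL-Computational_Algebra.Fundamental_Theorem_Algebra"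
begin

text \<open>
  Near the local minimizer, prox-regularity makes the proximal mapping single-valued and Lipschitz,
  so that the Moreau envelope \<open>E\<close> is \<open>C\<^sup>1\<close> with Lipschitz gradient
  \<open>F x = (x - prox x) / \<lambda>\<close>, and the method is gradient descent on \<open>E\<close> with momentum and a relative
  error \<open>\<nu>\<close>.  The function \<open>E (x k) - E xbar + (1 - \<nu>) / (2 \<tau>) * (norm (x k - x (k - 1)))\<^sup>2\<close> is a
  Lyapunov function for every \<open>\<beta> \<le> 1 - \<nu>\<close>, and a desingularizing function for \<open>E\<close> turns its decrease
  into finite length of the trajectory.

  A desingularizing function exists because \<open>E\<close> is semialgebraic.  By quantifier elimination, a
  curve \<open>x t\<close> on which \<open>F\<close> has minimal norm on the level set of height \<open>t\<close> can be chosen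
  semialgebraically; its coordinates are then monotone for small \<open>t\<close>, and twice the variation of the
  curve serves as desingularizing function.  No regularity of the curve is needed.

  In the second part of the theorem, the neighbourhood in the PLK condition depends on \<open>M\<close> and \<open>q\<close>
  whereas the radius \<open>\<xi>\<close> is chosen beforehand.  The gap is bridged by showing that only finitely
  many exponents can be optimal on small balls around \<open>xbar\<close>, so that one ball serves all \<open>q\<close>.
\<close>

section \<open>Signs of real polynomials\<close>

text \<open>A desingularizing function is only asked for increments,
  \<open>b - a \<le> (\<phi> b - \<phi> a) * norm (F x)\<close>, because the talweg may jump. The
  descent inequality has an error quadratic in the distance covered, so cutting the heights into
  fine steps recovers the increment even across jumps; the loss is the factor 2. Monotonicity of the
  minimal slope lets one bound at the top of a height interval control the whole curve below it.

  Admitting every \<open>\<beta>\<close> up to \<open>1 - \<nu>\<close> leaves little room: momentum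
  and relative error compete for the same squared displacement, and the margin that remains is
  \<open>\<nu> * (1 - \<nu>)\<close>.

  Only finitely many exponents occur for the following reason. With the radius treated as a further
  variable, a single finite family of polynomials describes the minimal slope for all radii.
  Freezing the radius keeps the degrees bounded, and the degrees alone limit the exponents.\<close>

lemma poly_strict_increasing:
  fixes p :: "real poly"
  assumes "a < b" "\<And>u. a < u \<Longrightarrow> u < b \<Longrightarrow> 0 < poly (pderiv p) u"
  shows "poly p a < poly p b"
proof -
  obtain x where "a < x" "x < b" "poly p b - poly p a = (b - a) * poly (pderiv p) x"
    using poly_MVT[OF assms(1), of p] by auto
  with assms show ?thesis by (smt (verit) mult_pos_pos)
qed

lemma poly_unbounded_abs:
  fixes p :: "real poly"
  assumes "pderiv p \<noteq> 0"
  obtains r where "\<And>z. r \<le> \<bar>z\<bar> \<Longrightarrow> d \<le> \<bar>poly p z\<bar>"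
proof -
  obtain a p' where p: "p = pCons a p'" by (cases p)
  with assms have "p' \<noteq> 0" by (auto simp: pderiv_pCons)
  from poly_infinity[OF this, of d a] obtain r where "\<forall>z. r \<le> norm z \<longrightarrow> d \<le> norm (poly p z)"
    unfolding p by blast
  with that show ?thesis by auto
qed

text \<open>A nonconstant polynomial is unbounded in absolute value, and one that increases up to
  \<open>c\<close> stays below \<open>poly p c\<close> on the left, so it must become negative
  there. This substitutes for a left end point on an unbounded cell.\<close>

lemma poly_increasing_neg_left:
  fixes p :: "real poly"
  assumes inc: "\<And>u. u < c \<Longrightarrow> 0 < poly (pderiv p) u"
  shows "\<exists>l<c. poly p l < 0"
proof -
  have nz: "pderiv p \<noteq> 0" using inc[of "c - 1"] by auto
  obtain r where r: "\<And>z. r \<le> \<bar>z\<bar> \<Longrightarrow> \<bar>poly p c\<bar> + 1 \<le> \<bar>poly p z\<bar>"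
    using poly_unbounded_abs[OF nz] by blast
  define l where "l = min (c - 1) (- \<bar>r\<bar>)"
  have "l < c" "r \<le> \<bar>l\<bar>" by (auto simp: l_def min_def)
  moreover have "poly p l < poly p c"
    using \<open>l < c\<close> by (intro poly_strict_increasing inc) auto
  ultimately show ?thesis using r[of l] by (intro exI[of _ l]) auto
qed

lemma poly_same_sign_of_no_root:
  fixes p :: "real poly"
  assumes "0 < poly p x" "\<And>u. u \<in> {min x y..max x y} \<Longrightarrow> poly p u \<noteq> 0"
  shows "0 < poly p y"
proof (rule ccontr)
  assume "\<not> ?thesis"
  with assms(2)[of y] have neg: "poly p y < 0" by force
  consider "x < y" | "y < x" using neg assms(1) by (cases x y rule: linorder_cases) auto
  then show False
  proof cases
    case 1
    then obtain u where "x < u" "u < y" "poly p u = 0" using poly_IVT_neg[OF 1 assms(1) neg] by blast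
    then show False using assms(2)[of u] by auto
  next
    case 2
    then obtain u where "y < u" "u < x" "poly p u = 0" using poly_IVT_pos[OF 2 neg assms(1)] by blast
    then show False using assms(2)[of u] by auto
  qed
qed

text \<open>A matching of finitely many roots has to become a reparametrisation of the whole line.
  The extension is piecewise affine; it is kept surjective because points are later pulled back
  through it.\<close>

lemma strict_mono_on_finite_extend:
  fixes s :: "real \<Rightarrow> real"
  assumes "finite A" "strict_mono_on A s"
  shows "\<exists>\<sigma>. strict_mono \<sigma> \<and> surj \<sigma> \<and> (\<forall>x\<in>A. \<sigma> x = s x)"
  using assms
proof (induction A rule: finite_linorder_max_induct)
  case empty
  have "strict_mono (\<lambda>x::real. x)" by (simp add: strict_mono_def)
  moreover have "surj (\<lambda>x::real. x)" by auto
  ultimately show ?case by blast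
next
  case (insert m A)
  have "strict_mono_on A s" using insert.prems by (auto simp: strict_mono_on_def)
  with insert.IH obtain \<sigma> where \<sigma>: "strict_mono \<sigma>" "surj \<sigma>" "\<forall>x\<in>A. \<sigma> x = s x" by blast
  show ?case
  proof (cases "A = {}")
    case True
    have "strict_mono (\<lambda>x. x + (s m - m))" by (simp add: strict_mono_def)
    moreover have "surj (\<lambda>x. x + (s m - m))"
      by (rule surjI[where f = "\<lambda>x. x - (s m - m)"]) simp
    ultimately show ?thesis using True by (intro exI[of _ "\<lambda>x. x + (s m - m)"]) auto
  next
    case False
    define a where "a = Max A"
    have a: "a \<in> A" "\<And>x. x \<in> A \<Longrightarrow> x \<le> a" using False insert.hyps(1) by (auto simp: a_def)
    have am: "a < m" using a insert.hyps by auto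
    have sam: "s a < s m" using insert.prems a am by (auto simp: strict_mono_on_def)
    define k where "k = (s m - s a) / (m - a)"
    have k: "0 < k" using am sam by (simp add: k_def)
    define \<tau> where "\<tau> y = (if y \<le> a then \<sigma> y else s a + (y - a) * k)" for y
    have sa: "\<sigma> a = s a" using \<sigma>(3) a(1) by blast
    have "strict_mono \<tau>"
    proof (rule strict_monoI)
      fix x y :: real assume xy: "x < y"
      show "\<tau> x < \<tau> y"
      proof (cases "y \<le> a")
        case True
        then show ?thesis using xy \<sigma>(1) by (auto simp: \<tau>_def strict_mono_def)
      next
        case False
        show ?thesis
        proof (cases "x \<le> a")
          case True
          have "\<sigma> x \<le> s a" using \<sigma>(1) True sa by (metis strict_mono_less_eq)
          also have "s a < s a + (y - a) * k" using False k by simp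
          finally show ?thesis using True False by (simp add: \<tau>_def)
        next
          case f2: False
          then show ?thesis using False xy k by (simp add: \<tau>_def)
        qed
      qed
    qed
    moreover have "surj \<tau>"
    proof -
      have "\<exists>x. y = \<tau> x" for y
      proof (cases "y \<le> s a")
        case True
        obtain x where x: "y = \<sigma> x" using \<sigma>(2) by blast
        with True sa have "x \<le> a" using \<sigma>(1) by (metis strict_mono_less_eq)
        with x show ?thesis by (intro exI[of _ x]) (simp add: \<tau>_def)
      next
        case False
        then show ?thesis using k by (intro exI[of _ "a + (y - s a) / k"]) (auto simp: \<tau>_def field_simps)
      qed
      then show ?thesis by (simp add: surj_def)
    qed
    moreover have "\<tau> x = s x" if "x \<in> insert m A" for x
    proof (cases "x = m")
      case True
      then show ?thesis using am by (simp add: \<tau>_def k_def)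
    next
      case False
      then show ?thesis using that a \<sigma>(3) by (auto simp: \<tau>_def)
    qed
    ultimately show ?thesis by blast
  qed
qed

text \<open>Between two consecutive points of \<open>Z\<close>, which contains the critical points of \<open>p\<close>, the
  polynomial \<open>p\<close> is strictly monotone; its behaviour there is read off the signs of \<open>p\<close> on \<open>Z\<close>
  and the sign of its derivative.  All of this is preserved by \<open>\<sigma>\<close>.\<close>

locale root_transfer =
  fixes Z :: "real set" and \<sigma> :: "real \<Rightarrow> real" and p q :: "real poly"
  assumes Z: "finite Z"
    and mono: "strict_mono \<sigma>" and surj: "surj \<sigma>"
    and deriv: "\<And>y. sgn (poly (pderiv p) y) = sgn (poly (pderiv q) (\<sigma> y))"
    and crit: "\<And>y. poly (pderiv p) y = 0 \<Longrightarrow> y \<in> Z"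
    and sgn_Z: "\<And>z. z \<in> Z \<Longrightarrow> sgn (poly p z) = sgn (poly q (\<sigma> z))"
begin

text \<open>\<open>y'\<close> plays among the points \<open>\<sigma> z\<close> the part of
  \<open>y\<close> among the points of Z. Comparisons instead of end points cover bounded and
  unbounded cells alike.\<close>

definition same_cut :: "real \<Rightarrow> real \<Rightarrow> bool" where
  "same_cut y y' \<longleftrightarrow> (\<forall>z\<in>Z. (z < y \<longrightarrow> \<sigma> z < y') \<and> (y < z \<longrightarrow> y' < \<sigma> z))"

text \<open>Z contains the roots of the derivative, whose sign is therefore constant on each cell;
  pulling \<open>y'\<close> back through \<open>\<sigma>\<close> lands in the cell of
  \<open>y\<close>.\<close>

lemma deriv_pos_cut:
  assumes "y \<notin> Z" "0 < poly (pderiv p) y" "same_cut y y'"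
  shows "0 < poly (pderiv q) y'"
proof -
  obtain u where u: "y' = \<sigma> u" using surj by blast
  have cut: "(z < y \<longrightarrow> z < u) \<and> (y < z \<longrightarrow> u < z)" if "z \<in> Z" for z
    using assms(3) that mono by (auto simp: same_cut_def u strict_mono_less)
  have "0 < poly (pderiv p) u"
  proof (rule poly_same_sign_of_no_root[OF assms(2)])
    fix v assume v: "v \<in> {min y u..max y u}"
    show "poly (pderiv p) v \<noteq> 0"
    proof
      assume "poly (pderiv p) v = 0"
      with crit have "v \<in> Z" by blast
      with cut[of v] v assms(1) show False by (auto simp: min_def max_def split: if_splits)
    qed
  qed
  then show ?thesis using deriv[of u] by (simp add: u sgn_real_def split: if_splits)
qed

text \<open>The witness is the image of the last point of Z below \<open>y\<close>: there
  \<open>p\<close> is smaller than at \<open>y\<close>, hence negative, and signs on Z carry over to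
  \<open>q\<close>. If Z has no such point, \<open>q\<close> increases on the whole half-line below
  \<open>y'\<close> and unboundedness supplies the witness.\<close>

lemma transfer_left:
  assumes y: "y \<notin> Z" "0 < poly (pderiv p) y" and py: "poly p y \<le> 0"
    and cut: "same_cut y y'"
  shows "\<exists>l<y'. poly q l < 0 \<and> (\<forall>z\<in>Z. z < y \<longrightarrow> \<sigma> z \<le> l)"
proof (cases "{z\<in>Z. z < y} = {}")
  case True
  have "\<exists>l<y'. poly q l < 0"
  proof (rule poly_increasing_neg_left)
    fix u assume "u < y'"
    then have "same_cut y u" using cut True by (auto simp: same_cut_def)
    then show "0 < poly (pderiv q) u" using deriv_pos_cut y by blast
  qed
  then show ?thesis using True by auto
next
  case False
  define a where "a = Max {z\<in>Z. z < y}"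
  have a: "a \<in> Z" "a < y" "\<And>z. z \<in> Z \<Longrightarrow> z < y \<Longrightarrow> z \<le> a"
    using Max_in[of "{z\<in>Z. z < y}"] Z False by (auto simp: a_def)
  have "poly p a < poly p y"
  proof (rule poly_strict_increasing[OF a(2)])
    fix u assume u: "a < u" "u < y"
    show "0 < poly (pderiv p) u"
    proof (rule poly_same_sign_of_no_root[OF y(2)])
      fix v assume "v \<in> {min y u..max y u}"
      then show "poly (pderiv p) v \<noteq> 0" using u crit[of v] a(3)[of v] y by (cases "v = y") auto
    qed
  qed
  with py have "poly p a < 0" by simp
  with sgn_Z[OF a(1)] have "poly q (\<sigma> a) < 0" by (simp add: sgn_real_def split: if_splits)
  moreover have "\<sigma> a < y'" using cut a by (auto simp: same_cut_def)
  moreover have "\<sigma> z \<le> \<sigma> a" if "z \<in> Z" "z < y" for z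
    using a(3)[OF that] mono by (simp add: strict_mono_less_eq)
  ultimately show ?thesis by blast
qed

text \<open>Passing from p(y) to -p(-y) turns the derivative into p'(-y): left and right are
  swapped, but increasing polynomials stay increasing. Each left-hand statement thus yields its
  right-hand twin.\<close>

lemma reflect:
  "root_transfer (uminus ` Z) (\<lambda>y. - \<sigma> (- y)) (- pcompose p [:0, -1:]) (- pcompose q [:0, -1:])"
proof
  have d: "poly (pderiv (- pcompose f [:0, -1:])) y = poly (pderiv f) (- y)" for f :: "real poly" and y
    by (simp add: pderiv_minus pderiv_pcompose poly_pcompose pderiv_pCons)
  show "strict_mono (\<lambda>y. - \<sigma> (- y))" using mono by (simp add: strict_mono_def)
  show "surj (\<lambda>y. - \<sigma> (- y))"
  proof (rule surjI[where f = "\<lambda>y. - inv \<sigma> (- y)"])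
    show "- \<sigma> (- (- inv \<sigma> (- y))) = y" for y using surj by (simp add: surj_f_inv_f)
  qed
  show "sgn (poly (pderiv (- pcompose p [:0, -1:])) y) =
      sgn (poly (pderiv (- pcompose q [:0, -1:])) (- \<sigma> (- y)))" for y
    unfolding d using deriv[of "- y"] by simp
  show "y \<in> uminus ` Z" if "poly (pderiv (- pcompose p [:0, -1:])) y = 0" for y
    using crit[of "- y"] that unfolding d by (force intro: image_eqI[of _ _ "- y"])
  show "sgn (poly (- pcompose p [:0, -1:]) z) = sgn (poly (- pcompose q [:0, -1:]) (- \<sigma> (- z)))"
    if "z \<in> uminus ` Z" for z
    using that sgn_Z by (auto simp: poly_pcompose sgn_minus)
qed (use Z in simp)

lemma transfer_right:
  assumes y: "y \<notin> Z" "0 < poly (pderiv p) y" and py: "0 \<le> poly p y"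
    and cut: "same_cut y y'"
  shows "\<exists>l>y'. 0 < poly q l \<and> (\<forall>z\<in>Z. y < z \<longrightarrow> l \<le> \<sigma> z)"
proof -
  interpret n: root_transfer "uminus ` Z" "\<lambda>y. - \<sigma> (- y)" "- pcompose p [:0, -1:]" "- pcompose q [:0, -1:]"
    by (rule reflect)
  have "\<exists>l<(- y'). poly (- pcompose q [:0, -1:]) l < 0 \<and> (\<forall>z\<in>uminus ` Z. z < - y \<longrightarrow> - \<sigma> (- z) \<le> l)"
    by (rule n.transfer_left)
      (use assms in \<open>auto simp: n.same_cut_def same_cut_def pderiv_minus pderiv_pcompose poly_pcompose pderiv_pCons\<close>)
  then obtain l where "l < - y'" "0 < poly q (- l)" "\<And>z. z \<in> Z \<Longrightarrow> y < z \<Longrightarrow> - \<sigma> z \<le> l"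
    by (auto simp: poly_pcompose)
  then show ?thesis by (intro exI[of _ "- l"]) force
qed

lemma same_cut_self: "same_cut y (\<sigma> y)"
  using mono by (auto simp: same_cut_def strict_mono_less)

lemma transfer_root_pos:
  assumes y: "y \<notin> Z" "0 < poly (pderiv p) y" and py: "poly p y = 0"
  shows "\<exists>w. poly q w = 0 \<and> same_cut y w"
proof -
  obtain l where l: "l < \<sigma> y" "poly q l < 0" "\<forall>z\<in>Z. z < y \<longrightarrow> \<sigma> z \<le> l"
    using transfer_left[OF y _ same_cut_self] py by auto
  obtain r where r: "\<sigma> y < r" "0 < poly q r" "\<forall>z\<in>Z. y < z \<longrightarrow> r \<le> \<sigma> z"
    using transfer_right[OF y _ same_cut_self] py by auto
  obtain w where "l < w" "w < r" "poly q w = 0" using poly_IVT_pos[of l r q] l r by auto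
  with l r show ?thesis by (intro exI[of _ w]) (force simp: same_cut_def)
qed

text \<open>Walking left from \<open>y\<close> inside its cell, one either meets a root of
  \<open>p\<close> or reaches the bounding point of Z with \<open>p\<close> still nonnegative; in an
  unbounded cell a root is certain. From either point \<open>q\<close> increases up to
  \<open>s y\<close>.\<close>

lemma transfer_pos_pos:
  assumes s: "strict_mono s" "\<And>z. z \<in> Z \<Longrightarrow> s z = \<sigma> z"
    and roots: "\<And>w. poly p w = 0 \<Longrightarrow> poly q (s w) = 0"
    and y: "y \<notin> Z" "0 < poly (pderiv p) y" and py: "0 < poly p y"
  shows "0 < poly q (s y)"
proof -
  have cut: "same_cut v (s v)" for v
    using s by (auto simp: same_cut_def strict_mono_less simp flip: s(2))
  have step: "0 < poly q (s y)"
    if "w < y" "0 \<le> poly q (s w)" "\<And>z. z \<in> Z \<Longrightarrow> z < y \<Longrightarrow> z \<le> w" for w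
  proof -
    have "poly q (s w) < poly q (s y)"
    proof (rule poly_strict_increasing)
      show "s w < s y" using that s by (simp add: strict_mono_less)
      fix u assume u: "s w < u" "u < s y"
      have "same_cut y u"
        unfolding same_cut_def
      proof (intro ballI conjI impI)
        fix z assume z: "z \<in> Z"
        { assume "z < y"
          with that(3) z have "s z \<le> s w" using s(1) by (simp add: strict_mono_less_eq)
          with u s(2)[OF z] show "\<sigma> z < u" by simp }
        { assume "y < z"
          then have "s y < s z" using s(1) by (simp add: strict_mono_less)
          with u s(2)[OF z] show "u < \<sigma> z" by simp }
      qed
      then show "0 < poly (pderiv q) u" using deriv_pos_cut y by blast
    qed
    with that show ?thesis by simp
  qed
  have root_step: "0 < poly q (s y)" if w: "w < y" "poly p w < 0" "\<And>z. z \<in> Z \<Longrightarrow> z < y \<Longrightarrow> z \<le> w" for w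
  proof -
    obtain u where "w < u" "u < y" "poly p u = 0" using poly_IVT_pos[OF w(1,2) py] by blast
    with step[of u] roots[of u] w(3) show ?thesis by force
  qed
  show ?thesis
  proof (cases "{z\<in>Z. z < y} = {}")
    case True
    have "\<exists>l<y. poly p l < 0"
    proof (rule poly_increasing_neg_left)
      fix u assume "u < y"
      show "0 < poly (pderiv p) u"
      proof (rule poly_same_sign_of_no_root[OF y(2)])
        fix v assume "v \<in> {min y u..max y u}"
        with \<open>u < y\<close> y True have "v \<notin> Z" by (cases "v = y") auto
        then show "poly (pderiv p) v \<noteq> 0" using crit by blast
      qed
    qed
    then show ?thesis using root_step True by blast
  next
    case False
    define a where "a = Max {z\<in>Z. z < y}"
    have a: "a \<in> Z" "a < y" "\<And>z. z \<in> Z \<Longrightarrow> z < y \<Longrightarrow> z \<le> a"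
      using Max_in[of "{z\<in>Z. z < y}"] Z False by (auto simp: a_def)
    show ?thesis
    proof (cases "poly p a < 0")
      case True
      then show ?thesis using root_step a by blast
    next
      case False
      then have "0 \<le> poly q (s a)" using sgn_Z[OF a(1)] s(2)[OF a(1)]
        by (auto simp: sgn_real_def split: if_splits)
      then show ?thesis using step a by blast
    qed
  qed
qed

lemma transfer_pos_neg:
  assumes s: "strict_mono s" "\<And>z. z \<in> Z \<Longrightarrow> s z = \<sigma> z"
    and roots: "\<And>w. poly p w = 0 \<Longrightarrow> poly q (s w) = 0"
    and y: "y \<notin> Z" "0 < poly (pderiv p) y" and py: "poly p y < 0"
  shows "poly q (s y) < 0"
proof -
  interpret n: root_transfer "uminus ` Z" "\<lambda>y. - \<sigma> (- y)" "- pcompose p [:0, -1:]" "- pcompose q [:0, -1:]"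
    by (rule reflect)
  have "0 < poly (- pcompose q [:0, -1:]) (- s (- (- y)))"
    by (rule n.transfer_pos_pos[where s = "\<lambda>y. - s (- y)"])
      (use assms in \<open>auto simp: strict_mono_def pderiv_minus pderiv_pcompose poly_pcompose pderiv_pCons\<close>)
  then show ?thesis by (simp add: poly_pcompose)
qed

lemma root_transfer_uminus: "root_transfer Z \<sigma> (- p) (- q)"
  using Z mono surj deriv crit sgn_Z by unfold_locales (auto simp: pderiv_minus sgn_minus)

lemma transfer_root:
  assumes y: "y \<notin> Z" and py: "poly p y = 0"
  shows "\<exists>w. poly q w = 0 \<and> same_cut y w"
proof -
  have "poly (pderiv p) y \<noteq> 0" using y crit by blast
  then consider "0 < poly (pderiv p) y" | "0 < poly (pderiv (- p)) y" by (force simp: pderiv_minus)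
  then show ?thesis
  proof cases
    case 1
    then show ?thesis using transfer_root_pos y py by blast
  next
    case 2
    from root_transfer.transfer_root_pos[OF root_transfer_uminus y 2] py show ?thesis
      by (simp add: root_transfer.same_cut_def[OF root_transfer_uminus] same_cut_def)
  qed
qed

lemma transfer_sgn:
  assumes s: "strict_mono s" "\<And>z. z \<in> Z \<Longrightarrow> s z = \<sigma> z"
    and roots: "\<And>w. poly p w = 0 \<Longrightarrow> poly q (s w) = 0"
  shows "sgn (poly p y) = sgn (poly q (s y))"
proof (cases "y \<in> Z")
  case True
  then show ?thesis using sgn_Z s(2) by simp
next
  case False
  interpret n: root_transfer Z \<sigma> "- p" "- q" by (rule root_transfer_uminus)
  have "poly (pderiv p) y \<noteq> 0" using False crit by blast
  then consider "0 < poly (pderiv p) y" | "0 < poly (pderiv (- p)) y" by (force simp: pderiv_minus)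
  then show ?thesis
  proof cases
    case 1
    with transfer_pos_pos[OF s roots False 1] transfer_pos_neg[OF s roots False 1] roots
    show ?thesis by (cases "poly p y" "0::real" rule: linorder_cases) auto
  next
    case 2
    have "poly (- p) w = 0 \<Longrightarrow> poly (- q) (s w) = 0" for w using roots by simp
    with n.transfer_pos_pos[OF s _ False 2] n.transfer_pos_neg[OF s _ False 2] roots
    show ?thesis by (cases "poly p y" "0::real" rule: linorder_cases) auto
  qed
qed

end

text \<open>The map \<open>\<sigma>\<close> is bent into \<open>s\<close> so that it also matches
  the signs of \<open>p\<close>. Knowing these signs at the roots of the other members is enough
  because the derivative is among them, so that \<open>p\<close> is monotone in between. Members
  that vanish identically are left out of the root condition to keep the set of points
  finite.\<close>

lemma sign_diagram_insert:
  fixes P Q :: "'i \<Rightarrow> real poly" and p q :: "real poly"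
  assumes fin: "finite I" and mono: "strict_mono \<sigma>" and surj: "surj \<sigma>"
    and sgn_I: "\<And>i y. i \<in> I \<Longrightarrow> sgn (poly (P i) y) = sgn (poly (Q i) (\<sigma> y))"
    and d: "d \<in> I" "P d = pderiv p" "Q d = pderiv q" "pderiv p \<noteq> 0"
    and roots: "\<And>i y. i \<in> I \<Longrightarrow> P i \<noteq> 0 \<Longrightarrow> poly (P i) y = 0 \<Longrightarrow> sgn (poly p y) = sgn (poly q (\<sigma> y))"
  shows "\<exists>s. strict_mono s \<and> surj s \<and> (\<forall>i\<in>I. \<forall>y. sgn (poly (P i) y) = sgn (poly (Q i) (s y))) \<and>
    (\<forall>y. sgn (poly p y) = sgn (poly q (s y)))"
proof -
  define Z where "Z = {y. \<exists>i\<in>I. P i \<noteq> 0 \<and> poly (P i) y = 0}"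
  have "Z = (\<Union>i\<in>{i\<in>I. P i \<noteq> 0}. {y. poly (P i) y = 0})" by (auto simp: Z_def)
  then have Z: "finite Z" using fin by (auto intro: poly_roots_finite)
  interpret root_transfer Z \<sigma> p q
  proof
    show "sgn (poly (pderiv p) y) = sgn (poly (pderiv q) (\<sigma> y))" for y
      using sgn_I[OF d(1)] d(2,3) by simp
    show "y \<in> Z" if "poly (pderiv p) y = 0" for y
      using that d by (auto simp: Z_def intro!: bexI[of _ d])
    show "sgn (poly p z) = sgn (poly q (\<sigma> z))" if "z \<in> Z" for z
      using that roots by (auto simp: Z_def)
  qed (use Z mono surj in auto)
  define R where "R = {w. poly p w = 0}"
  have pnz: "p \<noteq> 0" using d(4) by auto
  have finR: "finite R" using pnz by (simp add: R_def poly_roots_finite)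
  define s0 where "s0 w = (if w \<in> Z then \<sigma> w else SOME w'. poly q w' = 0 \<and> same_cut w w')" for w
  have s0: "poly q (s0 w) = 0 \<and> same_cut w (s0 w)" if "w \<notin> Z" "poly p w = 0" for w
    using someI_ex[OF transfer_root[OF that]] that by (simp add: s0_def)
  have "strict_mono_on (Z \<union> R) s0"
  proof (rule strict_mono_onI)
    fix u v assume uv: "u \<in> Z \<union> R" "v \<in> Z \<union> R" "u < v"
    consider "u \<in> Z" "v \<in> Z" | "u \<in> Z" "v \<notin> Z" | "u \<notin> Z" "v \<in> Z" | "u \<notin> Z" "v \<notin> Z" by blast
    then show "s0 u < s0 v"
    proof cases
      case 1
      then show ?thesis using uv mono by (simp add: s0_def strict_mono_less)
    next
      case 2
      then have "same_cut v (s0 v)" using uv s0 by (auto simp: R_def)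
      then have "\<sigma> u < s0 v" using 2 uv by (auto simp: same_cut_def)
      then show ?thesis using 2 by (simp add: s0_def)
    next
      case 3
      then have "same_cut u (s0 u)" using uv s0 by (auto simp: R_def)
      then have "s0 u < \<sigma> v" using 3 uv by (auto simp: same_cut_def)
      then show ?thesis using 3 by (simp add: s0_def)
    next
      \<comment> \<open>Two new roots of \<open>p\<close> never share a cell: by Rolle a critical
        point, hence a point of Z, separates them.\<close>
      case 4
      with uv have pu: "poly p u = 0" "poly p v = 0" by (auto simp: R_def)
      obtain z where z: "u < z" "z < v" "poly (pderiv p) z = 0"
        using poly_MVT[OF uv(3), of p] uv(3) pu by auto
      with crit have "z \<in> Z" by blast
      then have "s0 u < \<sigma> z" "\<sigma> z < s0 v" using s0 4 pu z by (auto simp: same_cut_def)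
      then show ?thesis by simp
    qed
  qed
  with Z finR obtain s where s: "strict_mono s" "surj s" "\<forall>x\<in>Z \<union> R. s x = s0 x"
    using strict_mono_on_finite_extend[of "Z \<union> R" s0] by auto
  have sZ: "s z = \<sigma> z" if "z \<in> Z" for z using s(3) that by (simp add: s0_def)
  have sR: "poly q (s w) = 0" if "poly p w = 0" for w
  proof (cases "w \<in> Z")
    case True
    then show ?thesis using sZ sgn_Z[OF True] that by (simp add: sgn_zero_iff)
  next
    case False
    then show ?thesis using s(3) s0 that by (auto simp: R_def)
  qed
  have "sgn (poly (P i) y) = sgn (poly (Q i) (s y))" if i: "i \<in> I" for i y
  proof -
    \<comment> \<open>\<open>s\<close> may move points inside a cell. Writing \<open>s y\<close> as
      \<open>\<sigma> u\<close> puts \<open>u\<close> into the cell of \<open>y\<close>, so the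
      signs of the old members at \<open>u\<close> and \<open>y\<close> agree.\<close>
    obtain u where u: "s y = \<sigma> u" using surj by blast
    have "sgn (poly (P i) y) = sgn (poly (P i) u)"
    proof (cases "P i = 0 \<or> u = y")
      case False
      then have unz: "P i \<noteq> 0" "u \<noteq> y" by auto
      have no: "z \<notin> Z" if "z \<in> {min y u..max y u}" for z
      proof
        assume z: "z \<in> Z"
        have "z < y \<longleftrightarrow> \<sigma> z < \<sigma> u" "y < z \<longleftrightarrow> \<sigma> u < \<sigma> z"
          using s(1) sZ[OF z] u by (metis strict_mono_less)+
        then have "z < y \<longleftrightarrow> z < u" "y < z \<longleftrightarrow> u < z" using mono by (auto simp: strict_mono_less)
        with that unz show False by (auto simp: min_def max_def split: if_splits)
      qed
      then have nr: "poly (P i) z \<noteq> 0" if "z \<in> {min y u..max y u}" for z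
        using that i unz by (auto simp: Z_def)
      have "0 < poly (P i) u" if "0 < poly (P i) y"
        using poly_same_sign_of_no_root[OF that nr] by blast
      moreover have "0 < poly (- P i) u" if "0 < poly (- P i) y"
        using poly_same_sign_of_no_root[OF that, of u] nr by simp
      moreover have "poly (P i) y \<noteq> 0" using nr by auto
      ultimately show ?thesis by (cases "0 < poly (P i) y") auto
    qed auto
    also have "\<dots> = sgn (poly (Q i) (s y))" using sgn_I[OF i] u by simp
    finally show ?thesis .
  qed
  moreover have "sgn (poly p y) = sgn (poly q (s y))" for y
    by (rule transfer_sgn[OF s(1) sZ sR])
  ultimately show ?thesis using s by blast
qed


section \<open>Univariate polynomials with parameter-dependent coefficients\<close>

locale function_ring =
  fixes A :: "('x \<Rightarrow> real) set"
  assumes const: "(\<lambda>_. c) \<in> A"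
    and add: "f \<in> A \<Longrightarrow> g \<in> A \<Longrightarrow> (\<lambda>x. f x + g x) \<in> A"
    and mult: "f \<in> A \<Longrightarrow> g \<in> A \<Longrightarrow> (\<lambda>x. f x * g x) \<in> A"
begin

lemma diff:
  assumes "f \<in> A" "g \<in> A"
  shows "(\<lambda>x. f x - g x) \<in> A"
  using add[OF assms(1) mult[OF const[of "-1"] assms(2)]] by simp

text \<open>\<open>d\<close> bounds the formal degree. The actual degree may drop with the
  parameter, which is why it reappears below as a condition \<open>degree (p x) = k\<close>.\<close>

definition poly_over :: "nat \<Rightarrow> ('x \<Rightarrow> real poly) set" where
  "poly_over d = {q. (\<forall>x. degree (q x) \<le> d) \<and> (\<forall>i. (\<lambda>x. coeff (q x) i) \<in> A)}"

lemma poly_over_mono: "q \<in> poly_over d \<Longrightarrow> d \<le> e \<Longrightarrow> q \<in> poly_over e"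
  by (auto simp: poly_over_def intro: le_trans)

lemma poly_over_pderiv:
  assumes "q \<in> poly_over (Suc d)"
  shows "(\<lambda>x. pderiv (q x)) \<in> poly_over d"
proof -
  have "degree (pderiv (q x)) \<le> d" for x
    using assms by (simp add: poly_over_def degree_pderiv le_diff_conv)
  moreover have "(\<lambda>x. coeff (pderiv (q x)) i) \<in> A" for i
    using mult[OF const[of "of_nat (Suc i)"], of "\<lambda>x. coeff (q x) (Suc i)"] assms
    by (simp add: poly_over_def coeff_pderiv)
  ultimately show ?thesis by (simp add: poly_over_def)
qed

lemma poly_over_cutoff:
  assumes "q \<in> poly_over e"
  shows "(\<lambda>x. poly_cutoff (Suc d) (q x)) \<in> poly_over d"
proof -
  have "degree (poly_cutoff (Suc d) (q x)) \<le> d" for x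
    by (intro degree_le) (auto simp: coeff_poly_cutoff)
  moreover have "(\<lambda>x. coeff (poly_cutoff (Suc d) (q x)) i) \<in> A" for i
    using assms const by (cases "i < Suc d") (auto simp: poly_over_def coeff_poly_cutoff)
  ultimately show ?thesis by (simp add: poly_over_def)
qed

text \<open>Euclidean division without divisions, cancelling one leading term of \<open>q\<close> at
  a time. The multiplier is the square of the leading coefficient of \<open>p\<close>, so that the
  sign of \<open>q\<close> at the roots of \<open>p\<close> is unaffected.\<close>

lemma pseudo_remainder:
  assumes p: "p \<in> poly_over e" and k: "1 \<le> k" and q: "q \<in> poly_over n"
  shows "\<exists>r\<in>poly_over (k - 1). \<forall>x y. degree (p x) = k \<and> poly (p x) y = 0 \<longrightarrow>
    sgn (poly (q x) y) = sgn (poly (r x) y)"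
  using q
proof (induction n arbitrary: q)
  case 0
  then show ?case using poly_over_mono[of q 0 "k - 1"] by blast
next
  case (Suc n)
  show ?case
  proof (cases "Suc n < k")
    case True
    then show ?thesis using poly_over_mono[OF Suc.prems, of "k - 1"] by auto
  next
    case False
    define c where "c x = coeff (p x) k" for x
    \<comment> \<open>Truncating \<open>p\<close> at degree \<open>k\<close> makes the leading term
      cancel for every parameter; where \<open>p x\<close> has degree exactly \<open>k\<close>, the
      truncation changes nothing.\<close>
    define pk where "pk x = poly_cutoff (Suc k) (p x)" for x
    define q1 where "q1 x = smult (c x * c x) (q x)
      - smult (c x * coeff (q x) (Suc n)) (monom 1 (Suc n - k) * pk x)" for x
    have cA: "c \<in> A" and qA: "\<And>i. (\<lambda>x. coeff (q x) i) \<in> A" and qd: "\<And>x. degree (q x) \<le> Suc n"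
      using p Suc.prems by (auto simp: c_def[abs_def] poly_over_def)
    have pkA: "(\<lambda>x. coeff (pk x) i) \<in> A" for i
      using poly_over_cutoff[OF p, of k] by (simp add: poly_over_def pk_def)
    have co: "coeff (q1 x) i = c x * c x * coeff (q x) i - c x * coeff (q x) (Suc n) *
        (if Suc n - k \<le> i then coeff (pk x) (i - (Suc n - k)) else 0)" for x i
      by (simp add: q1_def coeff_monom_mult)
    have "degree (q1 x) \<le> n" for x
    proof (rule degree_le, intro allI impI)
      fix i assume i: "n < i"
      show "coeff (q1 x) i = 0"
      proof (cases "i = Suc n")
        case True
        then show ?thesis using False by (simp add: co pk_def coeff_poly_cutoff c_def)
      next
        case f: False
        then have "coeff (q x) i = 0" using i qd[of x] by (intro coeff_eq_0) auto
        moreover have "coeff (pk x) (i - (Suc n - k)) = 0"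
          using f i False by (simp add: pk_def coeff_poly_cutoff)
        ultimately show ?thesis by (simp add: co)
      qed
    qed
    moreover have "(\<lambda>x. coeff (q1 x) i) \<in> A" for i
    proof (cases "Suc n - k \<le> i")
      case True
      show ?thesis unfolding co if_P[OF True] by (intro diff mult cA qA pkA)
    next
      case False
      show ?thesis unfolding co if_not_P[OF False] by (intro diff mult cA qA const)
    qed
    ultimately have "q1 \<in> poly_over n" by (simp add: poly_over_def)
    from Suc.IH[OF this] obtain r where r: "r \<in> poly_over (k - 1)"
      "\<And>x y. degree (p x) = k \<and> poly (p x) y = 0 \<Longrightarrow> sgn (poly (q1 x) y) = sgn (poly (r x) y)"
      by blast
    have "sgn (poly (q x) y) = sgn (poly (r x) y)" if h: "degree (p x) = k" "poly (p x) y = 0" for x y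
    proof -
      have "pk x = p x" using h(1)
        by (intro poly_eqI) (auto simp: pk_def coeff_poly_cutoff coeff_eq_0)
      then have "poly (q1 x) y = c x * c x * poly (q x) y" using h(2) by (simp add: q1_def)
      moreover have "c x \<noteq> 0" using h(1) k by (auto simp: c_def)
      ultimately have "sgn (poly (q1 x) y) = sgn (poly (q x) y)"
        by (simp add: sgn_mult)
      then show ?thesis using r(2) h by simp
    qed
    with r(1) show ?thesis by blast
  qed
qed

text \<open>A strictly monotone surjection reparametrises the line, so equal signs of
  \<open>G\<close> give the same sign conditions in the same order along \<open>y\<close>. Hence the
  signs of \<open>G\<close> decide whether some \<open>y\<close> satisfies a given sign condition on
  \<open>F\<close>.\<close>

definition signs_determined :: "('x \<Rightarrow> real poly) set \<Rightarrow> bool" where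
  "signs_determined F \<longleftrightarrow> (\<exists>G. finite G \<and> G \<subseteq> A \<and>
     (\<forall>x x'. (\<forall>g\<in>G. sgn (g x) = sgn (g x')) \<longrightarrow>
       (\<exists>\<sigma>. strict_mono \<sigma> \<and> surj \<sigma> \<and> (\<forall>q\<in>F. \<forall>y. sgn (poly (q x) y) = sgn (poly (q x') (\<sigma> y))))))"

text \<open>The induction of Cohen and Hoermander: one polynomial of maximal degree is traded for
  polynomials of smaller degree, namely its derivative, its truncation and its
  pseudo-remainders.\<close>

theorem signs_determined:
  assumes "finite F" "F \<subseteq> poly_over d"
  shows "signs_determined F"
  using assms
proof (induction d arbitrary: F)
  case 0
  have c: "poly (q x) y = coeff (q x) 0" if q: "q \<in> F" for q x y
  proof -
    have "degree (q x) = 0" using q 0 by (auto simp: poly_over_def)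
    then obtain a where "q x = [:a:]" by (rule degree_eq_zeroE)
    then show ?thesis by simp
  qed
  have m: "strict_mono (\<lambda>x::real. x)" "surj (\<lambda>x::real. x)" by (auto simp: strict_mono_def)
  show ?case unfolding signs_determined_def
  proof (intro exI[of _ "(\<lambda>q x. coeff (q x) 0) ` F"] conjI allI impI)
    show "(\<lambda>q x. coeff (q x) 0) ` F \<subseteq> A" using 0 by (auto simp: poly_over_def)
    fix x x' assume "\<forall>g\<in>(\<lambda>q x. coeff (q x) 0) ` F. sgn (g x) = sgn (g x')"
    with m c show "\<exists>\<sigma>. strict_mono \<sigma> \<and> surj \<sigma> \<and>
        (\<forall>q\<in>F. \<forall>y. sgn (poly (q x) y) = sgn (poly (q x') (\<sigma> y)))"
      by (intro exI[of _ "\<lambda>x. x"]) auto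
  qed (use 0 in auto)
next
  case (Suc d)
  \<comment> \<open>The inner induction removes polynomials of top degree one by one. Each removal
    may enlarge \<open>F0\<close> freely, since the outer hypothesis covers every finite family of
    smaller degree.\<close>
  have "signs_determined (F1 \<union> F0)"
    if "finite F1" "F1 \<subseteq> poly_over (Suc d)" "finite F0" "F0 \<subseteq> poly_over d" for F1 F0
    using that
  proof (induction F1 arbitrary: F0 rule: finite_induct)
    case empty
    then show ?case using Suc.IH by simp
  next
    case (insert q F1)
    have q: "q \<in> poly_over (Suc d)" using insert.prems by auto
    define dq where "dq = (\<lambda>x. pderiv (q x))"
    define tr where "tr = (\<lambda>x. poly_cutoff (Suc d) (q x))"
    have dq: "dq \<in> poly_over d" unfolding dq_def by (rule poly_over_pderiv[OF q])
    have tr: "tr \<in> poly_over d" unfolding tr_def by (rule poly_over_cutoff[OF q])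
    define F where "F = F1 \<union> F0 \<union> {dq}"
    have F: "finite F" "F \<subseteq> poly_over (Suc d)"
      using insert dq by (auto simp: F_def intro: poly_over_mono[where d = d])
    define rem where "rem p k r \<longleftrightarrow> r \<in> poly_over (k - 1) \<and> (\<forall>x y. degree (p x) = k \<and>
        poly (p x) y = 0 \<longrightarrow> sgn (poly (q x) y) = sgn (poly (r x) y))" for p k r
    define r where "r p k = (SOME r. rem p k r)" for p k
    have "rem p k (r p k)" if "p \<in> F" "k \<in> {1..Suc d}" for p k
    proof -
      have "\<exists>r. rem p k r"
        using pseudo_remainder[of p "Suc d" k q "Suc d"] that F q by (auto simp: rem_def)
      then show ?thesis unfolding r_def by (rule someI_ex)
    qed
    then have r1: "\<And>p k. p \<in> F \<Longrightarrow> k \<in> {1..Suc d} \<Longrightarrow> r p k \<in> poly_over (k - 1)"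
      and r2: "\<And>p k x y. p \<in> F \<Longrightarrow> k \<in> {1..Suc d} \<Longrightarrow> degree (p x) = k \<Longrightarrow> poly (p x) y = 0 \<Longrightarrow>
          sgn (poly (q x) y) = sgn (poly (r p k x) y)"
      by (simp_all add: rem_def)
    \<comment> \<open>The pseudo-remainders give the sign of \<open>q\<close> at the roots of each
      \<open>p\<close>. The degree of \<open>p x\<close> depends on \<open>x\<close>, so one is kept
      for each possible degree \<open>k\<close>.\<close>
    define F0' where "F0' = F0 \<union> {dq, tr} \<union> (\<lambda>(p, k). r p k) ` (F \<times> {1..Suc d})"
    have "r p k \<in> poly_over d" if "p \<in> F" "k \<in> {1..Suc d}" for p k
      using poly_over_mono[OF r1[OF that], of d] that by auto
    then have "finite F0'" "F0' \<subseteq> poly_over d"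
      using insert.prems F dq tr by (auto simp: F0'_def)
    with insert have "signs_determined (F1 \<union> F0')" by auto
    then obtain G0 where G0: "finite G0" "G0 \<subseteq> A"
      "\<And>x x'. (\<forall>g\<in>G0. sgn (g x) = sgn (g x')) \<Longrightarrow>
         \<exists>\<sigma>. strict_mono \<sigma> \<and> surj \<sigma> \<and> (\<forall>q\<in>F1 \<union> F0'. \<forall>y. sgn (poly (q x) y) = sgn (poly (q x') (\<sigma> y)))"
      unfolding signs_determined_def by blast
    \<comment> \<open>Signs of the coefficients tell which of them vanish. Hence the degrees at
      \<open>x\<close> and \<open>x'\<close> coincide, and the same pseudo-remainder applies at
      both.\<close>
    define G1 where "G1 = (\<lambda>(p, k) x. coeff (p x) k) ` (insert q F \<times> {..Suc d})"
    show ?case unfolding signs_determined_def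
    proof (intro exI[of _ "G0 \<union> G1"] conjI allI impI)
      show "finite (G0 \<union> G1)" using G0 F by (auto simp: G1_def)
      show "G0 \<union> G1 \<subseteq> A" using G0 F q by (auto simp: G1_def poly_over_def)
      fix x x' assume eq: "\<forall>g\<in>G0 \<union> G1. sgn (g x) = sgn (g x')"
      then obtain \<sigma> where \<sigma>: "strict_mono \<sigma>" "surj \<sigma>"
        "\<And>q y. q \<in> F1 \<union> F0' \<Longrightarrow> sgn (poly (q x) y) = sgn (poly (q x') (\<sigma> y))"
        using G0(3)[of x x'] by blast
      have co: "coeff (p x) k = 0 \<longleftrightarrow> coeff (p x') k = 0" if p: "p \<in> insert q F" for p k
      proof (cases "k \<le> Suc d")
        case True
        then have "(\<lambda>x. coeff (p x) k) \<in> G1" using p by (force simp: G1_def)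
        then have "sgn (coeff (p x) k) = sgn (coeff (p x') k)"
          using bspec[OF eq, of "\<lambda>x. coeff (p x) k"] by blast
        then show ?thesis by (metis sgn_zero_iff)
      next
        case False
        have "degree (p y) \<le> Suc d" for y using p q F by (auto simp: poly_over_def)
        with False have "coeff (p y) k = 0" for y by (intro coeff_eq_0) (meson le_trans not_le)
        then show ?thesis by simp
      qed
      have deg: "degree (p x) = degree (p x')" if "p \<in> insert q F" for p
        using co[OF that] by (simp add: degree_def)
      show "\<exists>\<sigma>. strict_mono \<sigma> \<and> surj \<sigma> \<and>
          (\<forall>p\<in>insert q F1 \<union> F0. \<forall>y. sgn (poly (p x) y) = sgn (poly (p x') (\<sigma> y)))"
      proof (cases "coeff (q x) (Suc d) = 0")
        \<comment> \<open>Where the top coefficient vanishes, \<open>q\<close> equals its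
          truncation, which \<open>\<sigma>\<close> already matches.\<close>
        case True
        have "q y = tr y" if "coeff (q y) (Suc d) = 0" for y
        proof (rule poly_eqI)
          fix i
          have "degree (q y) \<le> Suc d" using q by (auto simp: poly_over_def)
          then have "coeff (q y) i = 0" if "Suc d < i" using that by (intro coeff_eq_0) auto
          with that show "coeff (q y) i = coeff (tr y) i"
            by (cases i "Suc d" rule: linorder_cases) (auto simp: tr_def coeff_poly_cutoff)
        qed
        with True co[of q "Suc d"] have "q x = tr x" "q x' = tr x'" by auto
        with \<sigma> show ?thesis by (intro exI[of _ \<sigma>]) (auto simp: F0'_def)
      next
        case False
        have "\<exists>s. strict_mono s \<and> surj s \<and>
            (\<forall>p\<in>F. \<forall>y. sgn (poly (p x) y) = sgn (poly (p x') (s y))) \<and>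
            (\<forall>y. sgn (poly (q x) y) = sgn (poly (q x') (s y)))"
        proof (rule sign_diagram_insert[OF F(1) \<sigma>(1,2), of _ _ dq])
          show "sgn (poly (p x) y) = sgn (poly (p x') (\<sigma> y))" if "p \<in> F" for p y
            using that by (intro \<sigma>) (auto simp: F_def F0'_def)
          have "degree (q x) \<noteq> 0" using False by (metis coeff_eq_0 less_Suc_eq_0_disj)
          then show "pderiv (q x) \<noteq> 0" by (simp add: pderiv_eq_0_iff)
          show "sgn (poly (q x) y) = sgn (poly (q x') (\<sigma> y))"
            if p: "p \<in> F" "p x \<noteq> 0" "poly (p x) y = 0" for p y
          proof -
            have pF: "p \<in> F1 \<union> F0'" using p(1) by (auto simp: F_def F0'_def)
            have "degree (p x) \<noteq> 0"
            proof
              assume "degree (p x) = 0"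
              then obtain a where "p x = [:a:]" by (rule degree_eq_zeroE)
              with p show False by auto
            qed
            then have k: "degree (p x) \<in> {1..Suc d}" using F p by (force simp: poly_over_def)
            define k where "k = degree (p x)"
            have "poly (p x') (\<sigma> y) = 0" using \<sigma>(3)[OF pF, of y] p by (simp add: sgn_zero_iff)
            have "r p k \<in> F1 \<union> F0'" using p(1) k by (force simp: F0'_def k_def)
            have "sgn (poly (q x) y) = sgn (poly (r p k x) y)"
              using p k by (intro r2) (auto simp: k_def)
            also have "\<dots> = sgn (poly (r p k x') (\<sigma> y))" by (rule \<sigma>(3)) fact
            also have "\<dots> = sgn (poly (q x') (\<sigma> y))"
            proof (rule r2[symmetric])
              show "degree (p x') = k" using deg[of p] p(1) by (simp add: k_def)
            qed (use p(1) k k_def \<open>poly (p x') (\<sigma> y) = 0\<close> in auto)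
            finally show ?thesis .
          qed
        qed (auto simp: F_def dq_def)
        then show ?thesis by (auto simp: F_def)
      qed
    qed
  qed
  from this[of F "{}"] Suc.prems show ?case by simp
qed

end

section \<open>Semialgebraic predicates\<close>

interpretation real_polynomial: function_ring "Collect real_polynomial_function"
  by unfold_locales auto

text \<open>The coefficients are polynomials in the base point, so \<open>x\<close> becomes the
  parameter and \<open>t\<close> the variable to be eliminated.\<close>

lemma real_polynomial_along_line:
  assumes "real_polynomial_function f"
  shows "\<exists>d. \<exists>q\<in>real_polynomial.poly_over d. \<forall>x t. f (x + t *\<^sub>R b) = poly (q x) t"
  using assms
proof (induction f rule: real_polynomial_function.induct)
  case (linear f)
  interpret bounded_linear f by fact
  have "real_polynomial_function (\<lambda>x. coeff [:f x, f b:] i)" for i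
    using \<open>bounded_linear f\<close> by (cases i) (simp_all add: real_polynomial_function.intros(1,2))
  then have "(\<lambda>x. [:f x, f b:]) \<in> real_polynomial.poly_over 1"
    by (simp add: real_polynomial.poly_over_def)
  moreover have "f (x + t *\<^sub>R b) = poly [:f x, f b:] t" for x t
    by (simp add: add scaleR)
  ultimately show ?case by (intro exI[of _ 1] bexI[of _ "\<lambda>x. [:f x, f b:]"] allI)
next
  case (const c)
  have "(\<lambda>x. [:c:]) \<in> real_polynomial.poly_over 0"
    by (simp add: real_polynomial.poly_over_def real_polynomial_function.intros(2))
  moreover have "c = poly [:c:] t" for t by simp
  ultimately show ?case by (intro exI[of _ 0] bexI[of _ "\<lambda>x. [:c:]"] allI)
next
  case (add f g)
  then obtain d q e r where q: "q \<in> real_polynomial.poly_over d" "\<And>x t. f (x + t *\<^sub>R b) = poly (q x) t"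
    and r: "r \<in> real_polynomial.poly_over e" "\<And>x t. g (x + t *\<^sub>R b) = poly (r x) t" by blast
  have "(\<lambda>x. q x + r x) \<in> real_polynomial.poly_over (max d e)"
    using real_polynomial.poly_over_mono[OF q(1), of "max d e"]
      real_polynomial.poly_over_mono[OF r(1), of "max d e"]
    by (simp add: real_polynomial.poly_over_def degree_add_le real_polynomial_function.intros(3))
  moreover have "f (x + t *\<^sub>R b) + g (x + t *\<^sub>R b) = poly (q x + r x) t" for x t
    using q(2) r(2) by simp
  ultimately show ?case by (intro exI[of _ "max d e"] bexI[of _ "\<lambda>x. q x + r x"] allI)
next
  case (mult f g)
  then obtain d q e r where q: "q \<in> real_polynomial.poly_over d" "\<And>x t. f (x + t *\<^sub>R b) = poly (q x) t"
    and r: "r \<in> real_polynomial.poly_over e" "\<And>x t. g (x + t *\<^sub>R b) = poly (r x) t" by blast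
  have "degree (q x * r x) \<le> d + e" for x
    using q(1) r(1) order_trans[OF degree_mult_le add_mono, of "q x" d "r x" e]
    by (simp add: real_polynomial.poly_over_def)
  moreover have "real_polynomial_function (\<lambda>x. coeff (q x * r x) i)" for i
    using q(1) r(1) unfolding coeff_mult real_polynomial.poly_over_def
    by (intro real_polynomial_function_sum real_polynomial_function.intros(4)) simp_all
  ultimately have "(\<lambda>x. q x * r x) \<in> real_polynomial.poly_over (d + e)"
    by (simp add: real_polynomial.poly_over_def)
  moreover have "f (x + t *\<^sub>R b) * g (x + t *\<^sub>R b) = poly (q x * r x) t" for x t
    using q(2) r(2) by simp
  ultimately show ?case by (intro exI[of _ "d + e"] bexI[of _ "\<lambda>x. q x * r x"] allI)
qed

text \<open>A predicate is semialgebraic if its truth value depends only on the signs of finitely many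
  polynomials; in this form the Boolean closure properties are immediate.\<close>

definition semialg :: "('a::euclidean_space \<Rightarrow> bool) \<Rightarrow> bool" where
  "semialg P \<longleftrightarrow> (\<exists>G. finite G \<and> (\<forall>g\<in>G. real_polynomial_function g) \<and>
     (\<forall>x y. (\<forall>g\<in>G. sgn (g x) = sgn (g y)) \<longrightarrow> P x = P y))"

lemma semialg_const [intro, simp]: "semialg (\<lambda>x. c)"
  by (auto simp: semialg_def)

lemma semialg_not [intro]: "semialg P \<Longrightarrow> semialg (\<lambda>x. \<not> P x)"
  by (simp add: semialg_def)

lemma semialg_binary:
  assumes "semialg P" "semialg Q"
  shows "semialg (\<lambda>x. c (P x) (Q x))"
proof -
  from assms(1) obtain G where G: "finite G" "\<forall>g\<in>G. real_polynomial_function g"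
    "\<And>x y. (\<forall>g\<in>G. sgn (g x) = sgn (g y)) \<Longrightarrow> P x = P y" unfolding semialg_def by blast
  from assms(2) obtain H where H: "finite H" "\<forall>g\<in>H. real_polynomial_function g"
    "\<And>x y. (\<forall>g\<in>H. sgn (g x) = sgn (g y)) \<Longrightarrow> Q x = Q y" unfolding semialg_def by blast
  show ?thesis unfolding semialg_def
  proof (intro exI[of _ "G \<union> H"] conjI allI impI)
    fix x y assume eq: "\<forall>g\<in>G \<union> H. sgn (g x) = sgn (g y)"
    then have "P x = P y" "Q x = Q y" by (intro G(3) H(3); blast)+
    then show "c (P x) (Q x) = c (P y) (Q y)" by simp
  qed (use G H in auto)
qed

lemma semialg_conj [intro]: "semialg P \<Longrightarrow> semialg Q \<Longrightarrow> semialg (\<lambda>x. P x \<and> Q x)"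
  by (rule semialg_binary)

lemma semialg_disj [intro]: "semialg P \<Longrightarrow> semialg Q \<Longrightarrow> semialg (\<lambda>x. P x \<or> Q x)"
  by (rule semialg_binary)

lemma semialg_imp [intro]: "semialg P \<Longrightarrow> semialg Q \<Longrightarrow> semialg (\<lambda>x. P x \<longrightarrow> Q x)"
  by (rule semialg_binary)

lemma semialg_less [intro]:
  assumes "real_polynomial_function f" "real_polynomial_function g"
  shows "semialg (\<lambda>x. f x < g x)"
  unfolding semialg_def
proof (intro exI[of _ "{\<lambda>x. f x - g x}"] conjI allI impI)
  fix x y assume "\<forall>h\<in>{\<lambda>x. f x - g x}. sgn (h x) = sgn (h y)"
  then show "(f x < g x) = (f y < g y)" by (simp add: sgn_real_def split: if_splits)
qed (use assms in auto)

lemma semialg_le [intro]: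
  assumes "real_polynomial_function f" "real_polynomial_function g"
  shows "semialg (\<lambda>x. f x \<le> g x)"
  using semialg_not[OF semialg_less[OF assms(2,1)]] by (simp add: not_less)

lemma semialg_eq [intro]:
  assumes "real_polynomial_function f" "real_polynomial_function g"
  shows "semialg (\<lambda>x. f x = g x)"
  using semialg_conj[OF semialg_le[OF assms] semialg_le[OF assms(2,1)]] by (simp add: eq_iff)

lemma semialg_finite_Ball:
  assumes "finite I" "\<And>i. i \<in> I \<Longrightarrow> semialg (P i)"
  shows "semialg (\<lambda>x. \<forall>i\<in>I. P i x)"
  using assms by (induction I rule: finite_induct) (simp_all add: semialg_conj)

lemma semialg_compose:
  assumes "semialg P" "polynomial_function f"
  shows "semialg (\<lambda>x. P (f x))"
proof -
  from assms(1) obtain G where G: "finite G" "\<forall>g\<in>G. real_polynomial_function g"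
    "\<And>x y. (\<forall>g\<in>G. sgn (g x) = sgn (g y)) \<Longrightarrow> P x = P y" unfolding semialg_def by blast
  show ?thesis unfolding semialg_def
  proof (intro exI[of _ "(\<lambda>g. g \<circ> f) ` G"] conjI ballI allI impI)
    fix x y assume "\<forall>h\<in>(\<lambda>g. g \<circ> f) ` G. sgn (h x) = sgn (h y)"
    then show "P (f x) = P (f y)" by (intro G(3)) auto
  qed (use G assms in \<open>auto intro: real_polynomial_function_compose\<close>)
qed

text \<open>If \<open>x\<close> and \<open>y\<close> give the same signs to the parameter
  polynomials, the reparametrisation carries a witness \<open>t\<close> on the line through
  \<open>x\<close> to a witness \<open>\<sigma> t\<close> on the line through
  \<open>y\<close>.\<close>

lemma semialg_ex_line:
  assumes "semialg P"
  shows "semialg (\<lambda>x. \<exists>t::real. P (x + t *\<^sub>R b))"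
proof -
  from assms obtain G where G: "finite G" "\<forall>g\<in>G. real_polynomial_function g"
    "\<And>x y. (\<forall>g\<in>G. sgn (g x) = sgn (g y)) \<Longrightarrow> P x = P y" unfolding semialg_def by blast
  have "\<forall>g\<in>G. \<exists>d q. q \<in> real_polynomial.poly_over d \<and> (\<forall>x t. g (x + t *\<^sub>R b) = poly (q x) t)"
    using G(2) real_polynomial_along_line by blast
  then obtain d q where q: "\<And>g. g \<in> G \<Longrightarrow> q g \<in> real_polynomial.poly_over (d g)"
    "\<And>g x t. g \<in> G \<Longrightarrow> g (x + t *\<^sub>R b) = poly (q g x) t" by metis
  have "q ` G \<subseteq> real_polynomial.poly_over (\<Sum>g\<in>G. d g)"
    using real_polynomial.poly_over_mono[OF q(1)] member_le_sum[OF _ _ G(1), of _ d] by blast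
  with G(1) have "real_polynomial.signs_determined (q ` G)"
    by (intro real_polynomial.signs_determined) auto
  then obtain H where H: "finite H" "H \<subseteq> Collect real_polynomial_function"
    "\<And>x x'. (\<forall>g\<in>H. sgn (g x) = sgn (g x')) \<Longrightarrow>
       \<exists>\<sigma>. strict_mono \<sigma> \<and> surj \<sigma> \<and> (\<forall>p\<in>q ` G. \<forall>y. sgn (poly (p x) y) = sgn (poly (p x') (\<sigma> y)))"
    unfolding real_polynomial.signs_determined_def by blast
  have step: "\<exists>t. P (y + t *\<^sub>R b)" if eq: "\<forall>g\<in>H. sgn (g x) = sgn (g y)" and P: "P (x + t *\<^sub>R b)" for x y t
  proof -
    obtain \<sigma> where \<sigma>: "\<forall>p\<in>q ` G. \<forall>t. sgn (poly (p x) t) = sgn (poly (p y) (\<sigma> t))"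
      using H(3)[OF eq] by blast
    have "P (x + t *\<^sub>R b) = P (y + \<sigma> t *\<^sub>R b)" using \<sigma> q(2) by (intro G(3)) auto
    with P show ?thesis by blast
  qed
  show ?thesis unfolding semialg_def
  proof (intro exI[of _ H] conjI allI impI)
    fix x y assume eq: "\<forall>g\<in>H. sgn (g x) = sgn (g y)"
    then have "\<forall>g\<in>H. sgn (g y) = sgn (g x)" by simp
    with eq show "(\<exists>t. P (x + t *\<^sub>R b)) = (\<exists>t. P (y + t *\<^sub>R b))"
      using step by blast
  qed (use H in auto)
qed

lemma semialg_ex_span:
  assumes "finite B" "semialg P"
  shows "semialg (\<lambda>x. \<exists>v\<in>span B. P (x + v))"
  using assms
proof (induction B arbitrary: P rule: finite_induct)
  case empty
  then show ?case by simp
next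
  case (insert b B)
  have "(\<exists>v\<in>span (insert b B). P (x + v)) \<longleftrightarrow> (\<exists>t. \<exists>v\<in>span B. P (x + t *\<^sub>R b + v))" for x
  proof safe
    fix v assume "v \<in> span (insert b B)" "P (x + v)"
    then obtain k where "v - k *\<^sub>R b \<in> span B" by (auto simp: span_insert)
    with \<open>P (x + v)\<close> show "\<exists>t. \<exists>v\<in>span B. P (x + t *\<^sub>R b + v)"
      by (intro exI[of _ k] bexI[of _ "v - k *\<^sub>R b"]) auto
  next
    fix t v assume "v \<in> span B" "P (x + t *\<^sub>R b + v)"
    then show "\<exists>v\<in>span (insert b B). P (x + v)"
      by (intro bexI[of _ "t *\<^sub>R b + v"]) (auto simp: span_insert add.assoc intro!: exI[of _ t])
  qed
  then show ?case using semialg_ex_line[OF insert.IH[OF insert.prems], of b] by simp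
qed

text \<open>A quantifier over \<open>y\<close> ranges over displacements of \<open>(x, 0)\<close> in
  a subspace spanned by finitely many directions, and each direction is eliminated as a
  line.\<close>

theorem semialg_ex:
  fixes P :: "'a::euclidean_space \<Rightarrow> 'b::euclidean_space \<Rightarrow> bool"
  assumes "semialg (\<lambda>z. P (fst z) (snd z))"
  shows "semialg (\<lambda>x. \<exists>y. P x y)"
proof -
  define B where "B = Pair (0::'a) ` (Basis :: 'b set)"
  have in_span: "(0, y) \<in> span B" for y
  proof -
    have "(0, y) = (\<Sum>b\<in>Basis. (y \<bullet> b) *\<^sub>R (0, b))"
      by (simp add: prod_eq_iff fst_sum snd_sum euclidean_representation)
    also have "\<dots> \<in> span B" by (intro span_sum span_scale span_base) (auto simp: B_def)
    finally show ?thesis .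
  qed
  have "span B \<subseteq> {v. fst v = 0}"
    by (rule span_minimal) (auto simp: B_def subspace_def)
  then have "(\<exists>v\<in>span B. P (fst ((x, 0) + v)) (snd ((x, 0) + v))) \<longleftrightarrow> (\<exists>y. P x y)" for x
    using in_span by force
  moreover have "semialg (\<lambda>z. \<exists>v\<in>span B. P (fst (z + v)) (snd (z + v)))"
    using semialg_ex_span[OF _ assms, of B] by (simp add: B_def)
  then have "semialg (\<lambda>x. \<exists>v\<in>span B. P (fst ((x, 0) + v)) (snd ((x, 0) + v)))"
    by (rule semialg_compose)
      (auto intro!: polynomial_function_bounded_linear bounded_linear_Pair bounded_linear_ident bounded_linear_zero)
  ultimately show ?thesis by simp
qed

lemma semialg_all:
  fixes P :: "'a::euclidean_space \<Rightarrow> 'b::euclidean_space \<Rightarrow> bool"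
  assumes "semialg (\<lambda>z. P (fst z) (snd z))"
  shows "semialg (\<lambda>x. \<forall>y. P x y)"
  using semialg_not[OF semialg_ex[OF semialg_not[OF assms]]] by simp

lemma semialg_finite_Union:
  assumes "finite I" "\<And>i. i \<in> I \<Longrightarrow> semialg (P i)"
  shows "semialg (\<lambda>x. \<exists>i\<in>I. P i x)"
  using semialg_not[OF semialg_finite_Ball[of I "\<lambda>i x. \<not> P i x"]] assms by (simp add: semialg_not)

lemma semialgebraic_set_imp_semialg:
  assumes "semialgebraic_set S"
  shows "semialg (\<lambda>x. x \<in> S)"
proof -
  have basic: "semialg (\<lambda>x. x \<in> B)" if "basic_semialgebraic_set B" for B :: "'a set"
  proof -
    from that obtain P Q where PQ: "finite P" "finite Q" "\<And>p. p \<in> P \<union> Q \<Longrightarrow> real_polynomial_function p"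
      "B = {z. (\<forall>p\<in>P. p z = 0) \<and> (\<forall>q\<in>Q. q z < 0)}"
      unfolding basic_semialgebraic_set_def by blast
    then show ?thesis
      by (auto intro!: semialg_conj semialg_finite_Ball semialg_eq semialg_less)
  qed
  from assms obtain \<B> where "finite \<B>" "\<And>B. B \<in> \<B> \<Longrightarrow> basic_semialgebraic_set B" "S = \<Union>\<B>"
    unfolding semialgebraic_set_def by blast
  with basic show ?thesis using semialg_finite_Union[of \<B> "\<lambda>B x. x \<in> B"] by simp
qed


section \<open>Polynomial maps, and closure rules for formulas built from them\<close>

lemma polynomial_function_fst: "polynomial_function f \<Longrightarrow> polynomial_function (\<lambda>z. fst (f z))"
  using polynomial_function_compose[OF _ polynomial_function_bounded_linear[OF bounded_linear_fst], of f]
  by (simp add: o_def)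

lemma polynomial_function_snd: "polynomial_function f \<Longrightarrow> polynomial_function (\<lambda>z. snd (f z))"
  using polynomial_function_compose[OF _ polynomial_function_bounded_linear[OF bounded_linear_snd], of f]
  by (simp add: o_def)

lemma polynomial_function_Pair:
  assumes "polynomial_function f" "polynomial_function g"
  shows "polynomial_function (\<lambda>z. (f z, g z))"
  unfolding polynomial_function_def
proof (intro allI impI)
  fix h :: "'b \<times> 'c \<Rightarrow> real" assume h: "bounded_linear h"
  have "bounded_linear (\<lambda>u. h (u, 0))" "bounded_linear (\<lambda>u. h (0, u))"
    using bounded_linear_compose[OF h] bounded_linear_Pair bounded_linear_ident bounded_linear_zero
    by blast+
  then have "real_polynomial_function (\<lambda>z. h (f z, 0) + h (0, g z))"
    using assms by (intro real_polynomial_function.intros(3)) (auto simp: polynomial_function_def o_def)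
  moreover have "h (f z, g z) = h (f z, 0) + h (0, g z)" for z
    using bounded_linear.linear[OF h] by (simp flip: linear_add)
  ultimately show "real_polynomial_function (h \<circ> (\<lambda>z. (f z, g z)))" by (simp add: o_def)
qed

lemma polynomial_function_inner:
  fixes f g :: "'a::euclidean_space \<Rightarrow> 'b::euclidean_space"
  assumes "polynomial_function f" "polynomial_function g"
  shows "polynomial_function (\<lambda>z. f z \<bullet> g z)"
proof -
  have comp: "polynomial_function (\<lambda>z. k z \<bullet> b)" if "polynomial_function k" for k :: "'a \<Rightarrow> 'b" and b
    using polynomial_function_compose[OF that polynomial_function_bounded_linear[OF bounded_linear_inner_left]]
    by (simp add: o_def)
  have "polynomial_function (\<lambda>z. \<Sum>b\<in>Basis. (f z \<bullet> b) *\<^sub>R (g z \<bullet> b))"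
    by (intro polynomial_function_sum polynomial_function_mult comp assms) simp
  moreover have "f z \<bullet> g z = (\<Sum>b\<in>Basis. (f z \<bullet> b) *\<^sub>R (g z \<bullet> b))" for z
    by (subst euclidean_inner) simp
  ultimately show ?thesis by presburger
qed

lemma polynomial_function_times:
  fixes f g :: "'a::euclidean_space \<Rightarrow> real"
  shows "polynomial_function f \<Longrightarrow> polynomial_function g \<Longrightarrow> polynomial_function (\<lambda>z. f z * g z)"
  using polynomial_function_mult[of f g] by simp

lemma polynomial_function_norm_power2:
  fixes f :: "'a::euclidean_space \<Rightarrow> 'b::euclidean_space"
  shows "polynomial_function f \<Longrightarrow> polynomial_function (\<lambda>z. (norm (f z))\<^sup>2)"
  using polynomial_function_inner[of f f] by (simp add: power2_norm_eq_inner)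

lemma semialg_less_poly:
  assumes "polynomial_function f" "polynomial_function g"
  shows "semialg (\<lambda>x. f x < (g x :: real))"
  using assms by (intro semialg_less) (simp_all add: real_polynomial_function_eq)

lemma semialg_le_poly:
  assumes "polynomial_function f" "polynomial_function g"
  shows "semialg (\<lambda>x. f x \<le> (g x :: real))"
  using assms by (intro semialg_le) (simp_all add: real_polynomial_function_eq)

lemma semialg_eq_poly:
  assumes "polynomial_function f" "polynomial_function g"
  shows "semialg (\<lambda>x. f x = (g x :: real))"
  using assms by (intro semialg_eq) (simp_all add: real_polynomial_function_eq)

lemma semialg_compose2:
  assumes "semialg (\<lambda>z. R (fst z) (snd z))" "polynomial_function f" "polynomial_function g"
  shows "semialg (\<lambda>z. R (f z) (g z))"
  using semialg_compose[OF assms(1) polynomial_function_Pair[OF assms(2,3)]] by simp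

lemma semialg_compose3:
  assumes "semialg (\<lambda>z. R (fst z) (fst (snd z)) (snd (snd z)))"
    "polynomial_function f" "polynomial_function g" "polynomial_function h"
  shows "semialg (\<lambda>z. R (f z) (g z) (h z))"
  using semialg_compose[OF assms(1) polynomial_function_Pair[OF assms(2) polynomial_function_Pair[OF assms(3,4)]]]
  by simp

lemmas polynomial_intros = polynomial_function_id polynomial_function_const polynomial_function_fst
  polynomial_function_snd polynomial_function_Pair polynomial_function_add polynomial_function_diff
  polynomial_function_minus polynomial_function_times polynomial_function_inner
  polynomial_function_norm_power2

lemmas semialg_intros = semialg_ex semialg_all semialg_conj semialg_disj semialg_imp semialg_not
  semialg_less_poly semialg_le_poly semialg_eq_poly

section \<open>Semialgebraic functions of one variable\<close>

lemma poly_sgn_at_right: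
  fixes p :: "real poly"
  shows "\<exists>c. \<forall>\<^sub>F t in at_right a. sgn (poly p t) = c"
proof (cases "p = 0")
  case False
  have "finite {t. poly p t = 0 \<and> a < t}"
    using poly_roots_finite[OF False] by (rule rev_finite_subset) auto
  define b where "b = Min (insert (a + 1) {t. poly p t = 0 \<and> a < t})"
  have b: "a < b" and nr: "poly p t \<noteq> 0" if "a < t" "t < b" for t
    using that Min_le[of "insert (a + 1) {t. poly p t = 0 \<and> a < t}" t] \<open>finite _\<close>
    by (auto simp: b_def)
  have b: "a < b" using \<open>finite {t. poly p t = 0 \<and> a < t}\<close> by (auto simp: b_def)
  define m where "m = (a + b) / 2"
  have m: "a < m" "m < b" using b by (auto simp: m_def)
  have "sgn (poly p t) = sgn (poly p m)" if t: "a < t" "t < b" for t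
  proof -
    have no: "poly p u \<noteq> 0" if "u \<in> {min m t..max m t}" for u
      using that m t nr[of u] by (auto simp: min_def max_def split: if_splits)
    have "0 < poly p t" if "0 < poly p m" using poly_same_sign_of_no_root[OF that no] .
    moreover have "0 < poly (- p) t" if "0 < poly (- p) m"
      by (rule poly_same_sign_of_no_root[OF that]) (use no in simp)
    moreover have "poly p m \<noteq> 0" using nr m by blast
    ultimately show ?thesis by (cases "0 < poly p m") auto
  qed
  then show ?thesis using b by (auto simp: eventually_at_right_field)
qed (auto)

text \<open>Just to the right of a point each of finitely many polynomials has a constant sign, and
  these signs decide \<open>P\<close>. This is the one-variable face of o-minimality.\<close>

lemma semialg_at_right:
  fixes P :: "real \<Rightarrow> bool"
  assumes "semialg P"
  shows "(\<forall>\<^sub>F t in at_right a. P t) \<or> (\<forall>\<^sub>F t in at_right a. \<not> P t)"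
proof -
  from assms obtain G where G: "finite G" "\<forall>g\<in>G. real_polynomial_function g"
    "\<And>x y. (\<forall>g\<in>G. sgn (g x) = sgn (g y)) \<Longrightarrow> P x = P y" unfolding semialg_def by blast
  have "\<exists>c. \<forall>\<^sub>F t in at_right a. sgn (g t) = c" if g: "g \<in> G" for g
  proof -
    obtain q where "\<And>x t. g (x + t *\<^sub>R 1) = poly (q x) t"
      using real_polynomial_along_line[of g 1] G(2) g by blast
    from this[of 0] have "g = poly (q 0)" by auto
    then show ?thesis using poly_sgn_at_right by simp
  qed
  then obtain c where "\<forall>g\<in>G. \<forall>\<^sub>F t in at_right a. sgn (g t) = c g" by metis
  with G(1) have ev: "\<forall>\<^sub>F t in at_right a. \<forall>g\<in>G. sgn (g t) = c g" by (simp add: eventually_ball_finite)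
  then obtain s where s: "\<forall>g\<in>G. sgn (g s) = c g"
    using eventually_happens'[of "at_right a"] by (auto simp: trivial_limit_at_right_real)
  have "\<forall>\<^sub>F t in at_right a. P t = P s"
    using ev by eventually_elim (rule G(3), use s in simp)
  then show ?thesis by (cases "P s") auto
qed

lemma semialg_at_left:
  fixes P :: "real \<Rightarrow> bool"
  assumes "semialg P"
  shows "(\<forall>\<^sub>F t in at_left a. P t) \<or> (\<forall>\<^sub>F t in at_left a. \<not> P t)"
proof -
  have "semialg (\<lambda>t. P (- t))"
    by (rule semialg_compose[OF assms]) (intro polynomial_intros)
  from semialg_at_right[OF this, of "- a"] show ?thesis
    by (simp add: at_left_minus[of a] eventually_filtermap)
qed

section \<open>Monotonicity near 0 of functions with semialgebraic graph\<close>

lemma locally_mono_imp_mono: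
  fixes f :: "real \<Rightarrow> real"
  assumes "s \<le> t"
    and right: "\<And>x. s \<le> x \<Longrightarrow> x \<le> t \<Longrightarrow> \<forall>\<^sub>F u in at_right x. f x \<le> f u"
    and left: "\<And>x. s \<le> x \<Longrightarrow> x \<le> t \<Longrightarrow> \<forall>\<^sub>F u in at_left x. f u \<le> f x"
  shows "f s \<le> f t"
  using assms(1)
proof (induction rule: Bolzano)
  case (local x)
  obtain b where b: "x < b" "\<And>u. x < u \<Longrightarrow> u < b \<Longrightarrow> f x \<le> f u"
    using right[OF local] by (auto simp: eventually_at_right_field)
  obtain a where a: "a < x" "\<And>u. a < u \<Longrightarrow> u < x \<Longrightarrow> f u \<le> f x"
    using left[OF local] by (auto simp: eventually_at_left_field)
  have "f u \<le> f v" if "u \<le> x" "x \<le> v" "v - u < min (b - x) (x - a)" for u v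
  proof -
    have "f u \<le> f x" using that a(2)[of u] by (cases "u = x") auto
    also have "f x \<le> f v" using that b(2)[of v] by (cases "v = x") auto
    finally show ?thesis .
  qed
  with a b show ?case by (intro exI[of _ "min (b - x) (x - a)"]) auto
qed auto

text \<open>Strict local minima are countable: assign to each a rational interval on which it is the
  strict minimum. Two points with the same interval would each lie strictly below the other.\<close>

lemma not_strict_local_min_everywhere:
  fixes f :: "real \<Rightarrow> real"
  assumes "a < b"
  shows "\<exists>s\<in>{a<..<b}. \<not> ((\<forall>\<^sub>F u in at_right s. f s < f u) \<and> (\<forall>\<^sub>F u in at_left s. f s < f u))"
proof (rule ccontr)
  assume "\<not> ?thesis"
  then have loc: "\<And>s. s \<in> {a<..<b} \<Longrightarrow> (\<forall>\<^sub>F u in at_right s. f s < f u) \<and> (\<forall>\<^sub>F u in at_left s. f s < f u)"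
    by blast
  have "\<exists>p :: rat \<times> rat. of_rat (fst p) < s \<and> s < of_rat (snd p) \<and>
      (\<forall>u. of_rat (fst p) < u \<and> u < of_rat (snd p) \<and> u \<noteq> s \<longrightarrow> f s < f u)" if s: "s \<in> {a<..<b}" for s
  proof -
    obtain d where d: "s < d" "\<And>u. s < u \<Longrightarrow> u < d \<Longrightarrow> f s < f u"
      using loc[OF s] by (auto simp: eventually_at_right_field)
    obtain c where c: "c < s" "\<And>u. c < u \<Longrightarrow> u < s \<Longrightarrow> f s < f u"
      using loc[OF s] by (auto simp: eventually_at_left_field)
    obtain p q where "c < of_rat p" "of_rat p < s" "s < of_rat q" "of_rat q < d"
      using of_rat_dense[OF c(1)] of_rat_dense[OF d(1)] by blast
    with c d show ?thesis by (intro exI[of _ "(p, q)"]) (auto, metis less_trans linorder_neqE)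
  qed
  then obtain p where p: "\<And>s. s \<in> {a<..<b} \<Longrightarrow> of_rat (fst (p s)) < s \<and> s < of_rat (snd (p s)) \<and>
      (\<forall>u. of_rat (fst (p s :: rat \<times> rat)) < u \<and> u < of_rat (snd (p s)) \<and> u \<noteq> s \<longrightarrow> f s < f u)" by metis
  have "inj_on p {a<..<b}"
  proof (rule inj_onI, rule ccontr)
    fix s t assume st: "s \<in> {a<..<b}" "t \<in> {a<..<b}" "p s = p t" "s \<noteq> t"
    have "f s < f t" using p[OF st(1)] p[OF st(2)] st by auto
    moreover have "f t < f s" using p[OF st(1)] p[OF st(2)] st by auto
    ultimately show False by simp
  qed
  moreover have "countable (p ` {a<..<b})" by (rule countableI_type)
  ultimately have "countable {a<..<b}" by (rule countable_image_inj_on[rotated])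
  with uncountable_open_interval[of a b] assms show False by simp
qed

text \<open>The sign of the increment of \<open>f\<close> just to the right of \<open>s\<close>, and
  just to the left, is a semialgebraic property of \<open>s\<close>; so near 0 both signs are
  constant. They must agree, and then local monotonicity becomes global.\<close>

theorem semialg_fun_eventually_monotone:
  fixes f :: "real \<Rightarrow> real"
  assumes "semialg (\<lambda>z. snd z = f (fst z))"
  obtains d where "0 < d"
    "(\<forall>s t. 0 < s \<and> s \<le> t \<and> t < d \<longrightarrow> f s \<le> f t) \<or> (\<forall>s t. 0 < s \<and> s \<le> t \<and> t < d \<longrightarrow> f t \<le> f s)"
proof -
  define F where "F s y \<longleftrightarrow> y = f s" for s y
  have F: "semialg (\<lambda>z. F (u z) (v z))" if "polynomial_function u" "polynomial_function v"
    for u v :: "'z::euclidean_space \<Rightarrow> real"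
    using semialg_compose2[of F, OF _ that] assms by (simp add: F_def)
  have cmp: "semialg (\<lambda>z. sgn (f (v z) - f (u z)) = c)"
    if "polynomial_function u" "polynomial_function v" for u v :: "'z::euclidean_space \<Rightarrow> real" and c
  proof -
    have "semialg (\<lambda>z. \<exists>x y. F (u z) x \<and> F (v z) y \<and> (x < y \<and> c = 1 \<or> x = y \<and> c = 0 \<or> y < x \<and> c = -1))"
      by (intro semialg_intros F polynomial_intros polynomial_function_compose[OF _ that(1), unfolded o_def]
        polynomial_function_compose[OF _ that(2), unfolded o_def] polynomial_function_const)
    then show ?thesis by (rule back_subst[of semialg]) (auto simp: F_def fun_eq_iff sgn_real_def)
  qed
  define R where "R c s \<longleftrightarrow> (\<forall>\<^sub>F u in at_right s. sgn (f u - f s) = c)" for c s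
  define L where "L c s \<longleftrightarrow> (\<forall>\<^sub>F u in at_left s. sgn (f s - f u) = c)" for c s
  have semialg_R: "semialg (R c)" for c
  proof -
    have "semialg (\<lambda>s. \<exists>b. s < b \<and> (\<forall>u. s < u \<and> u < b \<longrightarrow> sgn (f u - f s) = c))"
      by (intro semialg_intros cmp polynomial_intros)
    then show ?thesis
      by (rule back_subst[of semialg]) (auto simp: R_def fun_eq_iff eventually_at_right_field)
  qed
  have semialg_L: "semialg (L c)" for c
  proof -
    have "semialg (\<lambda>s. \<exists>b. b < s \<and> (\<forall>u. b < u \<and> u < s \<longrightarrow> sgn (f s - f u) = c))"
      by (intro semialg_intros cmp polynomial_intros)
    then show ?thesis
      by (rule back_subst[of semialg]) (auto simp: L_def fun_eq_iff eventually_at_left_field)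
  qed
  have sgn_cases: "sgn x = -1 \<or> sgn x = 0 \<or> sgn x = 1" for x :: real by (simp add: sgn_real_def)
  have ex_R: "R (-1) s \<or> R 0 s \<or> R 1 s" for s
  proof (rule ccontr)
    assume "\<not> ?thesis"
    moreover have "R c s \<or> (\<forall>\<^sub>F u in at_right s. sgn (f u - f s) \<noteq> c)" for c
      unfolding R_def by (intro semialg_at_right cmp polynomial_intros)
    ultimately have "\<forall>\<^sub>F u in at_right s. sgn (f u - f s) \<noteq> -1 \<and> sgn (f u - f s) \<noteq> 0 \<and> sgn (f u - f s) \<noteq> 1"
      by (auto intro!: eventually_conj)
    then have "\<forall>\<^sub>F u in at_right s. False" by eventually_elim (use sgn_cases in blast)
    then show False by (simp add: trivial_limit_at_right_real)
  qed
  have ex_L: "L (-1) s \<or> L 0 s \<or> L 1 s" for s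
  proof (rule ccontr)
    assume "\<not> ?thesis"
    moreover have "L c s \<or> (\<forall>\<^sub>F u in at_left s. sgn (f s - f u) \<noteq> c)" for c
      unfolding L_def by (intro semialg_at_left cmp polynomial_intros)
    ultimately have "\<forall>\<^sub>F u in at_left s. sgn (f s - f u) \<noteq> -1 \<and> sgn (f s - f u) \<noteq> 0 \<and> sgn (f s - f u) \<noteq> 1"
      by (auto intro!: eventually_conj)
    then have "\<forall>\<^sub>F u in at_left s. False" by eventually_elim (use sgn_cases in blast)
    then show False by (simp add: trivial_limit_at_left_real)
  qed
  have ev: "\<exists>c\<in>{-1, 0, 1}. \<forall>\<^sub>F s in at_right (0::real). T c s"
    if T: "\<And>c. semialg (T c)" "\<And>s. T (-1) s \<or> T 0 s \<or> T 1 s" for T :: "real \<Rightarrow> real \<Rightarrow> bool"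
  proof (rule ccontr)
    assume "\<not> ?thesis"
    then have "\<forall>\<^sub>F s in at_right 0. \<not> T (-1) s" "\<forall>\<^sub>F s in at_right 0. \<not> T 0 s" "\<forall>\<^sub>F s in at_right 0. \<not> T 1 s"
      using semialg_at_right[OF T(1)] by auto
    then have "\<forall>\<^sub>F s in at_right (0::real). False" by eventually_elim (use T(2) in blast)
    then show False by (simp add: trivial_limit_at_right_real)
  qed
  obtain c c' where c: "c \<in> {-1, 0, 1}" "\<forall>\<^sub>F s in at_right 0. R c s"
    and c': "c' \<in> {-1, 0, 1}" "\<forall>\<^sub>F s in at_right 0. L c' s"
    using ev[OF semialg_R ex_R] ev[OF semialg_L ex_L] by blast
  from eventually_conj[OF c(2) c'(2)] obtain d where d: "0 < d"
    "\<And>s. 0 < s \<Longrightarrow> s < d \<Longrightarrow> R c s \<and> L c' s" by (auto simp: eventually_at_right_field)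
  \<comment> \<open>A function constant on one side of \<open>s\<close> has zero increments on both
    sides at any point inside that interval.\<close>
  have z: "c = 0 \<longleftrightarrow> c' = 0"
  proof -
    define s where "s = d / 2"
    have s: "0 < s" "s < d" using d by (auto simp: s_def)
    have "c' = 0" if c0: "c = 0"
    proof -
      obtain b where b: "s < b" "\<And>u. s < u \<Longrightarrow> u < b \<Longrightarrow> f u = f s"
        using d(2)[OF s] c0 by (auto simp: R_def eventually_at_right_field sgn_zero_iff)
      define u where "u = (s + min b d) / 2"
      have u: "s < u" "u < b" "u < d" "0 < u" using b s by (auto simp: u_def min_def)
      have "\<forall>\<^sub>F v in at_left u. sgn (f u - f v) = 0"
        unfolding eventually_at_left_field
        by (rule exI[of _ s]) (use u b in auto)
      moreover have "\<forall>\<^sub>F v in at_left u. sgn (f u - f v) = c'" using d(2)[of u] u by (simp add: L_def)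
      ultimately have "\<forall>\<^sub>F v in at_left u. c' = 0" by eventually_elim simp
      then show ?thesis by (simp add: trivial_limit_at_left_real)
    qed
    moreover have "c = 0" if c0: "c' = 0"
    proof -
      obtain b where b: "b < s" "\<And>u. b < u \<Longrightarrow> u < s \<Longrightarrow> f u = f s"
        using d(2)[OF s] c0 by (auto simp: L_def eventually_at_left_field sgn_zero_iff)
      define u where "u = (s + max b 0) / 2"
      have u: "u < s" "b < u" "u < d" "0 < u" using b s by (auto simp: u_def max_def)
      have "\<forall>\<^sub>F v in at_right u. sgn (f v - f u) = 0"
        unfolding eventually_at_right_field
        by (rule exI[of _ s]) (use u b in auto)
      moreover have "\<forall>\<^sub>F v in at_right u. sgn (f v - f u) = c" using d(2)[of u] u by (simp add: R_def)
      ultimately have "\<forall>\<^sub>F v in at_right u. c = 0" by eventually_elim simp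
      then show ?thesis by (simp add: trivial_limit_at_right_real)
    qed
    ultimately show ?thesis by blast
  qed
  \<comment> \<open>Opposite nonzero signs would make every point near 0 a strict local minimum of
    \<open>f\<close> or of \<open>- f\<close>, which countability forbids.\<close>
  have "c = c'"
  proof (rule ccontr)
    assume "c \<noteq> c'"
    with z c(1) c'(1) consider "c = 1" "c' = -1" | "c = -1" "c' = 1" by auto
    then show False
    proof cases
      case 1
      have "(\<forall>\<^sub>F u in at_right s. f s < f u) \<and> (\<forall>\<^sub>F u in at_left s. f s < f u)" if "s \<in> {0<..<d}" for s
        using d(2)[of s] that 1 by (auto simp: R_def L_def sgn_1_pos sgn_1_neg elim: eventually_mono)
      with not_strict_local_min_everywhere[OF d(1), of f] show False by blast
    next
      case 2
      have "(\<forall>\<^sub>F u in at_right s. - f s < - f u) \<and> (\<forall>\<^sub>F u in at_left s. - f s < - f u)" if "s \<in> {0<..<d}" for s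
        using d(2)[of s] that 2 by (auto simp: R_def L_def sgn_1_pos sgn_1_neg elim: eventually_mono)
      with not_strict_local_min_everywhere[OF d(1), of "\<lambda>x. - f x"] show False by blast
    qed
  qed
  show ?thesis
  proof (cases "c = -1")
    case True
    have "f t \<le> f s" if "0 < s" "s \<le> t" "t < d" for s t
    proof -
      have "- f s \<le> - f t"
      proof (rule locally_mono_imp_mono[OF that(2)])
        fix x assume x: "s \<le> x" "x \<le> t"
        then have "R (-1) x" "L (-1) x" using d(2)[of x] that True \<open>c = c'\<close> by auto
        then show "\<forall>\<^sub>F u in at_right x. - f x \<le> - f u" "\<forall>\<^sub>F u in at_left x. - f u \<le> - f x"
          by (auto simp: R_def L_def sgn_1_neg elim: eventually_mono)
      qed
      then show ?thesis by simp
    qed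
    with d(1) that show ?thesis by blast
  next
    case False
    have "f s \<le> f t" if "0 < s" "s \<le> t" "t < d" for s t
    proof (rule locally_mono_imp_mono[OF that(2)])
      fix x assume x: "s \<le> x" "x \<le> t"
      then have "R c x" "L c x" using d(2)[of x] that \<open>c = c'\<close> by auto
      then show "\<forall>\<^sub>F u in at_right x. f x \<le> f u" "\<forall>\<^sub>F u in at_left x. f u \<le> f x"
        using c(1) False by (auto simp: R_def L_def sgn_1_pos sgn_zero_iff elim: eventually_mono)
    qed
    with d(1) that show ?thesis by blast
  qed
qed

section \<open>Desingularizing functions\<close>

text \<open>Minimising one more coordinate makes it constant on the remaining set. Compactness keeps
  that set nonempty and is itself preserved, and the minimality condition is first-order.\<close>

lemma semialg_choice_aux:
  fixes K :: "real \<Rightarrow> 'a::euclidean_space \<Rightarrow> bool"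
  assumes "finite B" "semialg (\<lambda>z. K (fst z) (snd z))" "\<And>t. compact {x. K t x}"
  shows "\<exists>K'. semialg (\<lambda>z. K' (fst z) (snd z)) \<and>
    (\<forall>t. compact {x. K' t x} \<and> ((\<exists>x. K t x) \<longrightarrow> (\<exists>x. K' t x)) \<and> (\<forall>x. K' t x \<longrightarrow> K t x) \<and>
      (\<forall>x y. K' t x \<and> K' t y \<longrightarrow> (\<forall>b\<in>B. x \<bullet> b = y \<bullet> b)))"
  using assms(1)
proof (induction B rule: finite_induct)
  case empty
  then show ?case using assms by (intro exI[of _ K]) auto
next
  case (insert b B)
  then obtain K' where K': "semialg (\<lambda>z. K' (fst z) (snd z))" and
    K'_all: "\<forall>t. compact {x. K' t x} \<and> ((\<exists>x. K t x) \<longrightarrow> (\<exists>x. K' t x)) \<and> (\<forall>x. K' t x \<longrightarrow> K t x) \<and>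
      (\<forall>x y. K' t x \<and> K' t y \<longrightarrow> (\<forall>b\<in>B. x \<bullet> b = y \<bullet> b))"
    by (elim exE conjE)
  have compact: "compact {x. K' t x}" for t using K'_all by blast
  have nonempty: "(\<exists>x. K t x) \<longrightarrow> (\<exists>x. K' t x)" for t using K'_all by blast
  have sub: "K' t x \<Longrightarrow> K t x" for t x using K'_all by blast
  have agree: "K' t x \<Longrightarrow> K' t y \<Longrightarrow> b \<in> B \<Longrightarrow> x \<bullet> b = y \<bullet> b" for t x y b using K'_all by blast
  define K'' where "K'' t x \<longleftrightarrow> K' t x \<and> (\<forall>y. K' t y \<longrightarrow> x \<bullet> b \<le> y \<bullet> b)" for t x
  have "semialg (\<lambda>z. K'' (fst z) (snd z))"
    unfolding K''_def by (intro semialg_intros semialg_compose2[OF K'] polynomial_intros)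
  moreover have "compact {x. K'' t x} \<and> ((\<exists>x. K t x) \<longrightarrow> (\<exists>x. K'' t x))" for t
  proof (cases "\<exists>x. K' t x")
    case True
    have "\<exists>x0\<in>{x. K' t x}. \<forall>y\<in>{x. K' t x}. x0 \<bullet> b \<le> y \<bullet> b"
      by (rule continuous_attains_inf) (use True compact in \<open>auto intro!: continuous_intros\<close>)
    then obtain x0 where x0: "K' t x0" "\<And>y. K' t y \<Longrightarrow> x0 \<bullet> b \<le> y \<bullet> b" by auto
    then have "K'' t x \<longleftrightarrow> K' t x \<and> x \<bullet> b \<le> x0 \<bullet> b" for x
      unfolding K''_def by (meson order_trans)
    then have "{x. K'' t x} = {x. K' t x} \<inter> {x. x \<bullet> b \<le> x0 \<bullet> b}" by auto
    moreover have "closed {x. x \<bullet> b \<le> x0 \<bullet> b}" by (intro closed_Collect_le continuous_intros)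
    ultimately have "compact {x. K'' t x}" using compact by (simp add: compact_Int_closed)
    moreover have "K'' t x0" using x0 by (simp add: K''_def)
    ultimately show ?thesis by blast
  next
    case False
    then show ?thesis using nonempty[of t] by (auto simp: K''_def)
  qed
  moreover have "K'' t x \<longrightarrow> K t x" for t x using sub by (simp add: K''_def)
  moreover have "x \<bullet> c = y \<bullet> c" if "K'' t x" "K'' t y" "c \<in> insert b B" for t x y c
    using that agree[of t x y c] by (auto simp: K''_def intro: antisym)
  ultimately show ?case by (intro exI[of _ K'']) blast
qed

text \<open>The lexicographic minimum of a compact set is definable.\<close>

lemma semialg_choice:
  fixes K :: "real \<Rightarrow> 'a::euclidean_space \<Rightarrow> bool"
  assumes "semialg (\<lambda>z. K (fst z) (snd z))" "\<And>t. compact {x. K t x}"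
  obtains K' where "semialg (\<lambda>z. K' (fst z) (snd z))" "\<And>t x. K' t x \<Longrightarrow> K t x"
    "\<And>t. \<exists>x. K t x \<Longrightarrow> \<exists>!x. K' t x"
proof -
  obtain K' where K': "semialg (\<lambda>z. K' (fst z) (snd z))"
    "\<And>t. \<exists>x. K t x \<Longrightarrow> \<exists>x. K' t x" "\<And>t x. K' t x \<Longrightarrow> K t x"
    "\<And>t x y b. K' t x \<Longrightarrow> K' t y \<Longrightarrow> b \<in> Basis \<Longrightarrow> x \<bullet> b = y \<bullet> b"
    using semialg_choice_aux[OF finite_Basis assms] by metis
  have "\<exists>!x. K' t x" if "\<exists>x. K t x" for t
    using K'(2)[OF that] K'(4) by (blast intro: euclidean_eqI)
  with K' that show ?thesis by blast
qed

text \<open>\<open>F\<close> stands for the gradient of \<open>f\<close> and is tied to it by the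
  quadratic upper bound. On the closed ball level sets are compact, so minimal slopes are
  attained.\<close>

locale semialg_gradient =
  fixes f :: "'a::euclidean_space \<Rightarrow> real" and F :: "'a \<Rightarrow> 'a" and xb :: 'a and R0 L :: real
  assumes R0: "0 < R0" and L: "0 \<le> L"
    and descent: "\<And>x y. x \<in> cball xb R0 \<Longrightarrow> y \<in> cball xb R0 \<Longrightarrow>
      f y \<le> f x + F x \<bullet> (y - x) + L / 2 * (norm (y - x))\<^sup>2"
    and cont_f: "continuous_on (cball xb R0) f"
    and cont_F: "continuous_on (cball xb R0) F"
    and semialg_graph: "semialg (\<lambda>z. fst z \<in> cball xb R0 \<and> fst (snd z) = f (fst z) \<and> snd (snd z) = F (fst z))"
begin

definition level :: "real \<Rightarrow> real \<Rightarrow> 'a \<Rightarrow> bool" where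
  "level R t x \<longleftrightarrow> x \<in> cball xb R \<and> f x = f xb + t"

text \<open>The valley line: at each height the points of smallest gradient, which are the worst
  ones for a desingularizing inequality.\<close>

definition talweg :: "real \<Rightarrow> real \<Rightarrow> 'a \<Rightarrow> bool" where
  "talweg R t x \<longleftrightarrow> level R t x \<and> (\<forall>y. level R t y \<longrightarrow> norm (F x) \<le> norm (F y))"

definition graph :: "'a \<Rightarrow> real \<Rightarrow> 'a \<Rightarrow> bool" where
  "graph x c v \<longleftrightarrow> x \<in> cball xb R0 \<and> c = f x \<and> v = F x"

lemma semialg_graph': "semialg (\<lambda>z. graph (fst z) (fst (snd z)) (snd (snd z)))"
  using semialg_graph by (simp add: graph_def)

text \<open>The radius is one of the variables here, so that a single family of polynomials can
  later describe the minimal slopes for all radii.\<close>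

definition talweg' :: "real \<Rightarrow> real \<Rightarrow> 'a \<Rightarrow> real \<Rightarrow> bool" where
  "talweg' R t x m \<longleftrightarrow> 0 < R \<and> R \<le> R0 \<and> talweg R t x \<and> m = norm (F x)"

text \<open>Norms are not polynomial. Comparing squares, and describing \<open>m\<close> as a
  nonnegative root of \<open>m * m = (norm v)\<^sup>2\<close>, turns the condition into a
  first-order formula over \<open>graph\<close>.\<close>

lemma talweg'_iff: "talweg' R t x m \<longleftrightarrow> 0 < R \<and> R \<le> R0 \<and> (\<exists>c v. graph x c v \<and> (norm (x - xb))\<^sup>2 \<le> R * R \<and>
    c = f xb + t \<and> 0 \<le> m \<and> m * m = (norm v)\<^sup>2 \<and>
    (\<forall>y c' v'. graph y c' v' \<and> (norm (y - xb))\<^sup>2 \<le> R * R \<and> c' = f xb + t \<longrightarrow> (norm v)\<^sup>2 \<le> (norm v')\<^sup>2))"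
proof (cases "0 < R \<and> R \<le> R0")
  case True
  have ball: "(norm (x - xb))\<^sup>2 \<le> R * R \<longleftrightarrow> x \<in> cball xb R" for x
    using True by (simp add: power2_eq_square[symmetric] dist_norm norm_minus_commute)
  have sub: "x \<in> cball xb R \<Longrightarrow> x \<in> cball xb R0" for x using True by auto
  have m: "0 \<le> m \<and> m * m = (norm v)\<^sup>2 \<longleftrightarrow> m = norm v" for v :: 'a
    by (metis norm_ge_zero power2_eq_square power2_eq_iff_nonneg)
  have n: "(norm v)\<^sup>2 \<le> (norm v')\<^sup>2 \<longleftrightarrow> norm v \<le> norm v'" for v v' :: 'a by simp
  show ?thesis
    unfolding talweg'_def talweg_def level_def graph_def ball n using True sub m by metis
next
  case False
  then show ?thesis by (auto simp: talweg'_def)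
qed

lemma semialg_talweg':
  assumes "polynomial_function a" "polynomial_function b" "polynomial_function c" "polynomial_function d"
  shows "semialg (\<lambda>z::'z::euclidean_space. talweg' (a z) (b z) (c z) (d z))"
  unfolding talweg'_iff
  by (intro semialg_intros semialg_compose3[OF semialg_graph'] polynomial_intros
      polynomial_function_compose[OF _ assms(1), unfolded o_def]
      polynomial_function_compose[OF _ assms(2), unfolded o_def]
      polynomial_function_compose[OF _ assms(3), unfolded o_def]
      polynomial_function_compose[OF _ assms(4), unfolded o_def] assms)

lemma compact_level: "R \<le> R0 \<Longrightarrow> compact {x. level R t x}"
proof -
  assume R: "R \<le> R0"
  have "closed (cball xb R \<inter> f -` {f xb + t})"
    by (rule continuous_closed_preimage[OF continuous_on_subset[OF cont_f]]) (use R in auto)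
  moreover have "{x. level R t x} = cball xb R \<inter> f -` {f xb + t}" by (auto simp: level_def)
  ultimately show ?thesis by (metis bounded_Int bounded_cball compact_eq_bounded_closed)
qed

lemma talweg_exists:
  assumes "R \<le> R0" "level R t x"
  shows "\<exists>y. talweg R t y"
proof -
  have "\<exists>x0\<in>{x. level R t x}. \<forall>y\<in>{x. level R t x}. norm (F x0) \<le> norm (F y)"
    by (rule continuous_attains_inf[OF compact_level])
      (use assms in \<open>auto simp: level_def intro!: continuous_intros continuous_on_subset[OF cont_F]\<close>)
  then show ?thesis by (auto simp: talweg_def)
qed

lemma compact_talweg:
  assumes "R \<le> R0"
  shows "compact {x. talweg R t x}"
proof (cases "\<exists>x. talweg R t x")
  case True
  then obtain y where y: "talweg R t y" by blast
  have "closed (cball xb R \<inter> (\<lambda>x. norm (F x)) -` {..norm (F y)})"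
    by (rule continuous_closed_preimage)
      (use assms in \<open>auto intro!: continuous_intros continuous_on_subset[OF cont_F]\<close>)
  moreover have "{x. talweg R t x} = {x. level R t x} \<inter> (cball xb R \<inter> (\<lambda>x. norm (F x)) -` {..norm (F y)})"
    using y by (force simp: talweg_def level_def intro: order_trans)
  ultimately show ?thesis using compact_level[OF assms] by (simp add: compact_Int_closed)
qed auto

text \<open>An integrated form of \<open>\<phi>' * norm F \<ge> 1\<close>: for concave
  \<open>\<phi>\<close> the slope between \<open>a\<close> and \<open>b\<close> is at least the
  derivative at any \<open>t \<ge> b\<close>. The smallness near 0 later makes the length of a
  trajectory small.\<close>

definition desingularizing :: "(real \<Rightarrow> real) \<Rightarrow> real \<Rightarrow> bool" where
  "desingularizing \<phi> t0 \<longleftrightarrow> 0 < t0 \<and> \<phi> 0 = 0 \<and> (\<forall>a b. 0 \<le> a \<and> a \<le> b \<and> b < t0 \<longrightarrow> \<phi> a \<le> \<phi> b) \<and>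
     (\<forall>e>0. \<exists>\<delta>>0. \<forall>t. 0 \<le> t \<and> t < \<delta> \<longrightarrow> \<phi> t < e) \<and>
     (\<forall>a b t x. 0 \<le> a \<and> a \<le> b \<and> b \<le> t \<and> t < t0 \<and> level R0 t x \<longrightarrow> b - a \<le> (\<phi> b - \<phi> a) * norm (F x))"

text \<open>Cut the heights into steps of size \<open>h\<close>. Over a step with displacement
  \<open>D\<close>, the descent inequality gives \<open>h \<le> M * D + L / 2 * D\<^sup>2\<close>;
  for small \<open>h\<close> this forces \<open>h \<le> 2 * M * D\<close>, and the displacements are
  bounded by increments of \<open>V\<close>.\<close>

lemma curve_bound:
  assumes curve: "\<And>t. 0 < t \<Longrightarrow> t < t0 \<Longrightarrow> level R0 t (x t)"
    and V: "\<And>s t. 0 < s \<Longrightarrow> s \<le> t \<Longrightarrow> t < t0 \<Longrightarrow> norm (x t - x s) \<le> V t - V s"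
    and M: "0 < M" "\<And>t. 0 < t \<Longrightarrow> t \<le> b \<Longrightarrow> norm (F (x t)) \<le> M"
    and ab: "0 < a" "a \<le> b" "b < t0"
  shows "b - a \<le> 2 * M * (V b - V a)"
proof -
  \<comment> \<open>\<open>N\<close> is chosen so that the step size satisfies
    \<open>L * h \<le> 4 * M\<^sup>2\<close>.\<close>
  obtain N :: nat where N: "L * (b - a) / (4 * M\<^sup>2) < N" "0 < N"
  proof -
    obtain N :: nat where N: "L * (b - a) / (4 * M\<^sup>2) < N" using reals_Archimedean2 by blast
    moreover have "0 \<le> L * (b - a) / (4 * M\<^sup>2)" using L ab by simp
    ultimately have "0 < real N" by linarith
    with N that show ?thesis by simp
  qed
  define h where "h = (b - a) / N"
  have h: "0 \<le> h" "N * h = b - a" "L * h \<le> 4 * M\<^sup>2"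
    using N ab M by (auto simp: h_def field_simps)
  have step: "h \<le> 2 * M * (V (s + h) - V s)" if s: "a \<le> s" "s + h \<le> b" for s
  proof -
    have s': "0 < s" "s < t0" "s + h < t0" "s \<le> s + h" using ab s h by auto
    have lv: "level R0 s (x s)" "level R0 (s + h) (x (s + h))" using curve s' by auto
    define D where "D = norm (x (s + h) - x s)"
    have "f (x (s + h)) \<le> f (x s) + F (x s) \<bullet> (x (s + h) - x s) + L / 2 * D\<^sup>2"
      unfolding D_def by (rule descent) (use lv in \<open>simp_all add: level_def\<close>)
    moreover have "F (x s) \<bullet> (x (s + h) - x s) \<le> norm (F (x s)) * D"
      unfolding D_def by (rule norm_cauchy_schwarz)
    moreover have "norm (F (x s)) * D \<le> M * D"
      using M(2)[of s] s s' h(1) by (intro mult_right_mono) (auto simp: D_def)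
    ultimately have hD: "h \<le> M * D + L / 2 * D\<^sup>2" using lv by (simp add: level_def)
    \<comment> \<open>If \<open>D\<close> were below \<open>h / (2 * M)\<close>, then
      \<open>M * D < h / 2\<close> and \<open>L / 2 * D\<^sup>2 \<le> h / 2\<close>, against the
      descent inequality.\<close>
    have "h \<le> 2 * M * D"
    proof (rule ccontr)
      assume n: "\<not> ?thesis"
      then have hp: "0 < h" using M by (smt (verit) D_def mult_nonneg_nonneg norm_ge_zero)
      have "(2 * M * D)\<^sup>2 \<le> h\<^sup>2" using n M by (intro power_mono) (auto simp: D_def)
      then have "L * (4 * M\<^sup>2 * D\<^sup>2) \<le> L * h\<^sup>2" using L by (intro mult_left_mono) (auto simp: power_mult_distrib)
      also have "\<dots> = (L * h) * h" by (simp add: power2_eq_square)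
      also have "\<dots> \<le> 4 * M\<^sup>2 * h" using h by (intro mult_right_mono) auto
      finally have "L * D\<^sup>2 \<le> h" using M by (simp add: mult.left_commute)
      with hD n show False by simp
    qed
    also have "\<dots> \<le> 2 * M * (V (s + h) - V s)"
      using V[OF s'(1,4,3)] M by (intro mult_left_mono) (auto simp: D_def)
    finally show ?thesis .
  qed
  have "i * h \<le> 2 * M * (V (a + i * h) - V a)" if "i \<le> N" for i :: nat
    using that
  proof (induction i)
    case (Suc i)
    have "a + real i * h + h \<le> b"
      using Suc.prems h mult_right_mono[of "real (Suc i)" "real N" h] by (simp add: algebra_simps)
    with step[of "a + real i * h"] Suc h show ?case by (simp add: algebra_simps)
  qed auto
  from this[of N] h show ?thesis by simp
qed

theorem desingularizing_exists: "\<exists>\<phi> t0. desingularizing \<phi> t0"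
proof -
  define K where "K t x \<longleftrightarrow> talweg R0 t x" for t x
  have "semialg (\<lambda>z. \<exists>m. talweg' R0 (fst z) (snd z) m)"
    by (intro semialg_intros semialg_talweg' polynomial_intros)
  then have "semialg (\<lambda>z. K (fst z) (snd z))" using R0 by (simp add: talweg'_def K_def)
  moreover have "compact {x. K t x}" for t using compact_talweg by (simp add: K_def)
  ultimately obtain K' where K': "semialg (\<lambda>z. K' (fst z) (snd z))" "\<And>t x. K' t x \<Longrightarrow> K t x"
    "\<And>t. \<exists>x. K t x \<Longrightarrow> \<exists>!x. K' t x" using semialg_choice[of K] by blast
  have "semialg (\<lambda>t. \<exists>x. K' t x)"
    by (intro semialg_intros semialg_compose2[OF K'(1)] polynomial_intros)
  from semialg_at_right[OF this, of 0] show ?thesis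
  proof
    assume "\<forall>\<^sub>F t in at_right 0. \<nexists>x. K' t x"
    then obtain t0 where t0: "0 < t0" "\<And>t. 0 < t \<Longrightarrow> t < t0 \<Longrightarrow> \<nexists>x. K' t x"
      by (auto simp: eventually_at_right_field)
    have no: "\<not> level R0 t x" if "0 < t" "t < t0" for t x
      using t0(2)[OF that] K'(3)[of t] talweg_exists[of R0 t x] by (auto simp: K_def)
    \<comment> \<open>No value just above \<open>f xb\<close> is taken, so only \<open>t = 0\<close>
      remains and the zero function serves.\<close>
    have "desingularizing (\<lambda>_. 0) t0"
      unfolding desingularizing_def
    proof (intro conjI allI impI)
      show "\<exists>\<delta>>0::real. \<forall>t. 0 \<le> t \<and> t < \<delta> \<longrightarrow> 0 < e" if "0 < e" for e :: real
        by (rule exI[of _ 1]) (use that in simp)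
      fix a b t y assume h: "0 \<le> a \<and> a \<le> b \<and> b \<le> t \<and> t < t0 \<and> level R0 t y"
      have "t = 0"
      proof (rule ccontr)
        assume "t \<noteq> 0"
        with h have "0 < t" by linarith
        with no[of t y] h show False by blast
      qed
      with h show "b - a \<le> (0 - 0) * norm (F y)" by simp
    qed (use t0 in auto)
    then show ?thesis by blast
  next
    assume "\<forall>\<^sub>F t in at_right 0. \<exists>x. K' t x"
    then obtain d0 where d0: "0 < d0" "\<And>t. 0 < t \<Longrightarrow> t < d0 \<Longrightarrow> \<exists>x. K' t x"
      by (auto simp: eventually_at_right_field)
    \<comment> \<open>Away from 0 the curve may fail to exist; the default 0 makes it total and
      keeps its graph semialgebraic.\<close>
    define x where "x t = (if \<exists>x. K' t x then THE x. K' t x else 0)" for t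
    have ex1: "\<exists>!x. K' t x" if "\<exists>x. K' t x" for t using K'(2,3) that by blast
    have xK': "K' t (x t)" if "\<exists>x. K' t x" for t
      using theI'[OF ex1[OF that]] that by (simp add: x_def)
    have x_eq: "K' t y \<Longrightarrow> y = x t" for t y using ex1 xK' by blast
    define m where "m t = (if \<exists>x. K' t x then norm (F (x t)) else 0)" for t
    have sx: "semialg (\<lambda>z. snd z = x (fst z) \<bullet> b)" for b
    proof -
      have "semialg (\<lambda>z. (\<exists>y. K' (fst z) y \<and> snd z = y \<bullet> b) \<or> (\<not> (\<exists>y. K' (fst z) y) \<and> snd z = 0))"
        by (intro semialg_intros semialg_compose2[OF K'(1)] polynomial_intros)
      moreover have "(\<exists>y. K' t y \<and> s = y \<bullet> b) \<or> (\<not> (\<exists>y. K' t y) \<and> s = 0) \<longleftrightarrow> s = x t \<bullet> b" for t s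
      proof (cases "\<exists>y. K' t y")
        case True
        have "(\<exists>y. K' t y \<and> s = y \<bullet> b) \<longleftrightarrow> s = x t \<bullet> b" using xK'[OF True] x_eq by metis
        with True show ?thesis by blast
      qed (simp add: x_def)
      ultimately show ?thesis by simp
    qed
    have "semialg (\<lambda>z. snd z = m (fst z))"
    proof -
      have "semialg (\<lambda>z. (\<exists>y. K' (fst z) y \<and> talweg' R0 (fst z) y (snd z)) \<or> (\<not> (\<exists>y. K' (fst z) y) \<and> snd z = 0))"
        by (intro semialg_intros semialg_compose2[OF K'(1)] semialg_talweg' polynomial_intros)
      moreover have "(\<exists>y. K' t y \<and> talweg' R0 t y s) \<or> (\<not> (\<exists>y. K' t y) \<and> s = 0) \<longleftrightarrow> s = m t" for t s
      proof (cases "\<exists>y. K' t y")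
        case True
        then have "talweg R0 t (x t)" using K'(2) xK' by (simp add: K_def)
        then have "(\<exists>y. K' t y \<and> talweg' R0 t y s) \<longleftrightarrow> s = norm (F (x t))"
          using xK'[OF True] x_eq R0 unfolding talweg'_def by (metis order_refl)
        with True show ?thesis by (simp add: m_def)
      qed (simp add: m_def)
      ultimately show ?thesis by simp
    qed
    then obtain d1 where d1: "0 < d1"
      "(\<forall>s t. 0 < s \<and> s \<le> t \<and> t < d1 \<longrightarrow> m s \<le> m t) \<or> (\<forall>s t. 0 < s \<and> s \<le> t \<and> t < d1 \<longrightarrow> m t \<le> m s)"
      by (rule semialg_fun_eventually_monotone)
    have "\<exists>d>0. \<exists>\<sigma>\<in>{-1, 1}. \<forall>s t. 0 < s \<and> s \<le> t \<and> t < d \<longrightarrow> \<sigma> * (x s \<bullet> b) \<le> \<sigma> * (x t \<bullet> b)" for b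
      using semialg_fun_eventually_monotone[OF sx[of b]] by (metis insertI1 insertI2 mult_1 mult_minus1 neg_le_iff_le)
    then obtain d \<sigma> where d: "\<And>b. 0 < d b" "\<And>b. \<sigma> b = -1 \<or> \<sigma> b = (1::real)"
      "\<And>b s t. 0 < s \<Longrightarrow> s \<le> t \<Longrightarrow> t < d b \<Longrightarrow> \<sigma> b * (x s \<bullet> b) \<le> \<sigma> b * (x t \<bullet> b)"
      by (metis insertE singletonD)
    define t0 where "t0 = Min (insert d0 (insert d1 (d ` Basis)))"
    have t0: "t0 \<le> d0" "t0 \<le> d1" "\<And>b. b \<in> Basis \<Longrightarrow> t0 \<le> d b"
      by (auto simp: t0_def simp del: Min_insert intro!: Min_le)
    have t0: "0 < t0" "t0 \<le> d0" "t0 \<le> d1" "\<And>b. b \<in> Basis \<Longrightarrow> t0 \<le> d b"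
      using d0(1) d1(1) d(1) t0 by (auto simp: t0_def)
    \<comment> \<open>Each coordinate is monotone with direction \<open>\<sigma> b\<close>, so the
      increments of the signed sum are sums of absolute coordinate changes and dominate the
      Euclidean displacement.\<close>
    define V where "V t = (\<Sum>b\<in>Basis. \<sigma> b * (x t \<bullet> b))" for t
    have V: "norm (x t - x s) \<le> V t - V s" if st: "0 < s" "s \<le> t" "t < t0" for s t
    proof -
      have "norm (x t - x s) \<le> (\<Sum>b\<in>Basis. \<bar>(x t - x s) \<bullet> b\<bar>)" by (rule norm_le_l1)
      also have "\<dots> = (\<Sum>b\<in>Basis. \<sigma> b * (x t \<bullet> b) - \<sigma> b * (x s \<bullet> b))"
      proof (rule sum.cong[OF refl])
        fix b :: 'a assume "b \<in> Basis"
        then show "\<bar>(x t - x s) \<bullet> b\<bar> = \<sigma> b * (x t \<bullet> b) - \<sigma> b * (x s \<bullet> b)"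
          using d(2)[of b] d(3)[of s t b] st t0(4)[of b] by (auto simp: inner_diff_left)
      qed
      also have "\<dots> = V t - V s" by (simp add: V_def sum_subtractf)
      finally show ?thesis .
    qed
    have tal: "talweg R0 t (x t)" "m t = norm (F (x t))" if "0 < t" "t < t0" for t
      using d0(2)[of t] that t0(2) K'(2) xK' by (auto simp: K_def m_def)
    have m_le: "m t \<le> norm (F y)" if "0 < t" "t < t0" "level R0 t y" for t y
      using tal[OF that(1,2)] that(3) by (simp add: talweg_def)
    have lv: "level R0 t (x t)" if "0 < t" "t < t0" for t using tal[OF that] by (simp add: talweg_def)
    \<comment> \<open>A slope that decreases with the height, if positive somewhere, is bounded
      below near height 0, and a linear function desingularizes. An increasing slope is bounded
      along the curve by its value at the top height. A decreasing slope that is zero throughout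
      falls under \<open>inc\<close>.\<close>
    consider (dec) t1 where "0 < t1" "t1 < t0" "0 < m t1" "\<And>t. 0 < t \<Longrightarrow> t \<le> t1 \<Longrightarrow> m t1 \<le> m t"
      | (inc) "\<And>s t. 0 < s \<Longrightarrow> s \<le> t \<Longrightarrow> t < t0 \<Longrightarrow> m s \<le> m t"
    proof (cases "\<forall>s t. 0 < s \<and> s \<le> t \<and> t < d1 \<longrightarrow> m s \<le> m t")
      case True
      then show ?thesis using inc t0 by auto
    next
      case False
      with d1(2) have a: "\<And>s t. 0 < s \<Longrightarrow> s \<le> t \<Longrightarrow> t < d1 \<Longrightarrow> m t \<le> m s" by blast
      show ?thesis
      proof (cases "\<exists>t1. 0 < t1 \<and> t1 < t0 \<and> 0 < m t1")
        case True
        then show ?thesis using dec a t0 by force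
      next
        case False
        have "0 \<le> m t" for t by (simp add: m_def)
        with False have "m t = 0" if "0 < t" "t < t0" for t using that by (meson antisym_conv1 not_less)
        then show ?thesis using inc by force
      qed
    qed
    then show ?thesis
    proof cases
      case dec
      have "b - a \<le> (b / m t1 - a / m t1) * norm (F y)"
        if "0 \<le> a" "a \<le> b" "b \<le> t" "t < t1" "level R0 t y" for a b t y
      proof (cases "t = 0")
        case False
        then have "m t1 \<le> norm (F y)" using that dec m_le[of t y] by (smt (verit))
        then have "(b - a) * m t1 \<le> (b - a) * norm (F y)" using that by (intro mult_left_mono) auto
        then show ?thesis using dec(3) by (simp add: field_simps)
      next
        case True
        with that have "a = 0" "b = 0" by auto
        then show ?thesis by simp
      qed
      moreover have "\<exists>\<delta>>0. \<forall>t. 0 \<le> t \<and> t < \<delta> \<longrightarrow> t / m t1 < e" if "0 < e" for e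
        using that dec(3) by (intro exI[of _ "e * m t1"]) (auto simp: field_simps)
      ultimately have "desingularizing (\<lambda>t. t / m t1) t1"
        unfolding desingularizing_def using dec by (auto simp: divide_right_mono)
      then show ?thesis by blast
    next
      case inc
      have V_mono: "V s \<le> V t" if "0 < s" "s \<le> t" "t < t0" for s t
        using V[OF that] norm_ge_zero[of "x t - x s"] by linarith
      define C where "C = (\<Sum>b::'a\<in>Basis. norm xb + R0)"
      have "\<bar>V t\<bar> \<le> C" if "0 < t" "t < t0" for t
      proof -
        have "norm (x t) \<le> norm xb + R0"
          using lv[OF that] norm_triangle_ineq[of xb "x t - xb"]
          by (auto simp: level_def dist_norm norm_minus_commute)
        then have "\<bar>\<sigma> b * (x t \<bullet> b)\<bar> \<le> norm xb + R0" if "b \<in> Basis" for b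
          using d(2)[of b] Basis_le_norm[OF that, of "x t"] by (auto simp: abs_mult)
        then show ?thesis unfolding V_def C_def by (intro order_trans[OF sum_abs] sum_mono) auto
      qed
      then have bdd: "bdd_below (V ` {0<..<t0})" by (intro bdd_belowI2[of _ "- C"]) force
      \<comment> \<open>\<open>V\<close> need not tend to 0 at height 0; subtracting its infimum
        makes \<open>\<phi>\<close> small there.\<close>
      define V0 where "V0 = Inf (V ` {0<..<t0})"
      have V0: "V0 \<le> V t" if "0 < t" "t < t0" for t
        unfolding V0_def using that by (intro cInf_lower bdd) auto
      define \<phi> where "\<phi> t = (if t \<le> 0 then 0 else 2 * (V t - V0))" for t
      have \<phi>_mono: "\<phi> a \<le> \<phi> b" if "0 \<le> a" "a \<le> b" "b < t0" for a b
        using that V_mono[of a b] V0[of b] by (auto simp: \<phi>_def)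
      have D1: "b - a \<le> (\<phi> b - \<phi> a) * norm (F y)"
        if h: "0 < a" "a \<le> b" "b \<le> t" "t < t0" "level R0 t y" for a b t y
      proof (rule field_le_epsilon)
        fix e :: real assume e: "0 < e"
        \<comment> \<open>\<open>curve_bound\<close> asks for a positive slope bound, while
          \<open>norm (F y)\<close> might be zero at this stage. The added \<open>\<epsilon>\<close>
          costs at most \<open>e\<close>.\<close>
        define \<epsilon> where "\<epsilon> = e / (\<phi> b - \<phi> a + 1)"
        have p: "0 \<le> \<phi> b - \<phi> a" using \<phi>_mono[of a b] h by simp
        have \<epsilon>: "0 < \<epsilon>" "(\<phi> b - \<phi> a) * \<epsilon> \<le> e" using e p by (auto simp: \<epsilon>_def field_simps)
        have "b - a \<le> 2 * (norm (F y) + \<epsilon>) * (V b - V a)"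
        proof (rule curve_bound[OF lv V])
          fix s assume "0 < s" "s \<le> b"
          then show "norm (F (x s)) \<le> norm (F y) + \<epsilon>"
            using inc[of s t] m_le[of t y] h \<epsilon> tal[of s] by auto
        qed (use h \<epsilon> in \<open>auto intro: add_nonneg_pos\<close>)
        also have "\<dots> = (\<phi> b - \<phi> a) * norm (F y) + (\<phi> b - \<phi> a) * \<epsilon>"
          using h by (simp add: \<phi>_def algebra_simps)
        also have "\<dots> \<le> (\<phi> b - \<phi> a) * norm (F y) + e" using \<epsilon> by simp
        finally show "b - a \<le> (\<phi> b - \<phi> a) * norm (F y) + e" .
      qed
      have D: "b - a \<le> (\<phi> b - \<phi> a) * norm (F y)"
        if h: "0 \<le> a" "a \<le> b" "b \<le> t" "t < t0" "level R0 t y" for a b t y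
      proof (cases "a = 0 \<and> 0 < b")
        case True
        show ?thesis
        proof (rule field_le_epsilon)
          fix e :: real assume e: "0 < e"
          \<comment> \<open>The curve lives at positive heights only, so \<open>a = 0\<close> is
            replaced by a small \<open>a'\<close> at the cost of at most \<open>e\<close>.\<close>
          define a' where "a' = min b e"
          have a': "0 < a'" "a' \<le> b" "a' \<le> e" using e True by (auto simp: a'_def)
          have "b - a' \<le> (\<phi> b - \<phi> a') * norm (F y)" using D1 a' h by blast
          also have "\<dots> \<le> (\<phi> b - \<phi> a) * norm (F y)"
            using True \<phi>_mono[of a a'] a' h by (intro mult_right_mono) auto
          finally show "b - a \<le> (\<phi> b - \<phi> a) * norm (F y) + e" using a' True by simp
        qed
      next
        case False
        then show ?thesis using D1[of a b t y] h by (cases "a = 0") auto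
      qed
      have "\<exists>\<delta>>0. \<forall>t. 0 \<le> t \<and> t < \<delta> \<longrightarrow> \<phi> t < e" if e: "0 < e" for e
      proof -
        have "\<exists>v\<in>V ` {0<..<t0}. v < V0 + e / 2"
          unfolding V0_def using e bdd t0(1) by (intro cInf_lessD) auto
        then obtain s where s: "0 < s" "s < t0" "V s < V0 + e / 2" by auto
        have "\<phi> t < e" if "0 \<le> t" "t < s" for t
          using that s V_mono[of t s] e by (auto simp: \<phi>_def)
        with s show ?thesis by blast
      qed
      with D \<phi>_mono t0(1) have "desingularizing \<phi> t0"
        unfolding desingularizing_def by (auto simp: \<phi>_def[of 0])
      then show ?thesis by blast
    qed
  qed
qed

end

section \<open>Lojasiewicz exponents\<close>

text \<open>Bivariate polynomials in \<open>t\<close> and \<open>m\<close> are represented as \<open>real poly poly\<close>, with outer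
  variable \<open>m\<close>.\<close>

lemma real_polynomial_function_slices:
  fixes g :: "real \<times> real \<times> real \<Rightarrow> real"
  assumes "real_polynomial_function g"
  shows "\<exists>D. \<forall>R. \<exists>p::real poly poly. degree p \<le> D \<and> (\<forall>j. degree (coeff p j) \<le> D) \<and>
    (\<forall>t m. g (R, t, m) = poly (poly p [:m:]) t)"
  using assms
proof (induction g rule: real_polynomial_function.induct)
  case (linear g)
  then have lin: "linear g" by (rule bounded_linear.linear)
  show ?case
  proof (rule exI[of _ 1], rule allI)
    fix R :: real
    define p where "p = [:[:R * g (1, 0, 0), g (0, 1, 0):], [:g (0, 0, 1):]:]"
    have "g (R, t, m) = poly (poly p [:m:]) t" for t m
    proof -
      have "(R, t, m) = R *\<^sub>R (1, 0, 0) + t *\<^sub>R (0, 1, 0) + m *\<^sub>R (0, 0, 1)" by simp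
      then have "g (R, t, m) = R * g (1, 0, 0) + t * g (0, 1, 0) + m * g (0, 0, 1)"
        by (simp only: linear_add[OF lin] linear_scale[OF lin] real_scaleR_def)
      then show ?thesis by (simp add: p_def)
    qed
    moreover have "degree (coeff p j) \<le> 1" for j
      by (auto simp: p_def coeff_pCons split: nat.split)
    moreover have "degree p \<le> 1" by (simp add: p_def)
    ultimately show "\<exists>p::real poly poly. degree p \<le> 1 \<and> (\<forall>j. degree (coeff p j) \<le> 1) \<and>
        (\<forall>t m. g (R, t, m) = poly (poly p [:m:]) t)" by blast
  qed
next
  case (const c)
  show ?case
  proof (intro exI[of _ "0::nat"] allI exI[of _ "[:[:c:]:]"] conjI)
    show "degree (coeff [:[:c:]:] j) \<le> 0" for j by (cases j) simp_all
  qed simp_all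
next
  case (add g h)
  then obtain D E where
    D: "\<forall>R. \<exists>p::real poly poly. degree p \<le> D \<and> (\<forall>j. degree (coeff p j) \<le> D) \<and>
      (\<forall>t m. g (R, t, m) = poly (poly p [:m:]) t)"
    and E: "\<forall>R. \<exists>p::real poly poly. degree p \<le> E \<and> (\<forall>j. degree (coeff p j) \<le> E) \<and>
      (\<forall>t m. h (R, t, m) = poly (poly p [:m:]) t)" by blast
  show ?case
  proof (intro exI[of _ "D + E"] allI)
    fix R :: real
    obtain p :: "real poly poly" where p: "degree p \<le> D" "\<And>j. degree (coeff p j) \<le> D"
      "\<And>t m. g (R, t, m) = poly (poly p [:m:]) t" using D by blast
    obtain q :: "real poly poly" where q: "degree q \<le> E" "\<And>j. degree (coeff q j) \<le> E"
      "\<And>t m. h (R, t, m) = poly (poly q [:m:]) t" using E by blast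
    show "\<exists>p::real poly poly. degree p \<le> D + E \<and> (\<forall>j. degree (coeff p j) \<le> D + E) \<and>
        (\<forall>t m. g (R, t, m) + h (R, t, m) = poly (poly p [:m:]) t)"
    proof (intro exI[of _ "p + q"] conjI allI)
      show "degree (p + q) \<le> D + E"
        using p(1) q(1) by (intro degree_add_le) simp_all
      show "degree (coeff (p + q) j) \<le> D + E" for j
        unfolding coeff_add using p(2)[of j] q(2)[of j] by (intro degree_add_le) simp_all
    qed (simp add: p q)
  qed
next
  case (mult g h)
  then obtain D E where
    D: "\<forall>R. \<exists>p::real poly poly. degree p \<le> D \<and> (\<forall>j. degree (coeff p j) \<le> D) \<and>
      (\<forall>t m. g (R, t, m) = poly (poly p [:m:]) t)"
    and E: "\<forall>R. \<exists>p::real poly poly. degree p \<le> E \<and> (\<forall>j. degree (coeff p j) \<le> E) \<and>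
      (\<forall>t m. h (R, t, m) = poly (poly p [:m:]) t)" by blast
  show ?case
  proof (intro exI[of _ "D + E"] allI)
    fix R :: real
    obtain p :: "real poly poly" where p: "degree p \<le> D" "\<And>j. degree (coeff p j) \<le> D"
      "\<And>t m. g (R, t, m) = poly (poly p [:m:]) t" using D by blast
    obtain q :: "real poly poly" where q: "degree q \<le> E" "\<And>j. degree (coeff q j) \<le> E"
      "\<And>t m. h (R, t, m) = poly (poly q [:m:]) t" using E by blast
    have "degree (coeff (p * q) j) \<le> D + E" for j
      unfolding coeff_mult
      by (intro degree_sum_le) (auto intro!: order_trans[OF degree_mult_le] add_mono p q)
    moreover have "degree (p * q) \<le> D + E"
      by (intro order_trans[OF degree_mult_le] add_mono p q)
    ultimately show "\<exists>p::real poly poly. degree p \<le> D + E \<and> (\<forall>j. degree (coeff p j) \<le> D + E) \<and>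
        (\<forall>t m. g (R, t, m) * h (R, t, m) = poly (poly p [:m:]) t)"
      using p q by (intro exI[of _ "p * q"]) auto
  qed
qed

text \<open>If \<open>t ^ i * m ^ j\<close> and \<open>t ^ i' * m ^ j'\<close> are comparable,
  \<open>m\<close> has the order of \<open>t\<close> to the power
  \<open>(i - i') / (j' - j)\<close>. With degrees at most \<open>D\<close>, these are the possible
  edge slopes of a Newton polygon.\<close>

definition slopes :: "nat \<Rightarrow> real set" where
  "slopes D = (\<lambda>(i, j, n). (real i - real j) / real n) ` ({..D} \<times> {..D} \<times> {1..D})"

lemma finite_slopes: "finite (slopes D)"
  by (simp add: slopes_def)

text \<open>If the exponents of \<open>m\<close> agree, distinct powers of \<open>t\<close> would be
  comparable, which \<open>t < 1 / K\<close> excludes. Otherwise an n-th root is taken, and since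
  \<open>K \<le> K ^ n\<close> the constant need not grow.\<close>

lemma comparable_monomials:
  fixes t m K :: real
  assumes t: "0 < t" "t < 1 / K" and m: "0 < m" and K: "1 \<le> K"
    and le: "i \<le> D" "j \<le> D" "i' \<le> D" "j' \<le> D" and ne: "(i, j) \<noteq> (i', j')"
    and cmp: "t ^ i * m ^ j \<le> K * (t ^ i' * m ^ j')" "t ^ i' * m ^ j' \<le> K * (t ^ i * m ^ j)"
  shows "\<exists>\<theta>\<in>slopes D. t powr \<theta> \<le> K * m \<and> m \<le> K * t powr \<theta>"
proof -
  have t1: "t < 1" using t K by (smt (verit) divide_le_eq_1)
  have not_lt: False if "i < i'" "t ^ i \<le> K * t ^ i'" for i i' :: nat
  proof -
    have "t ^ i' \<le> t ^ Suc i" using that t t1 by (intro power_decreasing) auto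
    then have "t ^ i \<le> K * t ^ Suc i" using that(2) K by (smt (verit) mult_left_mono)
    then have "t ^ i * 1 \<le> t ^ i * (K * t)" by (simp add: mult_ac)
    then have "1 \<le> K * t" using t by (simp add: mult_le_cancel_left_pos)
    then show False using t K by (simp add: field_simps)
  qed
  have main: ?thesis
    if h: "j < j'" "i \<le> D" "i' \<le> D" "j' \<le> D"
      "t ^ i * m ^ j \<le> K * (t ^ i' * m ^ j')" "t ^ i' * m ^ j' \<le> K * (t ^ i * m ^ j)" for i j i' j'
  proof -
    define n where "n = j' - j"
    have n: "1 \<le> n" "n \<le> D" "m ^ j' = m ^ j * m ^ n" using h by (auto simp: n_def simp flip: power_add)
    define \<theta> where "\<theta> = (real i - real i') / real n"
    have "\<theta> \<in> slopes D" using h n by (force simp: slopes_def \<theta>_def)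
    have "(t powr \<theta>) ^ n = t powr (real i - real i')"
      using t n by (simp add: \<theta>_def powr_powr flip: powr_realpow)
    then have pw: "(t powr \<theta>) ^ n * t ^ i' = t ^ i"
      using t by (simp add: powr_diff powr_realpow)
    have "t ^ i * m ^ j \<le> (K * t ^ i' * m ^ n) * m ^ j" using h(5) n(3) by (simp add: mult_ac)
    then have "t ^ i \<le> K * t ^ i' * m ^ n" using m by (simp add: mult_le_cancel_right_pos)
    then have "(t powr \<theta>) ^ n * t ^ i' \<le> (K * m ^ n) * t ^ i'" using pw by (simp add: mult_ac)
    then have a: "(t powr \<theta>) ^ n \<le> K * m ^ n" using t by (simp add: mult_le_cancel_right_pos)
    have "t ^ i' * m ^ n * m ^ j \<le> (K * t ^ i) * m ^ j" using h(6) n(3) by (simp add: mult_ac)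
    then have "t ^ i' * m ^ n \<le> K * t ^ i" using m by (simp add: mult_le_cancel_right_pos)
    then have "m ^ n * t ^ i' \<le> (K * (t powr \<theta>) ^ n) * t ^ i'" using pw by (simp add: mult_ac)
    then have b: "m ^ n \<le> K * (t powr \<theta>) ^ n" using t by (simp add: mult_le_cancel_right_pos)
    have Kn: "K \<le> K ^ n" using K n(1) by (intro self_le_power) auto
    have "(t powr \<theta>) ^ n \<le> (K * m) ^ n"
      unfolding power_mult_distrib by (rule order_trans[OF a mult_right_mono[OF Kn]]) (use m in simp)
    then have "t powr \<theta> \<le> K * m" using K m n(1) power_mono_iff[of "t powr \<theta>" "K * m" n] by simp
    moreover have "m ^ n \<le> (K * t powr \<theta>) ^ n"
      unfolding power_mult_distrib by (rule order_trans[OF b mult_right_mono[OF Kn]]) simp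
    then have "m \<le> K * t powr \<theta>" using K m n(1) power_mono_iff[of m "K * t powr \<theta>" n] by simp
    ultimately show ?thesis using \<open>\<theta> \<in> slopes D\<close> by blast
  qed
  consider "j < j'" | "j' < j" | "j = j'" by linarith
  then show ?thesis
  proof cases
    case 3
    have "0 < m ^ j" using m by simp
    with cmp 3 have "t ^ i \<le> K * t ^ i'" "t ^ i' \<le> K * t ^ i"
      using mult_le_cancel_right_pos[of "m ^ j" "t ^ i" "K * t ^ i'"]
        mult_le_cancel_right_pos[of "m ^ j" "t ^ i'" "K * t ^ i"] by (simp_all add: mult.assoc)
    with not_lt[of i i'] not_lt[of i' i] 3 ne show ?thesis by (cases i i' rule: linorder_cases) auto
  qed (use main[OF _ le(1,3,4) cmp] main[OF _ le(3,1,2) cmp(2,1)] in auto)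
qed

text \<open>The two largest monomials in a vanishing sum are comparable, as in the construction of the
  Newton polygon.\<close>

lemma root_asymptotics:
  fixes p :: "real poly poly"
  assumes p: "p \<noteq> 0" "degree p \<le> D" "\<And>j. degree (coeff p j) \<le> D"
  shows "\<exists>K\<ge>1. \<exists>\<eta>>0. \<forall>t m. 0 < t \<and> t < \<eta> \<and> 0 < m \<and> poly (poly p [:m:]) t = 0 \<longrightarrow>
    (\<exists>\<theta>\<in>slopes D. t powr \<theta> \<le> K * m \<and> m \<le> K * t powr \<theta>)"
proof -
  define c where "c = (\<lambda>(i, j). coeff (coeff p j) i)"
  define J where "J = {ij \<in> {..D} \<times> {..D}. c ij \<noteq> 0}"
  have finJ: "finite J" by (simp add: J_def)
  have val: "poly (poly p [:m:]) t = (\<Sum>ij\<in>J. c ij * (t ^ fst ij * m ^ snd ij))" for t m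
  proof -
    have "poly (poly p [:m:]) t = (\<Sum>j\<le>D. poly (coeff p j) t * m ^ j)"
      by (subst poly_altdef[of p]) (simp add: poly_sum, intro sum.mono_neutral_left,
        use p(2) coeff_eq_0[of p] in auto)
    also have "\<dots> = (\<Sum>j\<le>D. (\<Sum>i\<le>D. coeff (coeff p j) i * t ^ i) * m ^ j)"
    proof (intro sum.cong refl arg_cong2[where f = "(*)"])
      fix j
      show "poly (coeff p j) t = (\<Sum>i\<le>D. coeff (coeff p j) i * t ^ i)"
        unfolding poly_altdef by (intro sum.mono_neutral_left)
          (use p(3)[of j] coeff_eq_0[of "coeff p j"] in auto)
    qed
    also have "\<dots> = (\<Sum>j\<le>D. \<Sum>i\<le>D. c (i, j) * (t ^ i * m ^ j))"
      by (simp add: sum_distrib_right c_def mult.assoc)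
    also have "\<dots> = (\<Sum>i\<le>D. \<Sum>j\<le>D. c (i, j) * (t ^ i * m ^ j))" by (rule sum.swap)
    also have "\<dots> = (\<Sum>ij\<in>{..D} \<times> {..D}. c ij * (t ^ fst ij * m ^ snd ij))"
      by (simp add: sum.cartesian_product case_prod_unfold)
    also have "\<dots> = (\<Sum>ij\<in>J. c ij * (t ^ fst ij * m ^ snd ij))"
      by (intro sum.mono_neutral_right) (auto simp: J_def)
    finally show ?thesis .
  qed
  have neJ: "J \<noteq> {}"
  proof -
    obtain j where j: "coeff p j \<noteq> 0" using p(1) by (auto simp: poly_eq_iff)
    then obtain i where i: "coeff (coeff p j) i \<noteq> 0" by (auto simp: poly_eq_iff)
    have "j \<le> D" using j p(2) le_degree le_trans by blast
    moreover have "i \<le> D" using i p(3)[of j] le_degree le_trans by blast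
    ultimately have "(i, j) \<in> J" using i by (auto simp: J_def c_def)
    then show ?thesis by blast
  qed
  define cl where "cl = Min ((\<lambda>ij. \<bar>c ij\<bar>) ` J)"
  define ch where "ch = Max ((\<lambda>ij. \<bar>c ij\<bar>) ` J)"
  have cl: "0 < cl" "\<And>ij. ij \<in> J \<Longrightarrow> cl \<le> \<bar>c ij\<bar>" "\<And>ij. ij \<in> J \<Longrightarrow> \<bar>c ij\<bar> \<le> ch"
    using finJ neJ by (auto simp: cl_def ch_def J_def)
  have clch: "cl \<le> ch" using cl(2,3) neJ by force
  \<comment> \<open>The factor \<open>card J\<close> pays for the cancellation among several terms,
    the ratio \<open>ch / cl\<close> for passing from terms to monomials.\<close>
  define K where "K = card J * (ch / cl)"
  have card: "1 \<le> card J" using finJ neJ by (simp add: Suc_le_eq card_gt_0_iff)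
  have K: "ch / cl \<le> K" "1 \<le> ch / cl"
    using cl(1) clch card mult_right_mono[of 1 "real (card J)" "ch / cl"] by (auto simp: K_def)
  have "\<exists>\<theta>\<in>slopes D. t powr \<theta> \<le> K * m \<and> m \<le> K * t powr \<theta>"
    if h: "0 < t" "t < 1 / K" "0 < m" "poly (poly p [:m:]) t = 0" for t m
  proof -
    define \<tau> where "\<tau> = (\<lambda>ij. t ^ fst ij * m ^ snd ij)"
    have \<tau>: "0 < \<tau> ij" for ij using h by (simp add: \<tau>_def)
    obtain a where a: "a \<in> J" "\<And>b. b \<in> J \<Longrightarrow> \<bar>c b\<bar> * \<tau> b \<le> \<bar>c a\<bar> * \<tau> a"
    proof -
      have "Max ((\<lambda>b. \<bar>c b\<bar> * \<tau> b) ` J) \<in> (\<lambda>b. \<bar>c b\<bar> * \<tau> b) ` J" using finJ neJ by (intro Max_in) auto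
      then obtain a where "a \<in> J" "Max ((\<lambda>b. \<bar>c b\<bar> * \<tau> b) ` J) = \<bar>c a\<bar> * \<tau> a" by auto
      moreover from this have "\<bar>c b\<bar> * \<tau> b \<le> \<bar>c a\<bar> * \<tau> a" if "b \<in> J" for b
        using Max_ge[of "(\<lambda>b. \<bar>c b\<bar> * \<tau> b) ` J" "\<bar>c b\<bar> * \<tau> b"] finJ \<open>b \<in> J\<close> by simp
      ultimately show ?thesis using that by blast
    qed
    have sum0: "(\<Sum>ij\<in>J. c ij * \<tau> ij) = 0" using h(4) val by (simp add: \<tau>_def)
    \<comment> \<open>The largest term is cancelled by the other \<open>card J - 1\<close> terms, so
      one of them has at least the share \<open>1 / card J\<close> of it.\<close>
    have ex: "\<exists>b\<in>J - {a}. \<bar>c a\<bar> * \<tau> a \<le> card J * (\<bar>c b\<bar> * \<tau> b)"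
    proof (rule ccontr)
      assume "\<not> ?thesis"
      then have n: "\<And>b. b \<in> J - {a} \<Longrightarrow> card J * (\<bar>c b\<bar> * \<tau> b) < \<bar>c a\<bar> * \<tau> a" by force
      have ca: "0 < \<bar>c a\<bar> * \<tau> a" using \<tau>[of a] a(1) by (simp add: J_def)
      have "c a * \<tau> a = - (\<Sum>b\<in>J - {a}. c b * \<tau> b)"
        using sum.remove[OF finJ a(1), of "\<lambda>b. c b * \<tau> b"] sum0 by simp
      then have "\<bar>c a * \<tau> a\<bar> = \<bar>\<Sum>b\<in>J - {a}. c b * \<tau> b\<bar>" by simp
      also have "\<dots> \<le> (\<Sum>b\<in>J - {a}. \<bar>c b\<bar> * \<tau> b)"
        using \<tau> by (intro order_trans[OF sum_abs] sum_mono) (simp add: abs_mult less_imp_le)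
      finally have 1: "\<bar>c a\<bar> * \<tau> a \<le> (\<Sum>b\<in>J - {a}. \<bar>c b\<bar> * \<tau> b)" using \<tau>[of a] by (simp add: abs_mult)
      have "card J * (\<bar>c a\<bar> * \<tau> a) \<le> card J * (\<Sum>b\<in>J - {a}. \<bar>c b\<bar> * \<tau> b)"
        by (intro mult_left_mono 1) simp
      also have "\<dots> = (\<Sum>b\<in>J - {a}. card J * (\<bar>c b\<bar> * \<tau> b))" by (rule sum_distrib_left)
      also have "\<dots> \<le> (\<Sum>b\<in>J - {a}. \<bar>c a\<bar> * \<tau> a)" using n by (intro sum_mono) (simp add: less_imp_le)
      also have "\<dots> = (real (card J) - 1) * (\<bar>c a\<bar> * \<tau> a)"
        using a(1) finJ card by (simp add: of_nat_diff)
      finally show False using ca by (simp add: algebra_simps)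
    qed
    then obtain b where b: "b \<in> J" "b \<noteq> a" "\<bar>c a\<bar> * \<tau> a \<le> card J * (\<bar>c b\<bar> * \<tau> b)" by blast
    have "cl * \<tau> a \<le> \<bar>c a\<bar> * \<tau> a" using cl(2)[OF a(1)] \<tau>[of a] by (intro mult_right_mono) auto
    also note b(3)
    also have "card J * (\<bar>c b\<bar> * \<tau> b) \<le> card J * (ch * \<tau> b)"
      using cl(3)[OF b(1)] \<tau>[of b] by (intro mult_left_mono mult_right_mono) auto
    finally have 1: "\<tau> a \<le> K * \<tau> b" using cl(1) by (simp add: K_def field_simps)
    have "cl * \<tau> b \<le> \<bar>c b\<bar> * \<tau> b" using cl(2)[OF b(1)] \<tau>[of b] by (intro mult_right_mono) auto
    also note a(2)[OF b(1)]
    also have "\<bar>c a\<bar> * \<tau> a \<le> ch * \<tau> a"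
      using cl(3)[OF a(1)] \<tau>[of a] by (intro mult_right_mono) auto
    finally have "\<tau> b \<le> ch / cl * \<tau> a" using cl(1) by (simp add: field_simps)
    also have "\<dots> \<le> K * \<tau> a" using K(1) \<tau>[of a] by (intro mult_right_mono) auto
    finally have 2: "\<tau> b \<le> K * \<tau> a" .
    show ?thesis
      by (rule comparable_monomials[of t K m "fst a" D "snd a" "fst b" "snd b"])
        (use h K a(1) b 1 2 in \<open>auto simp: J_def \<tau>_def prod_eq_iff\<close>)
  qed
  moreover have "0 < 1 / K" "1 \<le> K" using K by auto
  ultimately show ?thesis by blast
qed

section \<open>Power-law behaviour of the minimal slope and admissible exponents\<close>

context semialg_gradient
begin

lemma desingularizing_level:
  assumes "desingularizing \<phi> t0" "0 \<le> a" "a \<le> b" "b \<le> t" "t < t0" "level R0 t x"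
  shows "b - a \<le> (\<phi> b - \<phi> a) * norm (F x)"
  using assms(1) unfolding desingularizing_def using assms(2-) by blast

definition slope_at :: "real \<Rightarrow> real \<Rightarrow> real \<Rightarrow> bool" where
  "slope_at R t m \<longleftrightarrow> (\<exists>x. talweg' R t x m)"

lemma slope_at_unique: "slope_at R t m \<Longrightarrow> slope_at R t m' \<Longrightarrow> m = m'"
  by (auto simp: slope_at_def talweg'_def talweg_def intro: antisym)

text \<open>The graph of a function contains no vertical segment. If every polynomial of the family
  that vanishes at \<open>(R, t, m)\<close> vanished for all \<open>m'\<close>, all signs would
  persist just to the right of \<open>m\<close>, and the slope would have a second value.\<close>

lemma slope_at_polynomial:
  "\<exists>G. finite G \<and> (\<forall>g\<in>G. real_polynomial_function g) \<and>
     (\<forall>R t m. slope_at R t m \<longrightarrow> (\<exists>g\<in>G. g (R, t, m) = 0 \<and> (\<exists>m'. g (R, t, m') \<noteq> 0)))"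
proof -
  have "semialg (\<lambda>z. slope_at (fst z) (fst (snd z)) (snd (snd z)))"
    unfolding slope_at_def by (intro semialg_intros semialg_talweg' polynomial_intros)
  then obtain G where G: "finite G" "\<forall>g\<in>G. real_polynomial_function g"
    "\<And>x y. (\<forall>g\<in>G. sgn (g x) = sgn (g y)) \<Longrightarrow> slope_at (fst x) (fst (snd x)) (snd (snd x)) =
       slope_at (fst y) (fst (snd y)) (snd (snd y))" unfolding semialg_def by blast
  have "\<exists>g\<in>G. g (R, t, m) = 0 \<and> (\<exists>m'. g (R, t, m') \<noteq> 0)" if T: "slope_at R t m" for R t m
  proof (rule ccontr)
    assume n: "\<not> ?thesis"
    have "\<forall>\<^sub>F m' in at_right m. sgn (g (R, t, m')) = sgn (g (R, t, m))" if g: "g \<in> G" for g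
    proof (cases "g (R, t, m) = 0")
      case True
      with n g show ?thesis by auto
    next
      case False
      have "isCont (\<lambda>m'. g (R, t, m')) m"
        by (rule isCont_o2[where f = "\<lambda>m'. (R, t, m')" and g = g])
          (use G(2) g in \<open>simp_all add: continuous_real_polymonial_function continuous_Pair\<close>)
      then have lim: "((\<lambda>m'. g (R, t, m')) \<longlongrightarrow> g (R, t, m)) (at_right m)"
        using filterlim_at_split isCont_def by blast
      consider "0 < g (R, t, m)" | "g (R, t, m) < 0" using False by linarith
      then show ?thesis
      proof cases
        case 1
        from order_tendstoD(1)[OF lim 1] show ?thesis by eventually_elim (use 1 in simp)
      next
        case 2
        from order_tendstoD(2)[OF lim 2] show ?thesis by eventually_elim (use 2 in simp)
      qed
    qed
    then have "\<forall>\<^sub>F m' in at_right m. \<forall>g\<in>G. sgn (g (R, t, m')) = sgn (g (R, t, m))"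
      using G(1) by (simp add: eventually_ball_finite)
    then have "\<forall>\<^sub>F m' in at_right m. slope_at R t m'"
      by eventually_elim (use G(3)[of "(R, t, _)" "(R, t, m)"] T in auto)
    moreover have "\<forall>\<^sub>F m' in at_right m. m < m'" by (simp add: eventually_at_right_less)
    ultimately have "\<forall>\<^sub>F m' in at_right m. False"
      by eventually_elim (use slope_at_unique[OF T] in auto)
    then show False by (simp add: trivial_limit_at_right_real)
  qed
  with G(1,2) show ?thesis by blast
qed

definition lojasiewicz :: "real \<Rightarrow> real \<Rightarrow> bool" where
  "lojasiewicz R q \<longleftrightarrow> (\<exists>c>0. \<exists>\<eta>>0. \<forall>x\<in>cball xb R. 0 < f x - f xb \<and> f x - f xb < \<eta> \<longrightarrow>
     c * (f x - f xb) powr q \<le> norm (F x))"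

text \<open>On each level the inequality is tightest on the talweg, which reduces it to a statement
  about one function of \<open>t\<close>.\<close>

lemma lojasiewicz_slope_at:
  assumes R: "0 < R" "R \<le> R0"
  shows "lojasiewicz R q \<longleftrightarrow>
    (\<exists>c>0. \<exists>\<eta>>0. \<forall>t m. 0 < t \<and> t < \<eta> \<and> slope_at R t m \<longrightarrow> c * t powr q \<le> m)"
proof
  assume "lojasiewicz R q"
  then obtain c \<eta> where c: "0 < c" "0 < \<eta>"
    "\<And>x. x \<in> cball xb R \<Longrightarrow> 0 < f x - f xb \<Longrightarrow> f x - f xb < \<eta> \<Longrightarrow> c * (f x - f xb) powr q \<le> norm (F x)"
    unfolding lojasiewicz_def by blast
  have "c * t powr q \<le> m" if t: "0 < t" "t < \<eta>" "slope_at R t m" for t m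
  proof -
    obtain x where "talweg' R t x m" using t(3) unfolding slope_at_def by blast
    then have "x \<in> cball xb R" "f x - f xb = t" "m = norm (F x)"
      by (simp_all add: talweg'_def talweg_def level_def)
    with c(3)[of x] t show ?thesis by simp
  qed
  with c(1,2) show "\<exists>c>0. \<exists>\<eta>>0. \<forall>t m. 0 < t \<and> t < \<eta> \<and> slope_at R t m \<longrightarrow> c * t powr q \<le> m" by blast
next
  assume "\<exists>c>0. \<exists>\<eta>>0. \<forall>t m. 0 < t \<and> t < \<eta> \<and> slope_at R t m \<longrightarrow> c * t powr q \<le> m"
  then obtain c \<eta> where c: "0 < c" "0 < \<eta>"
    "\<And>t m. 0 < t \<Longrightarrow> t < \<eta> \<Longrightarrow> slope_at R t m \<Longrightarrow> c * t powr q \<le> m" by blast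
  have "c * (f x - f xb) powr q \<le> norm (F x)"
    if x: "x \<in> cball xb R" "0 < f x - f xb" "f x - f xb < \<eta>" for x
  proof -
    have lv: "level R (f x - f xb) x" using x by (simp add: level_def)
    from talweg_exists[OF R(2) this] obtain y where y: "talweg R (f x - f xb) y" by blast
    then have "slope_at R (f x - f xb) (norm (F y))" using R by (auto simp: slope_at_def talweg'_def)
    then have "c * (f x - f xb) powr q \<le> norm (F y)" using c(3) x by blast
    also have "\<dots> \<le> norm (F x)" using y lv by (simp add: talweg_def)
    finally show ?thesis .
  qed
  with c show "lojasiewicz R q" unfolding lojasiewicz_def by blast
qed

lemma lojasiewicz_antimono: "lojasiewicz R q \<Longrightarrow> R' \<le> R \<Longrightarrow> lojasiewicz R' q"
  unfolding lojasiewicz_def by (meson subset_cball subsetD)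

text \<open>The desingularizing inequality from 0 to \<open>t\<close> is incompatible with
  \<open>m = 0\<close>. One \<open>t0\<close> serves all radii because smaller balls have smaller
  level sets.\<close>

lemma slope_at_pos:
  obtains t0 where "0 < t0" "\<And>R t m. 0 < t \<Longrightarrow> t < t0 \<Longrightarrow> slope_at R t m \<Longrightarrow> 0 < m"
proof -
  obtain \<phi> t0 where d: "desingularizing \<phi> t0" using desingularizing_exists by blast
  have "0 < m" if t: "0 < t" "t < t0" and s: "slope_at R t m" for R t m
  proof -
    obtain x where "talweg' R t x m" using s unfolding slope_at_def by blast
    then have x: "level R0 t x" "m = norm (F x)"
      by (simp_all add: talweg'_def talweg_def level_def)
    have "t - 0 \<le> (\<phi> t - \<phi> 0) * m"
      unfolding x(2) by (rule desingularizing_level[OF d]) (use t x in auto)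
    with t show ?thesis using x by (cases "m = 0") auto
  qed
  moreover have "0 < t0" using d by (simp add: desingularizing_def)
  ultimately show ?thesis using that by blast
qed

text \<open>Freezing \<open>R\<close> in finitely many polynomials leaves polynomials in
  \<open>t\<close> and \<open>m\<close> with degrees bounded independently of \<open>R\<close>. Thus
  \<open>K\<close> and \<open>\<eta>\<close> depend on the radius, but the set of exponents does
  not.\<close>

lemma slope_at_asymptotics:
  obtains \<Theta> where "finite \<Theta>" "\<And>R. 0 < R \<Longrightarrow> R \<le> R0 \<Longrightarrow> \<exists>K\<ge>1. \<exists>\<eta>>0. \<forall>t m. 0 < t \<and> t < \<eta> \<and> slope_at R t m \<longrightarrow>
    (\<exists>\<theta>\<in>\<Theta>. t powr \<theta> \<le> K * m \<and> m \<le> K * t powr \<theta>)"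
proof -
  obtain G where G: "finite G" "\<forall>g\<in>G. real_polynomial_function g"
    "\<And>R t m. slope_at R t m \<Longrightarrow> (\<exists>g\<in>G. g (R, t, m) = 0 \<and> (\<exists>m'. g (R, t, m') \<noteq> 0))"
    using slope_at_polynomial by metis
  obtain D where D: "\<And>g R. g \<in> G \<Longrightarrow> \<exists>p::real poly poly. degree p \<le> D g \<and> (\<forall>j. degree (coeff p j) \<le> D g) \<and>
    (\<forall>t m. g (R, t, m) = poly (poly p [:m:]) t)"
    using G(2) real_polynomial_function_slices by metis
  obtain t0 where t0: "0 < t0" "\<And>R t m. 0 < t \<Longrightarrow> t < t0 \<Longrightarrow> slope_at R t m \<Longrightarrow> 0 < m"
    using slope_at_pos by blast
  show ?thesis
  proof (rule that[of "\<Union>g\<in>G. slopes (D g)"])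
    show "finite (\<Union>g\<in>G. slopes (D g))" using G(1) finite_slopes by blast
    fix R assume R: "0 < R" "R \<le> R0"
    have "\<exists>K\<ge>1. \<exists>\<eta>>0. \<forall>t m. 0 < t \<and> t < \<eta> \<and> 0 < m \<and> g (R, t, m) = 0 \<and> (\<exists>t m. g (R, t, m) \<noteq> 0) \<longrightarrow>
        (\<exists>\<theta>\<in>slopes (D g). t powr \<theta> \<le> K * m \<and> m \<le> K * t powr \<theta>)" if g: "g \<in> G" for g
    proof -
      obtain p :: "real poly poly" where p: "degree p \<le> D g" "\<And>j. degree (coeff p j) \<le> D g"
        "\<And>t m. g (R, t, m) = poly (poly p [:m:]) t" using D[OF g, of R] by blast
      show ?thesis
      proof (cases "p = 0")
        case True
        then have "g (R, t, m) = 0" for t m using p(3) by simp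
        then show ?thesis using zero_less_one le_refl by blast
      next
        case False
        from root_asymptotics[OF this p(1,2)] show ?thesis unfolding p(3) by blast
      qed
    qed
    then obtain K \<eta> where K: "\<And>g. g \<in> G \<Longrightarrow> 1 \<le> K g" "\<And>g. g \<in> G \<Longrightarrow> 0 < \<eta> g"
      "\<And>g t m. g \<in> G \<Longrightarrow> 0 < t \<Longrightarrow> t < \<eta> g \<Longrightarrow> 0 < m \<Longrightarrow> g (R, t, m) = 0 \<Longrightarrow> \<exists>t m. g (R, t, m) \<noteq> 0 \<Longrightarrow>
        \<exists>\<theta>\<in>slopes (D g). t powr \<theta> \<le> K g * m \<and> m \<le> K g * t powr \<theta>" by metis
    define K' where "K' = 1 + (\<Sum>g\<in>G. K g)"
    define \<eta>' where "\<eta>' = Min (insert t0 (\<eta> ` G))"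
    have K': "1 \<le> K'" "\<And>g. g \<in> G \<Longrightarrow> K g \<le> K'"
    proof -
      have nn: "\<And>g. g \<in> G \<Longrightarrow> 0 \<le> K g" using K(1) by (meson order_trans zero_le_one)
      then show "1 \<le> K'" unfolding K'_def by (simp add: sum_nonneg)
      show "K g \<le> K'" if "g \<in> G" for g
        using member_le_sum[OF that _ G(1), of K] nn by (simp add: K'_def)
    qed
    have \<eta>': "0 < \<eta>'" "\<eta>' \<le> t0" "\<And>g. g \<in> G \<Longrightarrow> \<eta>' \<le> \<eta> g"
      using G(1) t0(1) K(2) unfolding \<eta>'_def by (auto simp del: Min_insert intro!: Min_le)
    have "\<exists>\<theta>\<in>\<Union>g\<in>G. slopes (D g). t powr \<theta> \<le> K' * m \<and> m \<le> K' * t powr \<theta>"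
      if h: "0 < t" "t < \<eta>'" "slope_at R t m" for t m
    proof -
      have m: "0 < m" using t0(2)[OF h(1) _ h(3)] h(2) \<eta>'(2) by simp
      obtain g where g: "g \<in> G" "g (R, t, m) = 0" "\<exists>m'. g (R, t, m') \<noteq> 0" using G(3)[OF h(3)] by blast
      then obtain \<theta> where \<theta>: "\<theta> \<in> slopes (D g)" "t powr \<theta> \<le> K g * m" "m \<le> K g * t powr \<theta>"
        using K(3)[OF g(1) h(1) _ m g(2)] h(2) \<eta>'(3)[OF g(1)] by force
      have "K g * m \<le> K' * m" "K g * t powr \<theta> \<le> K' * t powr \<theta>"
        using K'(2)[OF g(1)] m by (auto intro: mult_right_mono)
      with \<theta> g(1) show ?thesis by (intro bexI[of _ \<theta>]) auto
    qed
    with K'(1) \<eta>'(1) show "\<exists>K\<ge>1. \<exists>\<eta>>0. \<forall>t m. 0 < t \<and> t < \<eta> \<and> slope_at R t m \<longrightarrow>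
        (\<exists>\<theta>\<in>\<Union>g\<in>G. slopes (D g). t powr \<theta> \<le> K * m \<and> m \<le> K * t powr \<theta>)" by blast
  qed
qed

text \<open>Since only finitely many exponents occur, the set of admissible Lojasiewicz exponents
  stabilises as the radius shrinks.\<close>

theorem lojasiewicz_uniform:
  obtains R1 where "0 < R1" "R1 \<le> R0" "\<And>R q. 0 < R \<Longrightarrow> R \<le> R0 \<Longrightarrow> lojasiewicz R q \<Longrightarrow> lojasiewicz R1 q"
proof -
  obtain \<Theta> where \<Theta>: "finite \<Theta>" "\<And>R. 0 < R \<Longrightarrow> R \<le> R0 \<Longrightarrow>
     \<exists>K\<ge>1. \<exists>\<eta>>0. \<forall>t m. 0 < t \<and> t < \<eta> \<and> slope_at R t m \<longrightarrow>
       (\<exists>\<theta>\<in>\<Theta>. t powr \<theta> \<le> K * m \<and> m \<le> K * t powr \<theta>)" using slope_at_asymptotics by blast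
  have char: "\<exists>\<Theta>'\<subseteq>\<Theta>. {q. lojasiewicz R q} = {q. \<forall>\<theta>\<in>\<Theta>'. \<theta> \<le> q}" if R: "0 < R" "R \<le> R0" for R
  proof -
    obtain K \<eta> where K: "1 \<le> K" "0 < \<eta>" "\<And>t m. 0 < t \<Longrightarrow> t < \<eta> \<Longrightarrow> slope_at R t m \<Longrightarrow>
        \<exists>\<theta>\<in>\<Theta>. t powr \<theta> \<le> K * m \<and> m \<le> K * t powr \<theta>" using \<Theta>(2)[OF R] by blast
    \<comment> \<open>The exponents realised as upper bounds on arbitrarily low levels; these are
      the ones that rule out a smaller \<open>q\<close>.\<close>
    define \<Theta>' where "\<Theta>' = {\<theta>\<in>\<Theta>. \<forall>\<epsilon>>0. \<exists>t m. 0 < t \<and> t < \<epsilon> \<and> slope_at R t m \<and> m \<le> K * t powr \<theta>}"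
    have "lojasiewicz R q \<longleftrightarrow> (\<forall>\<theta>\<in>\<Theta>'. \<theta> \<le> q)" for q
    proof
      assume "lojasiewicz R q"
      then obtain c \<epsilon> where c: "0 < c" "0 < \<epsilon>"
        "\<And>t m. 0 < t \<Longrightarrow> t < \<epsilon> \<Longrightarrow> slope_at R t m \<Longrightarrow> c * t powr q \<le> m"
        unfolding lojasiewicz_slope_at[OF R] by blast
      show "\<forall>\<theta>\<in>\<Theta>'. \<theta> \<le> q"
      proof (rule ballI, rule ccontr)
        fix \<theta> assume \<theta>: "\<theta> \<in> \<Theta>'" "\<not> \<theta> \<le> q"
        \<comment> \<open>Below this height \<open>t powr (\<theta> - q)\<close> is less than
          \<open>c / K\<close>.\<close>
        define \<delta> where "\<delta> = min \<epsilon> ((c / K) powr (1 / (\<theta> - q)))"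
        have "0 < \<delta>" using c K by (simp add: \<delta>_def)
        with \<theta> obtain t m where t: "0 < t" "t < \<delta>" "slope_at R t m" "m \<le> K * t powr \<theta>"
          unfolding \<Theta>'_def by blast
        have "c * t powr q \<le> K * t powr \<theta>" using c(3)[of t m] t by (simp add: \<delta>_def)
        then have "c / K \<le> t powr (\<theta> - q)" using K t by (simp add: powr_diff field_simps)
        also have "\<dots> < ((c / K) powr (1 / (\<theta> - q))) powr (\<theta> - q)"
          using t \<theta> by (intro powr_less_mono2) (auto simp: \<delta>_def)
        also have "\<dots> = c / K" using \<theta> c K by (simp add: powr_powr)
        finally show False by simp
      qed
    next
      assume q: "\<forall>\<theta>\<in>\<Theta>'. \<theta> \<le> q"
      have "\<exists>\<epsilon>>0. \<forall>t m. 0 < t \<and> t < \<epsilon> \<and> slope_at R t m \<longrightarrow> \<not> m \<le> K * t powr \<theta>" if "\<theta> \<in> \<Theta> - \<Theta>'" for \<theta>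
        using that by (auto simp: \<Theta>'_def)
      then obtain \<epsilon> where \<epsilon>: "\<And>\<theta>. \<theta> \<in> \<Theta> - \<Theta>' \<Longrightarrow> 0 < \<epsilon> \<theta>"
        "\<And>\<theta> t m. \<theta> \<in> \<Theta> - \<Theta>' \<Longrightarrow> 0 < t \<Longrightarrow> t < \<epsilon> \<theta> \<Longrightarrow> slope_at R t m \<Longrightarrow> \<not> m \<le> K * t powr \<theta>" by metis
      define \<delta> where "\<delta> = Min (insert (min \<eta> 1) (\<epsilon> ` (\<Theta> - \<Theta>')))"
      have \<delta>: "0 < \<delta>" "\<delta> \<le> min \<eta> 1" "\<And>\<theta>. \<theta> \<in> \<Theta> - \<Theta>' \<Longrightarrow> \<delta> \<le> \<epsilon> \<theta>"
      proof -
        have fin: "finite (insert (min \<eta> 1) (\<epsilon> ` (\<Theta> - \<Theta>')))" using \<Theta>(1) by simp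
        show "0 < \<delta>" unfolding \<delta>_def using K(2) \<epsilon>(1) by (subst Min_gr_iff[OF fin]) auto
        show "\<delta> \<le> min \<eta> 1" unfolding \<delta>_def by (rule Min_le[OF fin]) simp
        show "\<delta> \<le> \<epsilon> \<theta>" if "\<theta> \<in> \<Theta> - \<Theta>'" for \<theta>
          unfolding \<delta>_def by (rule Min_le[OF fin]) (use that in simp)
      qed
      have "(1 / K) * t powr q \<le> m" if t: "0 < t" "t < \<delta>" "slope_at R t m" for t m
      proof -
        obtain \<theta> where \<theta>: "\<theta> \<in> \<Theta>" "t powr \<theta> \<le> K * m" "m \<le> K * t powr \<theta>"
          using K(3)[of t m] t \<delta>(2) by auto
        have "\<theta> \<in> \<Theta>'"
        proof (rule ccontr)
          assume "\<theta> \<notin> \<Theta>'"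
          with \<theta>(1) \<epsilon>(2)[of \<theta> t m] \<delta>(3)[of \<theta>] t \<theta>(3) show False by force
        qed
        with q have "\<theta> \<le> q" by blast
        then have "t powr q \<le> t powr \<theta>" using t \<delta>(2) by (intro powr_mono') auto
        with \<theta>(2) show ?thesis using K(1) by (simp add: field_simps)
      qed
      moreover have "0 < 1 / K" using K(1) by simp
      ultimately show "lojasiewicz R q" unfolding lojasiewicz_slope_at[OF R] using \<delta>(1) by blast
    qed
    moreover have "\<Theta>' \<subseteq> \<Theta>" by (auto simp: \<Theta>'_def)
    ultimately show ?thesis by blast
  qed
  \<comment> \<open>Finitely many sets of admissible exponents occur, and shrinking the ball can
    only enlarge the set; so a maximal one contains all others.\<close>
  define U where "U = (\<lambda>R. {q. lojasiewicz R q}) ` {0<..R0}"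
  have "U \<subseteq> (\<lambda>\<Theta>'. {q. \<forall>\<theta>\<in>\<Theta>'. \<theta> \<le> q}) ` Pow \<Theta>" using char by (fastforce simp: U_def)
  then have "finite U" using \<Theta>(1) by (meson finite_Pow_iff finite_imageI finite_subset)
  moreover have "U \<noteq> {}" using R0 by (auto simp: U_def)
  ultimately obtain M where M: "M \<in> U" "\<And>N. N \<in> U \<Longrightarrow> M \<subseteq> N \<Longrightarrow> M = N"
    using finite_has_maximal[of U] by blast
  then obtain R1 where R1: "0 < R1" "R1 \<le> R0" "M = {q. lojasiewicz R1 q}" by (auto simp: U_def)
  show ?thesis
  proof (rule that[OF R1(1,2)])
    fix R q assume R: "0 < R" "R \<le> R0" "lojasiewicz R q"
    define R2 where "R2 = min R R1"
    have "{q. lojasiewicz R2 q} \<in> U" using R R1 by (auto simp: U_def R2_def)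
    moreover have "M \<subseteq> {q. lojasiewicz R2 q}" unfolding R1(3) R2_def by (auto elim: lojasiewicz_antimono)
    ultimately have "M = {q. lojasiewicz R2 q}" by (rule M(2))
    moreover have "lojasiewicz R2 q" using R(3) by (rule lojasiewicz_antimono) (simp add: R2_def)
    ultimately show "lojasiewicz R1 q" using R1(3) by blast
  qed
qed

end

section \<open>The Moreau envelope near a local minimizer\<close>

lemma lsc_eventually_nhds:
  assumes "lsc h" "c < h x"
  shows "\<forall>\<^sub>F z in nhds x. c < h z"
proof -
  have "c < Liminf (at x) h" using assms by (auto simp: lsc_def intro: less_le_trans)
  then have "\<forall>\<^sub>F z in at x. c < h z" by (rule less_LiminfD)
  with assms(2) show ?thesis by (simp add: eventually_nhds_conv_at)
qed

text \<open>Without a minimiser, open sets on which \<open>g\<close> exceeds some value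
  \<open>g (z x)\<close> would cover \<open>K\<close>; the least of finitely many such values would
  then exceed another of them.\<close>

lemma lower_semicontinuous_attains_inf:
  fixes g :: "'a::topological_space \<Rightarrow> 'b::linorder"
  assumes "compact K" "K \<noteq> {}" and lower: "\<And>x c. x \<in> K \<Longrightarrow> c < g x \<Longrightarrow> \<forall>\<^sub>F z in nhds x. c < g z"
  shows "\<exists>x\<in>K. \<forall>z\<in>K. g x \<le> g z"
proof (rule ccontr)
  assume "\<not> ?thesis"
  then have "\<forall>x\<in>K. \<exists>z\<in>K. g z < g x" by force
  then have "\<forall>x\<in>K. \<exists>U z. open U \<and> x \<in> U \<and> z \<in> K \<and> (\<forall>w\<in>U. g z < g w)"
    using lower unfolding eventually_nhds by metis
  then obtain U z where U: "\<And>x. x \<in> K \<Longrightarrow> open (U x) \<and> x \<in> U x \<and> z x \<in> K \<and> (\<forall>w\<in>U x. g (z x) < g w)"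
    by metis
  have cover: "K \<subseteq> (\<Union>x\<in>K. U x)" using U by blast
  obtain T where T: "T \<subseteq> K" "finite T" "K \<subseteq> (\<Union>x\<in>T. U x)"
  proof (rule compactE_image[OF assms(1)])
    show "open (U x)" if "x \<in> K" for x using U[OF that] by blast
  qed (use cover that in auto)
  have "T \<noteq> {}" using T(3) assms(2) by auto
  then have "Min ((g \<circ> z) ` T) \<in> (g \<circ> z) ` T" using T(2) by (intro Min_in) auto
  then obtain y where y: "y \<in> T" "Min ((g \<circ> z) ` T) = g (z y)" by auto
  then have "z y \<in> K" using U T(1) by blast
  then obtain x where "x \<in> T" "z y \<in> U x" using T(3) by blast
  then have "g (z x) < g (z y)" using U T(1) by blast
  moreover have "Min ((g \<circ> z) ` T) \<le> g (z x)" using \<open>x \<in> T\<close> T(2) by (intro Min_le) auto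
  ultimately show False using y(2) by simp
qed

lemma prox_objective_lower:
  assumes "proper h" "lsc h" and c: "c < prox_objective h lam x y"
  shows "\<forall>\<^sub>F z in nhds y. c < prox_objective h lam x z"
proof -
  define q where "q z = 1 / (2 * lam) * (norm (z - x))\<^sup>2" for z
  have hq: "prox_objective h lam x z = h z + ereal (q z)" for z by (simp add: prox_objective_def q_def)
  have nm: "h z \<noteq> - \<infinity>" for z using assms(1) by (simp add: proper_def)
  obtain s where s: "c < ereal s" "ereal s < h y + ereal (q y)" using c ereal_dense2 unfolding hq by blast
  obtain s' where s': "c < ereal s'" "ereal s' < ereal s" using s(1) ereal_dense2 by blast
  define d where "d = s - q y"
  have "ereal d < h y" using s(2) nm[of y] by (cases "h y") (auto simp: d_def)
  from lsc_eventually_nhds[OF assms(2) this] have 1: "\<forall>\<^sub>F z in nhds y. ereal d < h z" .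
  have "isCont q y" unfolding q_def by (intro continuous_intros)
  then have "(q \<longlongrightarrow> q y) (nhds y)" by (simp add: continuous_within tendsto_nhds_iff isCont_def)
  then have 2: "\<forall>\<^sub>F z in nhds y. q y - (s - s') < q z" using s'(2) by (intro order_tendstoD) auto
  from 1 2 show ?thesis
  proof eventually_elim
    case (elim z)
    have "c < ereal (d + q z)" using elim(2) s'(1) by (auto simp: d_def intro: less_trans)
    also have "\<dots> \<le> h z + ereal (q z)" using elim(1) nm[of z] by (cases "h z") auto
    finally show ?case unfolding hq .
  qed
qed

text \<open>Prox-boundedness gives a quadratic minorant centred at an unrelated point
  \<open>xh\<close>. Near \<open>xb\<close> local minimality takes over; away from it, a multiple of
  the squared distance to \<open>xb\<close> absorbs the constants and the change of centre.\<close>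

lemma prox_bounded_quadratic_minorant:
  fixes h :: "'a::euclidean_space \<Rightarrow> ereal"
  assumes "prox_bounded h" "local_minimizer h xb" "h xb = ereal hb"
  obtains a \<delta> where "0 \<le> a" "0 < \<delta>" "\<And>y. y \<in> ball xb \<delta> \<Longrightarrow> ereal hb \<le> h y"
    "\<And>y. ereal (hb - a * (norm (y - xb))\<^sup>2) \<le> h y"
proof -
  obtain lam xh where lam: "0 < lam" "- \<infinity> < moreau_env h lam xh"
    using assms(1) by (auto simp: prox_bounded_def)
  obtain c where c: "ereal c < moreau_env h lam xh" using lam(2) ereal_dense2 by blast
  have "moreau_env h lam xh \<le> prox_objective h lam xh y" for y
    unfolding moreau_env_def by (rule INF_lower) simp
  with c have cy: "ereal c \<le> h y + ereal (1 / (2 * lam) * (norm (y - xh))\<^sup>2)" for y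
    unfolding prox_objective_def by (meson less_imp_le less_le_trans)
  obtain \<delta> where \<delta>: "0 < \<delta>" "\<And>y. y \<in> ball xb \<delta> \<Longrightarrow> ereal hb \<le> h y"
    using assms(2,3) unfolding local_minimizer_def eventually_nhds_metric by (auto simp: dist_commute)
  define E where "E = (norm (xb - xh))\<^sup>2"
  \<comment> \<open>The term \<open>1 / lam\<close> stems from
    \<open>(norm (y - xh))\<^sup>2 \<le> 2 * D\<^sup>2 + 2 * E\<close>; the constants are multiplied
    by \<open>D\<^sup>2 / \<delta>\<^sup>2\<close>, which is at least 1.\<close>
  define a where "a = 1 / lam + (\<bar>hb - c\<bar> + E / lam) / \<delta>\<^sup>2"
  have a: "0 \<le> a" using lam by (auto simp: a_def E_def)
  have "ereal (hb - a * (norm (y - xb))\<^sup>2) \<le> h y" for y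
  proof (cases "y \<in> ball xb \<delta>")
    case True
    have "ereal (hb - a * (norm (y - xb))\<^sup>2) \<le> ereal hb" using a by simp
    also have "\<dots> \<le> h y" using \<delta> True by blast
    finally show ?thesis .
  next
    case False
    define D where "D = norm (y - xb)"
    have D: "\<delta> \<le> D" using False by (simp add: D_def dist_norm norm_minus_commute)
    then have "1 \<le> D\<^sup>2 / \<delta>\<^sup>2" using \<delta>(1) by (simp add: power_mono)
    then have "(\<bar>hb - c\<bar> + E / lam) * 1 \<le> (\<bar>hb - c\<bar> + E / lam) * (D\<^sup>2 / \<delta>\<^sup>2)"
      using lam by (intro mult_left_mono) (auto simp: E_def)
    then have aD: "D\<^sup>2 / lam + \<bar>hb - c\<bar> + E / lam \<le> a * D\<^sup>2" by (simp add: a_def field_simps)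
    have "norm (y - xh) \<le> D + norm (xb - xh)"
      using norm_triangle_ineq[of "y - xb" "xb - xh"] by (simp add: D_def)
    then have "(norm (y - xh))\<^sup>2 \<le> (D + norm (xb - xh))\<^sup>2" by (intro power_mono) auto
    also have "\<dots> \<le> 2 * D\<^sup>2 + 2 * E"
      using sum_squares_bound[of D "norm (xb - xh)"] by (simp add: E_def power2_sum)
    finally have "1 / (2 * lam) * (norm (y - xh))\<^sup>2 \<le> 1 / (2 * lam) * (2 * D\<^sup>2 + 2 * E)"
      using lam by (intro mult_left_mono) auto
    also have "\<dots> = D\<^sup>2 / lam + E / lam" using lam by (simp add: field_simps)
    finally have "hb - a * D\<^sup>2 \<le> c - 1 / (2 * lam) * (norm (y - xh))\<^sup>2" using aD by linarith
    with cy[of y] show ?thesis unfolding D_def by (cases "h y") auto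
  qed
  with a \<delta> that show ?thesis by blast
qed

text \<open>Optimality bounds the difference quotient below by
  \<open>- norm (z - y) / (2 * lam)\<close>, which tends to 0. This gives a regular subgradient, and
  constant sequences make it a limiting one.\<close>

lemma Prox_subgradient:
  fixes h :: "'a::euclidean_space \<Rightarrow> ereal"
  assumes "proper h" "0 < lam" "y \<in> Prox h lam x" "h y = ereal t"
  shows "(x - y) /\<^sub>R lam \<in> limiting_subdiff h y"
proof -
  define v where "v = (x - y) /\<^sub>R lam"
  have nm: "h z \<noteq> - \<infinity>" for z using assms(1) by (simp add: proper_def)
  have le: "ereal (- norm (z - y) / (2 * lam)) \<le> (h z - h y - ereal (v \<bullet> (z - y))) / ereal (norm (z - y))"
    if z: "z \<noteq> y" for z
  proof -
    have "prox_objective h lam x y \<le> prox_objective h lam x z" using assms(3) by (simp add: Prox_def)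
    then have opt: "ereal (t + 1 / (2 * lam) * (norm (y - x))\<^sup>2) \<le> h z + ereal (1 / (2 * lam) * (norm (z - x))\<^sup>2)"
      by (simp add: prox_objective_def assms(4))
    show ?thesis
    proof (cases "h z")
      case (real s)
      have "(norm (z - x))\<^sup>2 = (norm (y - x))\<^sup>2 - 2 * ((x - y) \<bullet> (z - y)) + (norm (z - y))\<^sup>2"
        by (simp add: power2_norm_eq_inner inner_diff_left inner_diff_right inner_commute)
      moreover have "(x - y) \<bullet> (z - y) = lam * (v \<bullet> (z - y))" using assms(2) by (simp add: v_def)
      ultimately have "1 / (2 * lam) * (norm (z - x))\<^sup>2 = 1 / (2 * lam) * (norm (y - x))\<^sup>2 - v \<bullet> (z - y)
          + 1 / (2 * lam) * (norm (z - y))\<^sup>2"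
        using assms(2) by (simp add: field_simps)
      with opt have "- (1 / (2 * lam) * (norm (z - y))\<^sup>2) \<le> s - t - v \<bullet> (z - y)" by (simp add: real)
      then have "- norm (z - y) / (2 * lam) \<le> (s - t - v \<bullet> (z - y)) / norm (z - y)"
        using z assms(2) by (simp add: pos_le_divide_eq power2_eq_square)
      moreover have "(h z - h y - ereal (v \<bullet> (z - y))) / ereal (norm (z - y)) =
          ereal ((s - t - v \<bullet> (z - y)) / norm (z - y))"
        using z by (simp only: real assms(4) ereal_minus(1) ereal_divide) simp
      ultimately show ?thesis by simp
    next
      case PInf
      then show ?thesis using z by (simp add: assms(4))
    next
      case MInf
      then show ?thesis using nm by simp
    qed
  qed
  have "((\<lambda>z. - norm (z - y) / (2 * lam)) \<longlongrightarrow> - norm (y - y) / (2 * lam)) (at y)"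
    using assms(2) by (intro tendsto_intros) auto
  then have "((\<lambda>z. ereal (- norm (z - y) / (2 * lam))) \<longlongrightarrow> ereal 0) (at y)" by simp
  then have "Liminf (at y) (\<lambda>z. ereal (- norm (z - y) / (2 * lam))) = ereal 0"
    by (rule lim_imp_Liminf[rotated]) simp
  moreover have "Liminf (at y) (\<lambda>z. ereal (- norm (z - y) / (2 * lam))) \<le>
      Liminf (at y) (\<lambda>z. (h z - h y - ereal (v \<bullet> (z - y))) / ereal (norm (z - y)))"
    by (rule Liminf_mono) (use le in \<open>auto simp: eventually_at_filter\<close>)
  ultimately have "v \<in> regular_subdiff h y"
    using assms(4) by (simp add: regular_subdiff_def edom_def zero_ereal_def)
  moreover from this have "y \<in> edom h" by (simp add: regular_subdiff_def)
  ultimately have "v \<in> limiting_subdiff h y"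
    unfolding limiting_subdiff_def
    by (intro CollectI conjI exI[of _ "\<lambda>_. y"] exI[of _ "\<lambda>_. v"]) simp_all
  then show ?thesis by (simp add: v_def)
qed

text \<open>\<open>a_lam\<close> makes the proximal term outweigh the quadratic minorant, which
  confines proximal points near \<open>xb\<close>. \<open>lam_rho\<close> makes at least half of the
  squared distance survive the defect \<open>\<rho>\<close> of prox-regularity, which gives the
  Lipschitz constant 2.\<close>

locale prox_setting =
  fixes h :: "'a::euclidean_space \<Rightarrow> ereal" and xb :: 'a and hb a \<delta> \<epsilon> \<rho> lam :: real
  assumes proper: "proper h" and lsc: "lsc h" and hxb: "h xb = ereal hb"
    and a: "0 \<le> a" and \<delta>: "0 < \<delta>" and \<epsilon>: "0 < \<epsilon>" and \<rho>: "0 \<le> \<rho>" and lam: "0 < lam"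
    and a_lam: "8 * a * lam \<le> 1" and lam_rho: "2 * lam * \<rho> \<le> 1"
    and min: "\<And>y. y \<in> ball xb \<delta> \<Longrightarrow> ereal hb \<le> h y"
    and minorant: "\<And>y. ereal (hb - a * (norm (y - xb))\<^sup>2) \<le> h y"
    and prox_reg: "\<And>x u v. x \<in> ball xb \<epsilon> \<Longrightarrow> u \<in> ball xb \<epsilon> \<Longrightarrow> v \<in> limiting_subdiff h u \<Longrightarrow> norm v < \<epsilon> \<Longrightarrow>
      h u < ereal (hb + \<epsilon>) \<Longrightarrow> h u + ereal (v \<bullet> (x - u) - \<rho> / 2 * (norm (x - u))\<^sup>2) \<le> h x"
begin

lemma not_minfty: "h z \<noteq> - \<infinity>"
  using proper by (simp add: proper_def)

text \<open>With \<open>d\<close> and \<open>D\<close> the distances of \<open>x\<close> and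
  \<open>z\<close> from \<open>xb\<close>, one gets
  \<open>(norm (z - x))\<^sup>2 \<le> d\<^sup>2 + D\<^sup>2 / 4\<close>. Combined with
  \<open>D - d \<le> norm (z - x)\<close>, this gives \<open>D \<le> 8 / 3 * d\<close>, rounded up
  to 3.\<close>

lemma near_of_objective_le:
  assumes "prox_objective h lam x z \<le> prox_objective h lam x xb"
  shows "norm (z - xb) \<le> 3 * norm (x - xb)"
proof -
  define d where "d = norm (x - xb)"
  define D where "D = norm (z - xb)"
  have dD: "0 \<le> d" "0 \<le> D" by (auto simp: d_def D_def)
  obtain t where t: "h z = ereal t"
    using assms not_minfty[of z] by (cases "h z") (auto simp: prox_objective_def hxb)
  have "t + 1 / (2 * lam) * (norm (z - x))\<^sup>2 \<le> hb + 1 / (2 * lam) * d\<^sup>2"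
    using assms by (simp add: prox_objective_def hxb t d_def norm_minus_commute)
  moreover have "hb - a * D\<^sup>2 \<le> t" using minorant[of z] by (simp add: t D_def)
  ultimately have "1 / (2 * lam) * (norm (z - x))\<^sup>2 \<le> 1 / (2 * lam) * d\<^sup>2 + a * D\<^sup>2" by linarith
  then have "2 * lam * (1 / (2 * lam) * (norm (z - x))\<^sup>2) \<le> 2 * lam * (1 / (2 * lam) * d\<^sup>2 + a * D\<^sup>2)"
    using lam by (intro mult_left_mono) auto
  then have "(norm (z - x))\<^sup>2 \<le> d\<^sup>2 + (2 * lam * a) * D\<^sup>2" using lam by (simp add: algebra_simps)
  also have "(2 * lam * a) * D\<^sup>2 \<le> 1 / 4 * D\<^sup>2" using a_lam by (intro mult_right_mono) (auto simp: mult_ac)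
  finally have zx: "(norm (z - x))\<^sup>2 \<le> d\<^sup>2 + D\<^sup>2 / 4" by simp
  have "D \<le> norm (z - x) + d"
    using norm_triangle_ineq[of "z - x" "x - xb"] by (simp add: d_def D_def)
  show ?thesis
  proof (rule ccontr)
    assume "\<not> ?thesis"
    then have n: "3 * d < D" by (simp add: d_def D_def)
    then have "(D - d)\<^sup>2 \<le> (norm (z - x))\<^sup>2" using \<open>D \<le> norm (z - x) + d\<close> dD by (intro power_mono) auto
    with zx have "D * (D * (3 / 4)) \<le> D * (2 * d)" by (simp add: power2_eq_square algebra_simps)
    moreover have "0 < D" using n dD by simp
    ultimately have "D * (3 / 4) \<le> 2 * d" by (rule mult_left_le_imp_le)
    with n dD show False by simp
  qed
qed

lemma Prox_near: "y \<in> Prox h lam x \<Longrightarrow> norm (y - xb) \<le> 3 * norm (x - xb)"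
  by (rule near_of_objective_le) (simp add: Prox_def)

text \<open>Points outside the ball of radius \<open>3 * norm (x - xb)\<close> are worse than
  \<open>xb\<close>, so a minimiser over that compact ball is global.\<close>

lemma Prox_nonempty: "Prox h lam x \<noteq> {}"
proof -
  have "\<exists>y\<in>cball xb (3 * norm (x - xb)). \<forall>z\<in>cball xb (3 * norm (x - xb)).
      prox_objective h lam x y \<le> prox_objective h lam x z"
    by (rule lower_semicontinuous_attains_inf) (auto intro: prox_objective_lower[OF proper lsc])
  then obtain y where y: "\<And>z. z \<in> cball xb (3 * norm (x - xb)) \<Longrightarrow> prox_objective h lam x y \<le> prox_objective h lam x z"
    by blast
  have "prox_objective h lam x y \<le> prox_objective h lam x z" for z
  proof (cases "prox_objective h lam x z \<le> prox_objective h lam x xb")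
    case True
    from near_of_objective_le[OF this] show ?thesis by (intro y) (simp add: dist_norm norm_minus_commute)
  next
    case False
    then show ?thesis using y[of xb] by simp
  qed
  then show ?thesis by (auto simp: Prox_def)
qed

lemma Prox_value:
  assumes "y \<in> Prox h lam x"
  obtains t where "h y = ereal t" "moreau_env h lam x = ereal (t + 1 / (2 * lam) * (norm (y - x))\<^sup>2)"
    "t + 1 / (2 * lam) * (norm (y - x))\<^sup>2 \<le> hb + 1 / (2 * lam) * (norm (x - xb))\<^sup>2"
proof -
  have le: "\<And>z. prox_objective h lam x y \<le> prox_objective h lam x z" using assms by (simp add: Prox_def)
  obtain t where t: "h y = ereal t"
    using le[of xb] not_minfty[of y] by (cases "h y") (auto simp: prox_objective_def hxb)
  have "moreau_env h lam x = prox_objective h lam x y"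
    unfolding moreau_env_def using le by (intro antisym INF_lower INF_greatest) auto
  moreover have "t + 1 / (2 * lam) * (norm (y - x))\<^sup>2 \<le> hb + 1 / (2 * lam) * (norm (x - xb))\<^sup>2"
    using le[of xb] by (simp add: prox_objective_def t hxb norm_minus_commute)
  ultimately show ?thesis using that[of t] t by (simp add: prox_objective_def)
qed

text \<open>A proximal point is within \<open>3 * r\<close> of \<open>xb\<close> and
  \<open>4 * r\<close> of \<open>x\<close>. So it lies in both balls, its subgradient
  \<open>(x - y) /\<^sub>R lam\<close> is shorter than \<open>\<epsilon>\<close>, and with
  \<open>r \<le> 1\<close> its value stays below \<open>hb + \<epsilon>\<close>.\<close>

definition r :: real where "r = Min {\<epsilon> / 4, \<delta> / 4, lam * \<epsilon> / 4, 1}"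

lemma r: "0 < r" "4 * r \<le> \<epsilon>" "4 * r \<le> \<delta>" "4 * r \<le> lam * \<epsilon>" "r \<le> 1"
  using \<epsilon> \<delta> lam by (simp_all add: r_def)

lemma Prox_prox_regular:
  assumes x: "x \<in> ball xb r" and y: "y \<in> Prox h lam x"
  shows "y \<in> ball xb \<epsilon>" "y \<in> ball xb \<delta>"
    "\<And>z. z \<in> ball xb \<epsilon> \<Longrightarrow> h y + ereal (((x - y) /\<^sub>R lam) \<bullet> (z - y) - \<rho> / 2 * (norm (z - y))\<^sup>2) \<le> h z"
proof -
  define d where "d = norm (x - xb)"
  have d: "d < r" "0 \<le> d" using x by (auto simp: d_def dist_norm norm_minus_commute)
  have yd: "norm (y - xb) \<le> 3 * d" using Prox_near[OF y] by (simp add: d_def)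
  show ye: "y \<in> ball xb \<epsilon>" and "y \<in> ball xb \<delta>"
    using yd d r by (auto simp: dist_norm norm_minus_commute)
  obtain t where t: "h y = ereal t" "t + 1 / (2 * lam) * (norm (y - x))\<^sup>2 \<le> hb + 1 / (2 * lam) * d\<^sup>2"
    using Prox_value[OF y] unfolding d_def by metis
  have "norm (x - y) \<le> 4 * d"
    using norm_triangle_ineq[of "x - xb" "xb - y"] yd by (simp add: d_def norm_minus_commute)
  then have "norm (x - y) < \<epsilon> * lam" using d(1) r(4) by (simp add: mult.commute)
  then have v: "norm ((x - y) /\<^sub>R lam) < \<epsilon>"
    using lam by (simp add: pos_divide_less_eq divide_inverse_commute[symmetric])
  have "d * d \<le> d * 1" using d r by (intro mult_left_mono) auto
  then have "d\<^sup>2 < lam * \<epsilon>" using d r by (simp add: power2_eq_square)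
  then have "d\<^sup>2 < 2 * (lam * \<epsilon>)" using mult_pos_pos[OF lam \<epsilon>] by linarith
  then have "d\<^sup>2 / (2 * lam) < \<epsilon>" using lam by (simp add: pos_divide_less_eq mult_ac)
  then have "1 / (2 * lam) * d\<^sup>2 < \<epsilon>" by simp
  moreover have "0 \<le> 1 / (2 * lam) * (norm (y - x))\<^sup>2" using lam by simp
  ultimately have "h y < ereal (hb + \<epsilon>)" using t by simp
  then show "h y + ereal (((x - y) /\<^sub>R lam) \<bullet> (z - y) - \<rho> / 2 * (norm (z - y))\<^sup>2) \<le> h z" if "z \<in> ball xb \<epsilon>" for z
    using prox_reg[OF that ye Prox_subgradient[OF proper lam y t(1)] v] by blast
qed

text \<open>Adding the prox-regularity inequalities at the two proximal points gives
  hypomonotonicity of their subgradients with constant \<open>\<rho>\<close>, and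
  \<open>lam * \<rho> \<le> 1 / 2\<close> leaves half of the squared distance. The case
  \<open>x = x'\<close> yields single-valuedness.\<close>

lemma Prox_Lipschitz:
  assumes x: "x \<in> ball xb r" "y \<in> Prox h lam x" and x': "x' \<in> ball xb r" "y' \<in> Prox h lam x'"
  shows "norm (y - y') \<le> 2 * norm (x - x')"
proof -
  obtain t where t: "h y = ereal t" using Prox_value[OF x(2)] by metis
  obtain t' where t': "h y' = ereal t'" using Prox_value[OF x'(2)] by metis
  define v where "v = (x - y) /\<^sub>R lam"
  define v' where "v' = (x' - y') /\<^sub>R lam"
  define N where "N = norm (y - y')"
  have "t + (v \<bullet> (y' - y) - \<rho> / 2 * N\<^sup>2) \<le> t'"
    using Prox_prox_regular(3)[OF x Prox_prox_regular(1)[OF x']] by (simp add: t t' v_def N_def norm_minus_commute)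
  moreover have "t' + (v' \<bullet> (y - y') - \<rho> / 2 * N\<^sup>2) \<le> t"
    using Prox_prox_regular(3)[OF x' Prox_prox_regular(1)[OF x]] by (simp add: t t' v'_def N_def)
  ultimately have "(v' - v) \<bullet> (y - y') \<le> \<rho> * N\<^sup>2"
    by (simp add: inner_diff_left inner_diff_right)
  then have "lam * ((v' - v) \<bullet> (y - y')) \<le> lam * (\<rho> * N\<^sup>2)" using lam by (intro mult_left_mono) auto
  moreover have "lam *\<^sub>R v = x - y" "lam *\<^sub>R v' = x' - y'" using lam by (auto simp: v_def v'_def)
  then have "lam * ((v' - v) \<bullet> (y - y')) = ((x' - y') - (x - y)) \<bullet> (y - y')"
    by (metis inner_scaleR_left scaleR_diff_right)
  moreover have "((x' - y') - (x - y)) \<bullet> (y - y') = N\<^sup>2 - (x - x') \<bullet> (y - y')"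
    by (simp add: N_def power2_norm_eq_inner algebra_simps inner_diff_left inner_diff_right inner_commute)
  moreover have "lam * (\<rho> * N\<^sup>2) \<le> 1 / 2 * N\<^sup>2"
    using mult_right_mono[of "lam * \<rho>" "1 / 2" "N\<^sup>2"] lam_rho by (simp add: mult_ac)
  moreover have "(x - x') \<bullet> (y - y') \<le> norm (x - x') * N" unfolding N_def by (rule norm_cauchy_schwarz)
  ultimately have "N * N \<le> 2 * norm (x - x') * N" by (simp add: power2_eq_square)
  then show ?thesis unfolding N_def by (cases "y = y'") (auto simp: mult_le_cancel_right_pos)
qed

abbreviation P where "P \<equiv> prox_point h lam"

lemma Prox_eq: "x \<in> ball xb r \<Longrightarrow> Prox h lam x = {P x}"
proof -
  assume x: "x \<in> ball xb r"
  obtain y where y: "y \<in> Prox h lam x" using Prox_nonempty by blast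
  have "z = y" if "z \<in> Prox h lam x" for z using Prox_Lipschitz[OF x that x y] by simp
  with y have "Prox h lam x = {y}" by blast
  then show ?thesis by (simp add: prox_point_def)
qed

lemma P_in_Prox: "x \<in> ball xb r \<Longrightarrow> P x \<in> Prox h lam x"
  by (simp add: Prox_eq)

definition E where "E x = real_of_ereal (moreau_env h lam x)"

definition F where "F x = (x - P x) /\<^sub>R lam"

lemma moreau_finite:
  assumes "x \<in> ball xb r"
  shows "\<bar>moreau_env h lam x\<bar> \<noteq> \<infinity>"
proof -
  obtain t where "moreau_env h lam x = ereal (t + 1 / (2 * lam) * (norm (P x - x))\<^sup>2)"
    using Prox_value[OF P_in_Prox[OF assms]] by blast
  then show ?thesis by simp
qed

lemma E_value:
  assumes "x \<in> ball xb r"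
  obtains t where "h (P x) = ereal t" "E x = t + 1 / (2 * lam) * (norm (P x - x))\<^sup>2"
proof -
  obtain t where "h (P x) = ereal t" "moreau_env h lam x = ereal (t + 1 / (2 * lam) * (norm (P x - x))\<^sup>2)"
    using Prox_value[OF P_in_Prox[OF assms]] by blast
  then show ?thesis using that[of t] by (simp add: E_def)
qed

text \<open>The proximal point of \<open>x\<close> is a competitor in the infimum at
  \<open>x'\<close>; expanding the square gives the bound.\<close>

lemma E_upper:
  assumes "x \<in> ball xb r" "x' \<in> ball xb r"
  shows "E x' \<le> E x + F x \<bullet> (x' - x) + 1 / (2 * lam) * (norm (x' - x))\<^sup>2"
proof -
  obtain t where t: "h (P x) = ereal t" "E x = t + 1 / (2 * lam) * (norm (P x - x))\<^sup>2"
    using E_value[OF assms(1)] by blast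
  have "moreau_env h lam x' \<le> prox_objective h lam x' (P x)"
    unfolding moreau_env_def by (rule INF_lower) simp
  also have "\<dots> = ereal (t + 1 / (2 * lam) * (norm (P x - x'))\<^sup>2)" by (simp add: prox_objective_def t)
  finally have "E x' \<le> t + 1 / (2 * lam) * (norm (P x - x'))\<^sup>2"
    using moreau_finite[OF assms(2)] unfolding E_def by (cases "moreau_env h lam x'") auto
  also have "(norm (P x - x'))\<^sup>2 = (norm (P x - x))\<^sup>2 + 2 * ((x - P x) \<bullet> (x' - x)) + (norm (x' - x))\<^sup>2"
    by (simp add: power2_norm_eq_inner inner_diff_left inner_diff_right inner_commute)
  also have "(x - P x) \<bullet> (x' - x) = lam * (F x \<bullet> (x' - x))" using lam by (simp add: F_def)
  finally have "E x' \<le> t + 1 / (2 * lam) * ((norm (P x - x))\<^sup>2 + 2 * (lam * (F x \<bullet> (x' - x))) + (norm (x' - x))\<^sup>2)" .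
  also have "\<dots> = t + 1 / (2 * lam) * (norm (P x - x))\<^sup>2 + F x \<bullet> (x' - x) + 1 / (2 * lam) * (norm (x' - x))\<^sup>2"
    using lam by (simp add: distrib_left)
  finally show ?thesis by (simp add: t(2))
qed

lemma F_Lipschitz:
  assumes "x \<in> ball xb r" "x' \<in> ball xb r"
  shows "norm (F x - F x') \<le> 3 / lam * norm (x - x')"
proof -
  have "F x - F x' = ((x - x') - (P x - P x')) /\<^sub>R lam" by (simp add: F_def scaleR_diff_right)
  then have "norm (F x - F x') = norm ((x - x') - (P x - P x')) / lam" using lam by (simp add: divide_inverse)
  also have "\<dots> \<le> (norm (x - x') + norm (P x - P x')) / lam"
    using lam by (intro divide_right_mono norm_triangle_ineq4) auto
  also have "\<dots> \<le> (norm (x - x') + 2 * norm (x - x')) / lam"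
    using lam Prox_Lipschitz[OF assms(1) P_in_Prox[OF assms(1)] assms(2) P_in_Prox[OF assms(2)]]
    by (intro divide_right_mono) auto
  finally show ?thesis by simp
qed

end

section \<open>Gradient and critical points of the Moreau envelope\<close>

context prox_setting
begin

text \<open>The upper bound at \<open>x\<close>, and the one at \<open>y\<close> with the roles
  exchanged, bracket \<open>E y\<close>; the Lipschitz property of \<open>F\<close> makes the
  bracket quadratically narrow.\<close>

lemma GDERIV_E:
  assumes x: "x \<in> ball xb r"
  shows "GDERIV E x :> F x"
proof -
  have bound: "\<bar>E y - E x - (y - x) \<bullet> F x\<bar> \<le> 4 / lam * (norm (y - x))\<^sup>2" if y: "y \<in> ball xb r" for y
  proof -
    define u where "u = (norm (y - x))\<^sup>2 / lam"
    have u: "0 \<le> u" unfolding u_def by (rule divide_nonneg_pos[OF zero_le_power2 lam])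
    have "E y \<le> E x + F x \<bullet> (y - x) + u / 2" using E_upper[OF x y] by (simp add: u_def)
    moreover have "E x \<le> E y + F y \<bullet> (x - y) + u / 2"
      using E_upper[OF y x] by (simp add: u_def norm_minus_commute)
    moreover have "\<bar>(F x - F y) \<bullet> (x - y)\<bar> \<le> 3 * u"
    proof -
      have "\<bar>(F x - F y) \<bullet> (x - y)\<bar> \<le> norm (F x - F y) * norm (x - y)" by (rule Cauchy_Schwarz_ineq2)
      also have "\<dots> \<le> 3 / lam * norm (x - y) * norm (x - y)"
        by (intro mult_right_mono F_Lipschitz x y) auto
      finally show ?thesis by (simp add: u_def power2_eq_square norm_minus_commute)
    qed
    moreover have "(F x - F y) \<bullet> (x - y) = - (F x \<bullet> (y - x)) - F y \<bullet> (x - y)"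
      by (simp add: inner_diff_left inner_diff_right)
    moreover have "4 / lam * (norm (y - x))\<^sup>2 = 4 * u" by (simp add: u_def)
    ultimately show ?thesis using u unfolding inner_commute[of "y - x"] by linarith
  qed
  have "((\<lambda>y. norm (E y - E x - (y - x) \<bullet> F x) / norm (y - x)) \<longlongrightarrow> 0) (at x)"
  proof (rule tendsto_sandwich[where f = "\<lambda>_. 0" and h = "\<lambda>y. 4 / lam * norm (y - x)"])
    have "\<forall>\<^sub>F y in at x. y \<in> ball xb r" by (rule eventually_at_in_open'[OF open_ball x])
    then show "\<forall>\<^sub>F y in at x. norm (E y - E x - (y - x) \<bullet> F x) / norm (y - x) \<le> 4 / lam * norm (y - x)"
    proof eventually_elim
      case (elim y)
      then show ?case using bound[OF elim] by (cases "y = x") (auto simp: pos_divide_le_eq power2_eq_square mult.assoc)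
    qed
    have "((\<lambda>y. 4 / lam * norm (y - x)) \<longlongrightarrow> 4 / lam * norm (x - x)) (at x)" by (intro tendsto_intros)
    then show "((\<lambda>y. 4 / lam * norm (y - x)) \<longlongrightarrow> 0) (at x)" by simp
  qed (auto intro!: always_eventually)
  then show ?thesis
    unfolding gderiv_def has_derivative_iff_norm by (simp add: bounded_linear_inner_left)
qed

lemma gradient_E:
  assumes x: "x \<in> ball xb r"
  shows "gradient E x = F x"
  unfolding gradient_def
proof (rule the_equality)
  show "GDERIV E x :> F x" by (rule GDERIV_E[OF x])
  fix D assume "GDERIV E x :> D"
  with GDERIV_E[OF x] have "(\<lambda>h. h \<bullet> D) = (\<lambda>h. h \<bullet> F x)"
    unfolding gderiv_def using has_derivative_unique by blast
  then have "h \<bullet> D = h \<bullet> F x" for h by (rule fun_cong)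
  then show "D = F x" using vector_eq_ldot by blast
qed

lemma continuous_on_F: "continuous_on (ball xb r) F"
  by (rule lipschitz_on_continuous_on[of "3 / lam"])
    (use F_Lipschitz lam in \<open>auto simp: lipschitz_on_def dist_norm\<close>)

lemma C1_on_E: "C1_on E (ball xb r)"
proof -
  have "continuous_on (ball xb r) (gradient E)"
    by (rule continuous_on_eq[OF continuous_on_F]) (simp add: gradient_E)
  moreover have "\<exists>D. GDERIV E x :> D" if "x \<in> ball xb r" for x using GDERIV_E[OF that] by blast
  ultimately show ?thesis unfolding C1_on_def by simp
qed

lemma P_xb: "P xb = xb"
  using Prox_near[OF P_in_Prox, of xb] r(1) by simp

lemma F_xb: "F xb = 0"
  by (simp add: F_def P_xb)

lemma E_xb: "E xb = hb"
proof -
  obtain t where "h (P xb) = ereal t" "E xb = t + 1 / (2 * lam) * (norm (P xb - xb))\<^sup>2"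
    using E_value[of xb] r(1) by auto
  then show ?thesis by (simp add: P_xb hxb)
qed

lemma E_ge: "x \<in> ball xb r \<Longrightarrow> hb \<le> E x"
proof -
  assume x: "x \<in> ball xb r"
  obtain t where t: "h (P x) = ereal t" "E x = t + 1 / (2 * lam) * (norm (P x - x))\<^sup>2"
    using E_value[OF x] by blast
  have "ereal hb \<le> h (P x)" by (intro min Prox_prox_regular(2)[OF x P_in_Prox[OF x]])
  then show ?thesis using t lam by (simp add: add_increasing2)
qed

lemma fixed_point:
  assumes "F x = 0"
  shows "P x = x"
  using assms lam by (simp add: F_def)

lemma critical_subdiff:
  assumes "x \<in> ball xb r" "F x = 0"
  shows "0 \<in> limiting_subdiff h x"
proof -
  have P: "P x = x" by (rule fixed_point[OF assms(2)])
  obtain t where "h (P x) = ereal t" using E_value[OF assms(1)] by blast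
  with Prox_subgradient[OF proper lam P_in_Prox[OF assms(1)]] show ?thesis by (simp add: P)
qed

text \<open>A zero of \<open>F\<close> is its own proximal point, so \<open>h\<close> and
  \<open>E\<close> agree there. The value \<open>hb\<close> is a lower bound of \<open>h\<close> on
  the \<open>\<delta>\<close>-ball, which contains \<open>x\<close> in its interior.\<close>

lemma critical_local_minimizer:
  assumes x: "x \<in> ball xb r" and F: "F x = 0" and "E x = hb"
  shows "local_minimizer h x" "h x = h xb"
proof -
  have P: "P x = x" by (rule fixed_point[OF F])
  obtain t where t: "h (P x) = ereal t" "E x = t + 1 / (2 * lam) * (norm (P x - x))\<^sup>2"
    using E_value[OF x] by blast
  then have hx: "h x = ereal hb" using assms(3) by (simp add: P)
  then show "h x = h xb" by (simp add: hxb)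
  have "x \<in> ball xb \<delta>" using x r by auto
  then have "\<forall>\<^sub>F y in nhds x. y \<in> ball xb \<delta>" by (intro eventually_nhds_in_open) auto
  then have "\<forall>\<^sub>F y in nhds x. h x \<le> h y" unfolding hx by eventually_elim (rule min)
  then show "local_minimizer h x" by (simp add: local_minimizer_def edom_def hx)
qed

end

section \<open>Descent with momentum\<close>

lemma powr_diff_concave:
  fixes s t q :: real
  assumes "0 < t" "t \<le> s" "0 \<le> q" "q < 1"
  shows "(1 - q) * s powr (- q) * (s - t) \<le> s powr (1 - q) - t powr (1 - q)"
proof -
  define u where "u = t / s"
  have s: "0 < s" using assms by simp
  have u: "0 < u" "t = u * s" using assms s by (auto simp: u_def)
  have "u powr (1 - q) * 1 powr q \<le> (1 - q) * u + q * 1"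
    using assms u by (intro Youngs_inequality_0) auto
  then have "(1 - q) * (1 - u) \<le> 1 - u powr (1 - q)" by (simp add: algebra_simps)
  then have "s powr (1 - q) * ((1 - q) * (1 - u)) \<le> s powr (1 - q) * (1 - u powr (1 - q))"
    by (intro mult_left_mono) auto
  moreover have "s powr (1 - q) = s powr (- q) * s" using s by (simp add: powr_diff powr_minus_divide)
  moreover have "t powr (1 - q) = u powr (1 - q) * s powr (1 - q)" using u s by (simp add: powr_mult)
  ultimately show ?thesis using u(2) by (simp add: algebra_simps)
qed

lemma powr_neg_diff:
  fixes s t \<alpha> :: real
  assumes "0 < t" "t \<le> s" "0 \<le> \<alpha>"
  shows "s powr (- \<alpha>) + \<alpha> * s powr (- \<alpha> - 1) * (s - t) \<le> t powr (- \<alpha>)"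
proof -
  define u where "u = t / s"
  have s: "0 < s" using assms by simp
  have u: "0 < u" "t = u * s" using assms s by (auto simp: u_def)
  have "1 + \<alpha> * (1 - u) \<le> 1 + \<alpha> * (- ln u)"
    using ln_le_minus_one[OF u(1)] assms(3) by (intro add_left_mono mult_left_mono) auto
  also have "\<dots> \<le> u powr (- \<alpha>)" using exp_ge_add_one_self[of "- \<alpha> * ln u"] u by (simp add: powr_def)
  finally have "s powr (- \<alpha>) * (1 + \<alpha> * (1 - u)) \<le> s powr (- \<alpha>) * u powr (- \<alpha>)"
    by (intro mult_left_mono) auto
  moreover have "s powr (- \<alpha>) = s powr (- \<alpha> - 1) * s" using s by (simp add: powr_diff)
  moreover have "t powr (- \<alpha>) = u powr (- \<alpha>) * s powr (- \<alpha>)" using u s by (simp add: powr_mult)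
  ultimately show ?thesis using u(2) by (simp add: algebra_simps)
qed

lemma powr_add_le_two:
  fixes x y q :: real
  assumes "0 \<le> x" "0 \<le> y" "0 \<le> q" "q \<le> 1"
  shows "(x + y) powr q \<le> 2 * (x powr q + y powr q)"
proof -
  have "(x + y) powr q \<le> (2 * max x y) powr q" using assms by (intro powr_mono2) auto
  also have "\<dots> = 2 powr q * max x y powr q" using assms by (simp add: powr_mult)
  also have "\<dots> \<le> 2 powr 1 * (x powr q + y powr q)"
    using assms by (intro mult_mono powr_mono) (auto simp: max_def)
  finally show ?thesis by simp
qed

lemma linear_decay:
  fixes s :: "nat \<Rightarrow> real"
  assumes "0 < c" and pos: "\<And>k. k0 \<le> k \<Longrightarrow> 0 < s k" and step: "\<And>k. k0 \<le> k \<Longrightarrow> s (Suc k) \<le> s k - c * s k"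
  obtains C \<mu> where "0 < C" "0 < \<mu>" "\<mu> < 1" "\<And>k. k0 \<le> k \<Longrightarrow> s k \<le> C * \<mu> ^ k"
proof -
  \<comment> \<open>The maximum with 1/2 keeps \<open>\<mu>\<close> positive when
    \<open>c \<ge> 1\<close>.\<close>
  define \<mu> where "\<mu> = max (1 - c) (1 / 2)"
  have \<mu>: "0 < \<mu>" "\<mu> < 1" "1 - c \<le> \<mu>" using assms(1) by (auto simp: \<mu>_def)
  define C where "C = s k0 / \<mu> ^ k0"
  have C: "0 < C" using \<mu> pos by (simp add: C_def)
  have "s k \<le> C * \<mu> ^ k" if "k0 \<le> k" for k
    using that
  proof (induction k rule: dec_induct)
    case base
    then show ?case using \<mu> by (simp add: C_def)
  next
    case (step k)
    have "s (Suc k) \<le> (1 - c) * s k" using assms(3)[of k] step by (simp add: algebra_simps)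
    also have "\<dots> \<le> \<mu> * s k" using pos[of k] step \<mu> by (intro mult_right_mono) auto
    also have "\<dots> \<le> \<mu> * (C * \<mu> ^ k)" using step \<mu> by (intro mult_left_mono) auto
    finally show ?case by (simp add: mult_ac)
  qed
  with C \<mu> that show ?thesis by blast
qed

text \<open>The quantity \<open>s k powr (- \<alpha>)\<close> grows by at least
  \<open>\<alpha> * c\<close> per step, hence linearly; inverting the power gives the rate.\<close>

lemma sublinear_decay:
  fixes s :: "nat \<Rightarrow> real"
  assumes c: "0 < c" and \<alpha>: "0 < \<alpha>" and pos: "\<And>k. k0 \<le> k \<Longrightarrow> 0 < s k"
    and step: "\<And>k. k0 \<le> k \<Longrightarrow> s (Suc k) \<le> s k - c * s k powr (1 + \<alpha>)"
  obtains C k1 where "0 < C" "k0 \<le> k1" "\<And>k. k1 \<le> k \<Longrightarrow> s k \<le> C * real k powr (- 1 / \<alpha>)"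
proof -
  have inc: "\<alpha> * c * (real k - real k0) \<le> s k powr (- \<alpha>)" if "k0 \<le> k" for k
    using that
  proof (induction k rule: dec_induct)
    case (step k)
    have sk: "0 < s k" "0 < s (Suc k)" using pos step by auto
    have d: "c * s k powr (1 + \<alpha>) \<le> s k - s (Suc k)" using assms(4)[of k] step by simp
    moreover have "0 \<le> c * s k powr (1 + \<alpha>)" using c by simp
    ultimately have le: "s (Suc k) \<le> s k" by linarith
    have "\<alpha> * c = \<alpha> * s k powr (- \<alpha> - 1) * (c * s k powr (1 + \<alpha>))"
      using sk by (simp add: mult_ac flip: powr_add)
    also have "\<dots> \<le> \<alpha> * s k powr (- \<alpha> - 1) * (s k - s (Suc k))"
      using d \<alpha> by (intro mult_left_mono) auto
    finally have "s k powr (- \<alpha>) + \<alpha> * c \<le> s (Suc k) powr (- \<alpha>)"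
      using powr_neg_diff[OF sk(2) le, of \<alpha>] \<alpha> by linarith
    with step(3) show ?case by (simp add: algebra_simps)
  qed simp
  \<comment> \<open>From this index on, \<open>k\<close> is positive and \<open>k - k0\<close> is at
    least \<open>k / 2\<close>.\<close>
  define k1 where "k1 = 2 * k0 + 1"
  define D where "D = \<alpha> * c / 2"
  have D: "0 < D" using \<alpha> c by (simp add: D_def)
  have "s k \<le> D powr (- 1 / \<alpha>) * real k powr (- 1 / \<alpha>)" if "k1 \<le> k" for k
  proof -
    have k: "k0 \<le> k" "0 < k" "real k / 2 \<le> real k - real k0" using that by (auto simp: k1_def)
    have sk: "0 < s k" using pos k by blast
    have "D * real k = \<alpha> * c * (real k / 2)" by (simp add: D_def)
    also have "\<dots> \<le> \<alpha> * c * (real k - real k0)" using k \<alpha> c by (intro mult_left_mono) auto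
    also have "\<dots> \<le> s k powr (- \<alpha>)" by (rule inc[OF k(1)])
    finally have le: "D * real k \<le> s k powr (- \<alpha>)" .
    have "s k = (s k powr (- \<alpha>)) powr (- 1 / \<alpha>)" using sk \<alpha> by (simp add: powr_powr)
    also have "\<dots> \<le> (D * real k) powr (- 1 / \<alpha>)"
      using le D k \<alpha> by (intro powr_mono2') auto
    also have "\<dots> = D powr (- 1 / \<alpha>) * real k powr (- 1 / \<alpha>)" using D by (simp add: powr_mult)
    finally show ?thesis .
  qed
  moreover have "0 < D powr (- 1 / \<alpha>)" "k0 \<le> k1" using D by (auto simp: k1_def)
  ultimately show ?thesis using that by blast
qed

section \<open>Lyapunov analysis of gradient descent with momentum and relative error\<close>

locale smooth_near_min =
  fixes f :: "'a::euclidean_space \<Rightarrow> real" and F :: "'a \<Rightarrow> 'a" and xb :: 'a and r L :: real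
  assumes r: "0 < r" and L: "0 < L"
    and descent: "\<And>x y. x \<in> ball xb r \<Longrightarrow> y \<in> ball xb r \<Longrightarrow>
      f y \<le> f x + F x \<bullet> (y - x) + L / 2 * (norm (y - x))\<^sup>2"
    and lipschitz: "\<And>x y. x \<in> ball xb r \<Longrightarrow> y \<in> ball xb r \<Longrightarrow> norm (F x - F y) \<le> L * norm (x - y)"
    and crit: "F xb = 0" and f_ge: "\<And>x. x \<in> ball xb r \<Longrightarrow> f xb \<le> f x"
    and cont_f: "continuous_on (ball xb r) f"

text \<open>The first bound on \<open>\<tau> * L\<close> lets the Lipschitz errors consume at most
  half of the margin \<open>\<nu> * (1 - \<nu>)\<close>; the second keeps
  \<open>\<tau> * norm (g k)\<close> at most \<open>\<rho>\<close>. The bound on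
  \<open>4 * (1 + \<Gamma>) * \<rho>\<close> keeps extrapolated points and the next iterate in the
  ball; the last inequality for \<open>\<xi>\<close> reserves room for the whole trajectory.\<close>

locale momentum_method = smooth_near_min f F xb r L
  for f :: "'a::euclidean_space \<Rightarrow> real" and F :: "'a \<Rightarrow> 'a" and xb :: 'a and r L :: real +
  fixes \<phi> :: "real \<Rightarrow> real" and t0 \<rho> \<nu> \<Gamma> \<tau> \<xi> :: real and \<beta> \<gamma> :: "nat \<Rightarrow> real" and x g :: "nat \<Rightarrow> 'a"
  assumes \<nu>: "0 < \<nu>" "\<nu> < 1" and \<Gamma>: "0 \<le> \<Gamma>" and \<rho>: "0 < \<rho>" "4 * (1 + \<Gamma>) * \<rho> < r"
    and \<tau>: "0 < \<tau>" "\<tau> \<le> 1" "\<tau> * L * (\<Gamma> + 1) \<le> \<nu> * (1 - \<nu>) / 2" "\<tau> * L * (1 + 2 * \<Gamma>) \<le> 1 - \<nu>"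
    and \<beta>: "\<And>k. 1 \<le> k \<Longrightarrow> 0 \<le> \<beta> k \<and> \<beta> k \<le> 1 - \<nu>"
    and \<gamma>: "\<And>k. 1 \<le> k \<Longrightarrow> 0 \<le> \<gamma> k \<and> \<gamma> k \<le> \<Gamma>"
    and x01: "x 1 = x 0"
    and iter: "\<And>k. 1 \<le> k \<Longrightarrow> x (Suc k) = momentum \<beta> x k - \<tau> *\<^sub>R g k"
    and err: "\<And>k. 1 \<le> k \<Longrightarrow> momentum \<gamma> x k \<in> ball xb r \<Longrightarrow>
      norm (g k - F (momentum \<gamma> x k)) \<le> \<nu> * norm (g k)"
    and noncrit: "\<And>k. 1 \<le> k \<Longrightarrow> momentum \<gamma> x k \<in> ball xb r \<Longrightarrow> F (momentum \<gamma> x k) \<noteq> 0"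
    and \<phi>0: "\<phi> 0 = 0" and \<phi>_mono: "\<And>s t. 0 \<le> s \<Longrightarrow> s \<le> t \<Longrightarrow> t < t0 \<Longrightarrow> \<phi> s \<le> \<phi> t"
    and \<phi>_des: "\<And>s t u y. 0 \<le> s \<Longrightarrow> s \<le> t \<Longrightarrow> t \<le> u \<Longrightarrow> u < t0 \<Longrightarrow> y \<in> cball xb \<rho> \<Longrightarrow> f y = f xb + u \<Longrightarrow>
      t - s \<le> (\<phi> t - \<phi> s) * norm (F y)"
    and start: "norm (x 0 - xb) \<le> \<xi>" "L / 2 * \<xi>\<^sup>2 < t0"
      "\<xi> + 48 / (\<nu> * (1 - \<nu>)) * (\<phi> (L / 2 * \<xi>\<^sup>2 / 2) + sqrt (L / 2 * \<xi>\<^sup>2)) \<le> \<rho>"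
begin

text \<open>The margin for the largest admissible momentum: both
  \<open>(1 - \<nu>) - (1 - \<nu>)\<^sup>2\<close> and
  \<open>(1 - \<nu>\<^sup>2) - (1 - \<nu>)\<close> are equal to it.\<close>

definition \<sigma> where "\<sigma> = \<nu> * (1 - \<nu>)"

lemma \<sigma>: "0 < \<sigma>" "\<sigma> \<le> 1"
proof -
  show "0 < \<sigma>" using \<nu> by (simp add: \<sigma>_def)
  show "\<sigma> \<le> 1" using \<nu> mult_mono[of \<nu> 1 "1 - \<nu>" 1] by (simp add: \<sigma>_def)
qed

definition d where "d k = x k - x (k - 1)"

definition s where "s k = f (x k) - f xb + (1 - \<nu>) / (2 * \<tau>) * (norm (d k))\<^sup>2"

definition \<psi> where "\<psi> t = \<phi> (t / 2) + sqrt t"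

lemma \<psi>_mono: "0 \<le> t \<Longrightarrow> t \<le> u \<Longrightarrow> u < t0 \<Longrightarrow> \<psi> t \<le> \<psi> u"
  unfolding \<psi>_def by (intro add_mono \<phi>_mono) auto

lemma \<psi>_nonneg: "0 \<le> t \<Longrightarrow> t < t0 \<Longrightarrow> 0 \<le> \<psi> t"
  using \<psi>_mono[of 0 t] \<phi>0 by (simp add: \<psi>_def)

lemma s_nonneg: "x k \<in> ball xb r \<Longrightarrow> f (x k) - f xb \<le> s k \<and> 0 \<le> s k"
  using f_ge[of "x k"] \<nu> \<tau>(1) by (simp add: s_def)

lemma cball_ball: "y \<in> cball xb \<rho> \<Longrightarrow> y \<in> ball xb r"
proof -
  have "\<rho> \<le> 4 * (1 + \<Gamma>) * \<rho>" using \<rho> \<Gamma> by (simp add: algebra_simps)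
  then show "y \<in> cball xb \<rho> \<Longrightarrow> y \<in> ball xb r" using \<rho>(2) by auto
qed

context
  fixes k assumes k: "1 \<le> k" and x_prev: "x (k - 1) \<in> cball xb \<rho>" and x_cur: "x k \<in> cball xb \<rho>"
begin

lemma d_le: "norm (d k) \<le> 2 * \<rho>"
  using x_prev x_cur norm_triangle_ineq4[of "x k - xb" "x (k - 1) - xb"]
  by (simp add: d_def dist_norm norm_minus_commute)

lemma extrapolated: "momentum \<gamma> x k = x k + \<gamma> k *\<^sub>R d k"
  by (simp add: momentum_def d_def)

lemma extrapolated_ball: "norm (momentum \<gamma> x k - xb) \<le> (1 + 2 * \<Gamma>) * \<rho>" "momentum \<gamma> x k \<in> ball xb r"
proof -
  have "norm (momentum \<gamma> x k - xb) \<le> norm (x k - xb) + norm (\<gamma> k *\<^sub>R d k)"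
    unfolding extrapolated using norm_triangle_ineq[of "x k - xb" "\<gamma> k *\<^sub>R d k"] by (simp add: algebra_simps)
  also have "norm (\<gamma> k *\<^sub>R d k) \<le> \<Gamma> * (2 * \<rho>)"
    using \<gamma>[OF k] d_le by (simp add: mult_mono)
  also have "norm (x k - xb) \<le> \<rho>" using x_cur by (simp add: dist_norm norm_minus_commute)
  finally show 1: "norm (momentum \<gamma> x k - xb) \<le> (1 + 2 * \<Gamma>) * \<rho>" by (simp add: algebra_simps)
  have "(1 + 2 * \<Gamma>) * \<rho> \<le> 4 * (1 + \<Gamma>) * \<rho>" using \<Gamma> \<rho>(1) by (intro mult_right_mono) auto
  with 1 \<rho>(2) show "momentum \<gamma> x k \<in> ball xb r" by (simp add: dist_norm norm_minus_commute)
qed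

lemma d_next: "d (Suc k) = \<beta> k *\<^sub>R d k - \<tau> *\<^sub>R g k"
  using iter[OF k] by (simp add: d_def momentum_def)

lemma next_ball: "x (Suc k) \<in> ball xb r"
proof -
  define Fe where "Fe = F (momentum \<gamma> x k)"
  have "norm Fe \<le> L * norm (momentum \<gamma> x k - xb)"
    using lipschitz[OF extrapolated_ball(2), of xb] r crit by (simp add: Fe_def)
  also have "\<dots> \<le> L * ((1 + 2 * \<Gamma>) * \<rho>)" using extrapolated_ball(1) L by (intro mult_left_mono) auto
  finally have Fe: "norm Fe \<le> L * ((1 + 2 * \<Gamma>) * \<rho>)" .
  have "norm (g k) \<le> norm Fe + \<nu> * norm (g k)"
    using err[OF k extrapolated_ball(2)] norm_triangle_sub[of "g k" Fe] by (simp add: Fe_def)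
  then have "(1 - \<nu>) * norm (g k) \<le> L * ((1 + 2 * \<Gamma>) * \<rho>)" using Fe by (simp add: algebra_simps)
  then have "\<tau> * ((1 - \<nu>) * norm (g k)) \<le> \<tau> * (L * ((1 + 2 * \<Gamma>) * \<rho>))" using \<tau>(1) by (intro mult_left_mono) auto
  also have "\<dots> = (\<tau> * L * (1 + 2 * \<Gamma>)) * \<rho>" by simp
  also have "\<dots> \<le> (1 - \<nu>) * \<rho>" using \<tau>(4) \<rho>(1) by (intro mult_right_mono) auto
  finally have "(1 - \<nu>) * (\<tau> * norm (g k)) \<le> (1 - \<nu>) * \<rho>" by (simp add: mult_ac)
  then have g: "\<tau> * norm (g k) \<le> \<rho>" using \<nu> by (simp add: mult_le_cancel_left_pos)
  have "norm (d (Suc k)) \<le> norm (\<beta> k *\<^sub>R d k) + norm (\<tau> *\<^sub>R g k)"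
    unfolding d_next by (rule norm_triangle_ineq4)
  also have "norm (\<beta> k *\<^sub>R d k) \<le> 1 * (2 * \<rho>)"
    using \<beta>[OF k] \<nu> d_le by (simp only: norm_scaleR) (intro mult_mono, auto)
  also have "norm (\<tau> *\<^sub>R g k) \<le> \<rho>" using g \<tau>(1) by simp
  finally have "norm (d (Suc k)) \<le> 3 * \<rho>" by simp
  moreover have "norm (x (Suc k) - xb) \<le> norm (x k - xb) + norm (d (Suc k))"
    using norm_triangle_ineq[of "x k - xb" "d (Suc k)"] by (simp add: d_def)
  moreover have "norm (x k - xb) \<le> \<rho>" using x_cur by (simp add: dist_norm norm_minus_commute)
  ultimately have "norm (x (Suc k) - xb) \<le> 4 * \<rho>" by linarith
  also have "4 * \<rho> \<le> 4 * (1 + \<Gamma>) * \<rho>" using \<rho>(1) \<Gamma> by simp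
  also have "\<dots> < r" by (rule \<rho>(2))
  finally show ?thesis by (simp add: dist_norm norm_minus_commute)
qed

lemma gradient_gap: "norm (F (x k) - F (momentum \<gamma> x k)) \<le> L * \<Gamma> * norm (d k)"
proof -
  have "norm (F (x k) - F (momentum \<gamma> x k)) \<le> L * norm (x k - momentum \<gamma> x k)"
    using lipschitz[OF cball_ball[OF x_cur] extrapolated_ball(2)] .
  also have "norm (x k - momentum \<gamma> x k) = \<gamma> k * norm (d k)" using \<gamma>[OF k] by (simp add: extrapolated)
  also have "L * (\<gamma> k * norm (d k)) \<le> L * (\<Gamma> * norm (d k))"
    using \<gamma>[OF k] L by (intro mult_left_mono mult_right_mono) auto
  finally show ?thesis by (simp add: mult.assoc)
qed

text \<open>The inner product \<open>(\<beta> d - d') \<bullet> d'\<close> is expanded by polarisation, and the remaining term in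
  \<open>G = norm (\<beta> d - d')\<close> is maximised over \<open>G\<close>; a cruder bound would not reach \<open>1 - \<nu>\<close>.\<close>

lemma lyapunov_decrease:
  "s (Suc k) \<le> s k - \<sigma> / (4 * \<tau>) * ((norm (d k))\<^sup>2 + (norm (d (Suc k)))\<^sup>2)"
proof -
  define a where "a = norm (d k)"
  define b' where "b' = norm (d (Suc k))"
  define G where "G = norm (\<beta> k *\<^sub>R d k - d (Suc k))"
  define Fe where "Fe = F (momentum \<gamma> x k)"
  have ab: "0 \<le> a" "0 \<le> b'" "0 \<le> G" by (auto simp: a_def b'_def G_def)
  have tg: "\<tau> *\<^sub>R g k = \<beta> k *\<^sub>R d k - d (Suc k)" by (simp add: d_next)
  have G: "G = \<tau> * norm (g k)" using \<tau>(1) by (simp add: G_def flip: tg)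
  have xd: "x (Suc k) - x k = d (Suc k)" by (simp add: d_def)
  have "f (x (Suc k)) \<le> f (x k) + F (x k) \<bullet> d (Suc k) + L / 2 * b'\<^sup>2"
    using descent[OF cball_ball[OF x_cur] next_ball] by (simp add: xd b'_def)
  moreover have "F (x k) \<bullet> d (Suc k) = (F (x k) - Fe) \<bullet> d (Suc k) + (Fe - g k) \<bullet> d (Suc k) + g k \<bullet> d (Suc k)"
    by (simp add: inner_diff_left)
  moreover have "(F (x k) - Fe) \<bullet> d (Suc k) \<le> L * \<Gamma> * a * b'"
    using norm_cauchy_schwarz[of "F (x k) - Fe" "d (Suc k)"] mult_right_mono[OF gradient_gap, of b'] ab
    by (simp add: Fe_def a_def b'_def)
  moreover have "(Fe - g k) \<bullet> d (Suc k) \<le> \<nu> * norm (g k) * b'"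
    using norm_cauchy_schwarz[of "Fe - g k" "d (Suc k)"]
      mult_right_mono[OF err[OF k extrapolated_ball(2)], of b'] ab
    by (simp add: Fe_def b'_def norm_minus_commute)
  ultimately have "f (x (Suc k)) - f (x k) \<le> L * \<Gamma> * a * b' + \<nu> * norm (g k) * b' + g k \<bullet> d (Suc k) + L / 2 * b'\<^sup>2"
    by linarith
  then have "2 * \<tau> * (f (x (Suc k)) - f (x k)) \<le>
      2 * \<tau> * (L * \<Gamma> * a * b' + \<nu> * norm (g k) * b' + g k \<bullet> d (Suc k) + L / 2 * b'\<^sup>2)"
    using \<tau>(1) by (intro mult_left_mono) auto
  also have "\<dots> = \<tau> * L * \<Gamma> * (2 * a * b') + 2 * \<nu> * G * b' + 2 * (\<tau> * (g k \<bullet> d (Suc k))) + \<tau> * L * b'\<^sup>2"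
    by (simp add: G algebra_simps)
  also have "2 * (\<tau> * (g k \<bullet> d (Suc k))) = (\<beta> k)\<^sup>2 * a\<^sup>2 - G\<^sup>2 - b'\<^sup>2"
  proof -
    have polar: "2 * ((w - v) \<bullet> v) = (norm w)\<^sup>2 - (norm (w - v))\<^sup>2 - (norm v)\<^sup>2" for w v :: 'a
      by (simp add: power2_norm_eq_inner inner_diff_left inner_diff_right inner_commute)
    have "\<tau> * (g k \<bullet> d (Suc k)) = (\<beta> k *\<^sub>R d k - d (Suc k)) \<bullet> d (Suc k)" by (simp flip: tg)
    moreover have "(norm (\<beta> k *\<^sub>R d k))\<^sup>2 = (\<beta> k)\<^sup>2 * a\<^sup>2" by (simp add: a_def power_mult_distrib)
    ultimately show ?thesis using polar[of "\<beta> k *\<^sub>R d k" "d (Suc k)"] by (simp add: G_def b'_def)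
  qed
  also have "\<tau> * L * \<Gamma> * (2 * a * b') \<le> \<tau> * L * \<Gamma> * (a\<^sup>2 + b'\<^sup>2)"
    using \<tau>(1) L \<Gamma> sum_squares_bound[of a b'] by (intro mult_left_mono) auto
  finally have 1: "2 * \<tau> * (f (x (Suc k)) - f (x k)) \<le> \<tau> * L * \<Gamma> * (a\<^sup>2 + b'\<^sup>2) + 2 * \<nu> * G * b'
      + ((\<beta> k)\<^sup>2 * a\<^sup>2 - G\<^sup>2 - b'\<^sup>2) + \<tau> * L * b'\<^sup>2" by simp
  have "2 * \<nu> * G * b' \<le> G\<^sup>2 + \<nu>\<^sup>2 * b'\<^sup>2"
    using sum_squares_bound[of G "\<nu> * b'"] by (simp add: power_mult_distrib mult_ac)
  moreover have "(\<beta> k)\<^sup>2 * a\<^sup>2 \<le> (1 - \<nu>)\<^sup>2 * a\<^sup>2"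
    using \<beta>[OF k] by (intro mult_right_mono power_mono) auto
  moreover have "\<tau> * L * b'\<^sup>2 \<le> \<tau> * L * (a\<^sup>2 + b'\<^sup>2)" using \<tau>(1) L by (intro mult_left_mono) auto
  moreover have "(\<tau> * L * (\<Gamma> + 1)) * (a\<^sup>2 + b'\<^sup>2) \<le> \<sigma> / 2 * (a\<^sup>2 + b'\<^sup>2)"
    using \<tau>(3) by (intro mult_right_mono) (auto simp: \<sigma>_def)
  ultimately have "2 * \<tau> * (f (x (Suc k)) - f (x k)) \<le> \<sigma> / 2 * (a\<^sup>2 + b'\<^sup>2) + (1 - \<nu>)\<^sup>2 * a\<^sup>2 - (1 - \<nu>\<^sup>2) * b'\<^sup>2"
    using 1 by (simp add: algebra_simps)
  also have "(1 - \<nu>)\<^sup>2 = (1 - \<nu>) - \<sigma>" by (simp add: \<sigma>_def power2_eq_square algebra_simps)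
  also have "1 - \<nu>\<^sup>2 = (1 - \<nu>) + \<sigma>" by (simp add: \<sigma>_def power2_eq_square algebra_simps)
  finally have "2 * \<tau> * (f (x (Suc k)) - f (x k)) + (1 - \<nu>) * b'\<^sup>2 - (1 - \<nu>) * a\<^sup>2 \<le> - (\<sigma> / 2) * (a\<^sup>2 + b'\<^sup>2)"
    by (simp add: algebra_simps)
  then have "(2 * \<tau> * (f (x (Suc k)) - f (x k)) + (1 - \<nu>) * b'\<^sup>2 - (1 - \<nu>) * a\<^sup>2) / (2 * \<tau>)
      \<le> (- (\<sigma> / 2) * (a\<^sup>2 + b'\<^sup>2)) / (2 * \<tau>)"
    using \<tau>(1) by (intro divide_right_mono) auto
  moreover have "(2 * \<tau> * (f (x (Suc k)) - f (x k)) + (1 - \<nu>) * b'\<^sup>2 - (1 - \<nu>) * a\<^sup>2) / (2 * \<tau>) = s (Suc k) - s k"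
    using \<tau>(1) by (simp add: s_def a_def b'_def field_simps)
  moreover have "(- (\<sigma> / 2) * (a\<^sup>2 + b'\<^sup>2)) / (2 * \<tau>) = - (\<sigma> / (4 * \<tau>) * (a\<^sup>2 + b'\<^sup>2))" by simp
  ultimately show ?thesis by (simp add: a_def b'_def)
qed

text \<open>Two vanishing displacements force \<open>g k = 0\<close>, and the relative error bound
  would then make the extrapolated point critical.\<close>

lemma moving: "0 < norm (d k) + norm (d (Suc k))"
proof (rule ccontr)
  assume "\<not> ?thesis"
  then have "d k = 0" "d (Suc k) = 0" by (smt (verit) norm_ge_zero norm_eq_zero)+
  then have "g k = 0" using d_next \<tau>(1) by simp
  with err[OF k extrapolated_ball(2)] noncrit[OF k extrapolated_ball(2)] show False by simp
qed

text \<open>The displacements determine \<open>\<tau> *\<^sub>R g k\<close>, the relative error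
  bounds the extrapolated gradient by \<open>2 * norm (g k)\<close>, and since
  \<open>\<tau> * L * \<Gamma> \<le> 1\<close> returning to \<open>x k\<close> costs one more
  \<open>norm (d k)\<close>.\<close>

lemma gradient_bound: "\<tau> * norm (F (x k)) \<le> 3 * (norm (d k) + norm (d (Suc k)))"
proof -
  define Fe where "Fe = F (momentum \<gamma> x k)"
  have "norm (\<tau> *\<^sub>R g k) = norm (\<beta> k *\<^sub>R d k - d (Suc k))" by (simp add: d_next)
  also have "\<dots> \<le> norm (\<beta> k *\<^sub>R d k) + norm (d (Suc k))" by (rule norm_triangle_ineq4)
  also have "norm (\<beta> k *\<^sub>R d k) \<le> 1 * norm (d k)"
    using \<beta>[OF k] \<nu> by (simp only: norm_scaleR) (intro mult_right_mono, auto)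
  finally have g: "\<tau> * norm (g k) \<le> norm (d k) + norm (d (Suc k))" using \<tau>(1) by simp
  have "norm Fe \<le> norm (g k) + norm (g k - Fe)" using norm_triangle_sub[of Fe "g k"] by (simp add: norm_minus_commute)
  also have "norm (g k - Fe) \<le> 1 * norm (g k)"
    using err[OF k extrapolated_ball(2)] \<nu> mult_right_mono[of \<nu> 1 "norm (g k)"] by (simp add: Fe_def)
  finally have Fe: "norm Fe \<le> 2 * norm (g k)" by simp
  have "norm (F (x k)) \<le> norm Fe + norm (F (x k) - Fe)" by (rule norm_triangle_sub)
  also have "\<dots> \<le> 2 * norm (g k) + L * \<Gamma> * norm (d k)" using Fe gradient_gap by (simp add: Fe_def)
  finally have "\<tau> * norm (F (x k)) \<le> \<tau> * (2 * norm (g k) + L * \<Gamma> * norm (d k))"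
    using \<tau>(1) by (intro mult_left_mono) auto
  also have "\<dots> = 2 * (\<tau> * norm (g k)) + (\<tau> * L * \<Gamma>) * norm (d k)" by (simp add: algebra_simps)
  also have "\<dots> \<le> 2 * (norm (d k) + norm (d (Suc k))) + 1 * norm (d k)"
  proof (intro add_mono mult_left_mono mult_right_mono g)
    have "\<tau> * L * \<Gamma> \<le> \<tau> * L * (\<Gamma> + 1)" using \<tau>(1) L by simp
    then show "\<tau> * L * \<Gamma> \<le> 1" using \<tau>(3) \<sigma> by (simp add: \<sigma>_def)
  qed auto
  also have "\<dots> \<le> 3 * (norm (d k) + norm (d (Suc k)))" by simp
  finally show ?thesis .
qed

lemma s_decreasing: "s (Suc k) < s k" "0 \<le> s (Suc k)"
proof -
  have "0 < (norm (d k))\<^sup>2 + (norm (d (Suc k)))\<^sup>2"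
    using moving by (metis add.right_neutral norm_eq_zero norm_zero order_less_irrefl sum_power2_gt_zero_iff)
  then have "0 < \<sigma> / (4 * \<tau>) * ((norm (d k))\<^sup>2 + (norm (d (Suc k)))\<^sup>2)" using \<sigma> \<tau>(1) by simp
  with lyapunov_decrease show "s (Suc k) < s k" by linarith
  show "0 \<le> s (Suc k)" using s_nonneg[OF next_ball] by blast
qed

lemma square_decrease: "\<sigma> / (8 * \<tau>) * (norm (d k) + norm (d (Suc k)))\<^sup>2 \<le> s k - s (Suc k)"
proof -
  have "(norm (d k) + norm (d (Suc k)))\<^sup>2 \<le> 2 * ((norm (d k))\<^sup>2 + (norm (d (Suc k)))\<^sup>2)"
    using sum_squares_bound[of "norm (d k)" "norm (d (Suc k))"] by (simp add: power2_sum)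
  then have "\<sigma> / (8 * \<tau>) * (norm (d k) + norm (d (Suc k)))\<^sup>2
      \<le> \<sigma> / (8 * \<tau>) * (2 * ((norm (d k))\<^sup>2 + (norm (d (Suc k)))\<^sup>2))"
    using \<sigma> \<tau>(1) by (intro mult_left_mono) auto
  also have "\<sigma> / (8 * \<tau>) * (2 * u) = \<sigma> / (4 * \<tau>) * u" for u using \<tau>(1) by (simp add: field_simps)
  finally show ?thesis using lyapunov_decrease by linarith
qed

text \<open>Either the function gap makes up at least half of \<open>s k\<close>, and \<open>\<phi>\<close> applies at level \<open>s k / 2\<close>,
  or the momentum term does, and then \<open>s k\<close> is bounded by a multiple of \<open>(norm (d k))\<^sup>2\<close>, so that the
  square root is a desingularizing function.\<close>

lemma finite_length_step:
  assumes "s k < t0"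
  shows "norm (d k) + norm (d (Suc k)) \<le> 48 / \<sigma> * (\<psi> (s k) - \<psi> (s (Suc k)))"
proof -
  define S where "S = norm (d k) + norm (d (Suc k))"
  have S: "0 < S" using moving by (simp add: S_def)
  have sq: "\<sigma> / (8 * \<tau>) * S\<^sup>2 \<le> s k - s (Suc k)" using square_decrease by (simp add: S_def)
  note s' = s_decreasing
  have \<phi>_inc: "\<phi> (s (Suc k) / 2) \<le> \<phi> (s k / 2)" using s' assms by (intro \<phi>_mono) auto
  have sqrt_inc: "sqrt (s (Suc k)) \<le> sqrt (s k)" using s' by simp
  \<comment> \<open>48 is 8 times 6: multiplied by \<open>\<tau>\<close>, the decrease is
    \<open>\<sigma> / 8\<close> times the square of \<open>S\<close>, while halving
    \<open>s k\<close> and the 3 of \<open>gradient_bound\<close> give the 6. The momentum case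
    would allow 16.\<close>
  have "\<sigma> / 48 * S \<le> \<psi> (s k) - \<psi> (s (Suc k))"
  proof (cases "s k / 2 \<le> f (x k) - f xb")
    case True
    define D where "D = \<phi> (s k / 2) - \<phi> (s (Suc k) / 2)"
    have D0: "0 \<le> D" using \<phi>_inc by (simp add: D_def)
    have "s k / 2 - s (Suc k) / 2 \<le> D * norm (F (x k))"
      unfolding D_def
    proof (rule \<phi>_des[where u = "f (x k) - f xb"])
      show "f (x k) - f xb < t0" using s_nonneg[OF cball_ball[OF x_cur]] assms by linarith
    qed (use s' True x_cur in auto)
    then have "\<tau> * (s k / 2 - s (Suc k) / 2) \<le> \<tau> * (D * norm (F (x k)))" using \<tau>(1) by (intro mult_left_mono) auto
    also have "\<dots> = D * (\<tau> * norm (F (x k)))" by simp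
    also have "\<dots> \<le> D * (3 * S)" using gradient_bound D0 by (intro mult_left_mono) (auto simp: S_def)
    finally have "\<tau> * (s k - s (Suc k)) \<le> 6 * D * S" by (simp add: field_simps)
    moreover have "\<tau> * (\<sigma> / (8 * \<tau>) * S\<^sup>2) \<le> \<tau> * (s k - s (Suc k))" using sq \<tau>(1) by (intro mult_left_mono) auto
    moreover have "\<tau> * (\<sigma> / (8 * \<tau>) * S\<^sup>2) = \<sigma> / 8 * S * S" using \<tau>(1) by (simp add: power2_eq_square)
    ultimately have "(\<sigma> / 8 * S) * S \<le> (6 * D) * S" by simp
    then have "\<sigma> / 8 * S \<le> 6 * D" using S by (rule mult_right_le_imp_le)
    then have "\<sigma> / 48 * S \<le> D" by simp
    then show ?thesis using sqrt_inc unfolding \<psi>_def D_def by linarith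
  next
    case False
    define a where "a = norm (d k)"
    have a: "0 \<le> a" "a \<le> S" by (auto simp: a_def S_def)
    have "s k < (1 - \<nu>) / \<tau> * a\<^sup>2" using False by (simp add: s_def a_def field_simps)
    also have "\<dots> \<le> 1 / \<tau> * a\<^sup>2" using \<nu> \<tau>(1) by (intro mult_right_mono divide_right_mono) auto
    also have "\<dots> \<le> 1 / \<tau> * S\<^sup>2" using a \<tau>(1) by (intro mult_left_mono power_mono) auto
    finally have "s k \<le> S\<^sup>2 / \<tau>" by simp
    then have "sqrt (s k) \<le> sqrt (S\<^sup>2 / \<tau>)" by simp
    also have "\<dots> = S / sqrt \<tau>" using S by (simp add: real_sqrt_divide)
    finally have rk: "sqrt (s k) \<le> S / sqrt \<tau>" .
    define R where "R = sqrt (s k) - sqrt (s (Suc k))"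
    have R: "0 \<le> R" using sqrt_inc by (simp add: R_def)
    have "s k - s (Suc k) = R * (sqrt (s k) + sqrt (s (Suc k)))"
      using s' by (simp add: R_def square_diff_square_factored[symmetric] algebra_simps)
    also have "\<dots> \<le> R * (2 * (S / sqrt \<tau>))"
    proof (rule mult_left_mono[OF _ R])
      show "sqrt (s k) + sqrt (s (Suc k)) \<le> 2 * (S / sqrt \<tau>)" using rk sqrt_inc by linarith
    qed
    finally have "\<sigma> / (8 * \<tau>) * S\<^sup>2 \<le> R * (2 * (S / sqrt \<tau>))" using sq by simp
    then have "\<tau> * (\<sigma> / (8 * \<tau>) * S\<^sup>2) \<le> \<tau> * (R * (2 * (S / sqrt \<tau>)))" using \<tau>(1) by (intro mult_left_mono) auto
    moreover have "\<tau> * (\<sigma> / (8 * \<tau>) * S\<^sup>2) = (\<sigma> / 8 * S) * S" using \<tau>(1) by (simp add: power2_eq_square)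
    moreover have "\<tau> * (R * (2 * (S / sqrt \<tau>))) = (2 * R * (\<tau> / sqrt \<tau>)) * S" by simp
    moreover have "\<tau> / sqrt \<tau> = sqrt \<tau>" using \<tau>(1) by (simp add: real_div_sqrt)
    ultimately have "(\<sigma> / 8 * S) * S \<le> (2 * R * sqrt \<tau>) * S" by simp
    then have "\<sigma> / 8 * S \<le> 2 * R * sqrt \<tau>" using S by (rule mult_right_le_imp_le)
    also have "\<dots> \<le> 2 * R * 1" using R \<tau>(2) by (intro mult_left_mono) auto
    finally have "\<sigma> / 48 * S \<le> R" using R by simp
    then show ?thesis using \<phi>_inc unfolding \<psi>_def R_def by linarith
  qed
  then show ?thesis using \<sigma>(1) by (simp add: S_def field_simps)
qed

end

end

section \<open>Finite length, convergence and the limit\<close>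

context momentum_method
begin

lemma \<xi>: "0 \<le> \<xi>"
  using start(1) norm_ge_zero[of "x 0 - xb"] by linarith

lemma x0_in: "x 0 \<in> cball xb \<rho>"
proof -
  have "0 \<le> L / 2 * \<xi>\<^sup>2" using L by simp
  then have "0 \<le> 48 / \<sigma> * \<psi> (L / 2 * \<xi>\<^sup>2)"
    using \<sigma>(1) \<psi>_nonneg[OF _ start(2)] by simp
  then have "\<xi> \<le> \<rho>" using start(3) by (simp add: \<psi>_def \<sigma>_def)
  with start(1) show ?thesis by (simp add: dist_norm norm_minus_commute)
qed

text \<open>As \<open>x 1 = x 0\<close>, the momentum part is absent from \<open>s 1\<close>, and
  the descent inequality from the critical point \<open>xb\<close> bounds the rest.\<close>

lemma s1: "0 \<le> s 1" "s 1 \<le> L / 2 * \<xi>\<^sup>2" "s 1 < t0"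
proof -
  have x1: "x 1 \<in> ball xb r" using x0_in x01 cball_ball by simp
  then show "0 \<le> s 1" using s_nonneg by blast
  have "s 1 = f (x 1) - f xb" using x01 by (simp add: s_def d_def)
  also have "\<dots> \<le> L / 2 * (norm (x 1 - xb))\<^sup>2" using descent[of xb "x 1"] x1 r crit by simp
  also have "\<dots> \<le> L / 2 * \<xi>\<^sup>2" using L start(1) x01 by (intro mult_left_mono power_mono) auto
  finally show "s 1 \<le> L / 2 * \<xi>\<^sup>2" .
  then show "s 1 < t0" using start(2) by linarith
qed

text \<open>The trapping argument: while the iterates stay in the ball, the length travelled is at
  most a multiple of \<open>\<psi> (s 1)\<close>, and this budget is too small to leave the
  ball.\<close>

lemma iterates:
  assumes "1 \<le> k"
  shows "(\<forall>j\<le>k. x j \<in> cball xb \<rho>) \<and> s k \<le> s 1 \<and> norm (x k - x 1) \<le> 48 / \<sigma> * (\<psi> (s 1) - \<psi> (s k))"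
  using assms
proof (induction k rule: dec_induct)
  case base
  have "x j \<in> cball xb \<rho>" if "j \<le> 1" for j
    using that x0_in x01 by (cases "j = 0") (auto simp: le_Suc_eq)
  then show ?case by simp
next
  case (step k)
  have k: "1 \<le> k" "x (k - 1) \<in> cball xb \<rho>" "x k \<in> cball xb \<rho>" "s k < t0"
    using step s1(3) by auto
  have len: "norm (d k) + norm (d (Suc k)) \<le> 48 / \<sigma> * (\<psi> (s k) - \<psi> (s (Suc k)))"
    by (rule finite_length_step[OF k])
  have "norm (x (Suc k) - x 1) \<le> norm (x k - x 1) + norm (d (Suc k))"
    using norm_triangle_ineq[of "x k - x 1" "d (Suc k)"] by (simp add: d_def)
  also have "\<dots> \<le> 48 / \<sigma> * (\<psi> (s 1) - \<psi> (s k)) + 48 / \<sigma> * (\<psi> (s k) - \<psi> (s (Suc k)))"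
    using step(3) len norm_ge_zero[of "d k"] by linarith
  also have "\<dots> = 48 / \<sigma> * (\<psi> (s 1) - \<psi> (s (Suc k)))" by (simp add: algebra_simps)
  finally have dist: "norm (x (Suc k) - x 1) \<le> 48 / \<sigma> * (\<psi> (s 1) - \<psi> (s (Suc k)))" .
  have s': "s (Suc k) < s k" "0 \<le> s (Suc k)" using s_decreasing[OF k(1-3)] by auto
  have "48 / \<sigma> * (\<psi> (s 1) - \<psi> (s (Suc k))) \<le> 48 / \<sigma> * \<psi> (L / 2 * \<xi>\<^sup>2)"
  proof (rule mult_left_mono)
    have "\<psi> (s 1) \<le> \<psi> (L / 2 * \<xi>\<^sup>2)" using s1 start(2) by (intro \<psi>_mono) auto
    moreover have "0 \<le> \<psi> (s (Suc k))" using s' k(4) by (intro \<psi>_nonneg) auto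
    ultimately show "\<psi> (s 1) - \<psi> (s (Suc k)) \<le> \<psi> (L / 2 * \<xi>\<^sup>2)" by linarith
  qed (use \<sigma> in simp)
  moreover have "norm (x (Suc k) - xb) \<le> norm (x (Suc k) - x 1) + norm (x 1 - xb)"
    using norm_triangle_ineq[of "x (Suc k) - x 1" "x 1 - xb"] by simp
  ultimately have "norm (x (Suc k) - xb) \<le> \<rho>"
    using dist start(1,3) x01 by (simp add: \<psi>_def \<sigma>_def)
  then have "x (Suc k) \<in> cball xb \<rho>" by (simp add: dist_norm norm_minus_commute)
  then have "\<forall>j\<le>Suc k. x j \<in> cball xb \<rho>" using step(3) by (auto simp: le_Suc_eq)
  with dist s' step(3) show ?case by auto
qed

lemma in_cball: "x k \<in> cball xb \<rho>"
  using iterates[of "max 1 k"] by auto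

lemma s_lt: "1 \<le> k \<Longrightarrow> s k < t0"
  using iterates[of k] s1(3) by auto

lemma s_antimono:
  assumes "1 \<le> m" "m \<le> n"
  shows "s n \<le> s m"
  using assms(2)
proof (induction n rule: dec_induct)
  case (step n)
  then show ?case using s_decreasing(1)[OF _ in_cball in_cball, of n] assms(1) by simp
qed simp

lemma s_pos: "1 \<le> k \<Longrightarrow> 0 < s k"
  using s_decreasing[of k] in_cball by fastforce

lemma telescope:
  assumes step: "\<And>k. m \<le> k \<Longrightarrow> norm (d (Suc k)) \<le> w k - w (Suc k)" and "m \<le> n"
  shows "norm (x n - x m) \<le> w m - w n"
  using assms(2)
proof (induction n rule: dec_induct)
  case (step n)
  have "norm (x (Suc n) - x m) \<le> norm (x n - x m) + norm (d (Suc n))"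
    using norm_triangle_ineq[of "x n - x m" "d (Suc n)"] by (simp add: d_def)
  with step(3) assms(1)[OF step(1)] show ?case by linarith
qed simp

lemma Cauchy_x: "Cauchy x"
proof -
  \<comment> \<open>Displacements are bounded by decrements of \<open>w\<close>, which is decreasing
    and bounded below, hence Cauchy.\<close>
  define w where "w k = 48 / \<sigma> * \<psi> (s k)" for k
  have w: "norm (x n - x m) \<le> w m - w n" if "1 \<le> m" "m \<le> n" for m n
  proof (rule telescope[OF _ that(2)])
    fix k assume "m \<le> k"
    then have k: "1 \<le> k" using that by simp
    show "norm (d (Suc k)) \<le> w k - w (Suc k)"
      using finite_length_step[OF k in_cball in_cball s_lt[OF k]] norm_ge_zero[of "d k"]
      unfolding w_def right_diff_distrib by linarith
  qed
  have dec: "w (Suc n) \<le> w (Suc m)" if "m \<le> n" for m n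
    using w[of "Suc m" "Suc n"] that norm_ge_zero[of "x (Suc n) - x (Suc m)"] by linarith
  have nonneg: "\<forall>n. 0 \<le> w (Suc n)"
  proof
    fix n
    show "0 \<le> w (Suc n)"
    using s_pos[of "Suc n"] s_lt[of "Suc n"] \<sigma> \<psi>_nonneg[of "s (Suc n)"] by (simp add: w_def)
  qed
  have "decseq (\<lambda>n. w (Suc n))" using dec by (simp add: decseq_def)
  then obtain l where "(\<lambda>n. w (Suc n)) \<longlonglongrightarrow> l"
    using decseq_convergent nonneg by blast
  then have "convergent (\<lambda>n. w (Suc n))" by (auto simp: convergent_def)
  then have "convergent w" by (simp only: convergent_Suc_iff)
  then have Cw: "Cauchy w" by (rule convergent_Cauchy)
  show ?thesis
  proof (rule metric_CauchyI)
    fix e :: real assume "0 < e"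
    then obtain M where M: "\<And>m n. M \<le> m \<Longrightarrow> M \<le> n \<Longrightarrow> dist (w m) (w n) < e"
      using metric_CauchyD[OF Cw] by blast
    have le: "dist (x m) (x n) < e" if "max 1 M \<le> m" "m \<le> n" for m n
    proof -
      have "dist (x m) (x n) \<le> w m - w n"
        using w[of m n] that by (simp add: dist_norm norm_minus_commute)
      also have "\<dots> \<le> dist (w m) (w n)" by (simp add: dist_real_def)
      also have "\<dots> < e" using M that by simp
      finally show ?thesis .
    qed
    show "\<exists>M. \<forall>m\<ge>M. \<forall>n\<ge>M. dist (x m) (x n) < e"
    proof (intro exI[of _ "max 1 M"] allI impI)
      fix m n assume mn: "max 1 M \<le> m" "max 1 M \<le> n"
      show "dist (x m) (x n) < e"
        using le[OF mn(1), of n] le[OF mn(2), of m] by (cases "m \<le> n") (simp_all add: dist_commute)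
    qed
  qed
qed

definition xt where "xt = lim x"

lemma x_tendsto: "x \<longlonglongrightarrow> xt"
  using Cauchy_x by (simp add: xt_def Cauchy_convergent_iff convergent_LIMSEQ_iff)

lemma xt_in: "xt \<in> cball xb \<rho>"
  using closed_sequentially[OF closed_cball _ x_tendsto] in_cball by blast

lemma d_tendsto: "d \<longlonglongrightarrow> 0"
proof -
  have "(\<lambda>k. x (Suc k) - x k) \<longlonglongrightarrow> xt - xt"
    by (intro tendsto_diff LIMSEQ_Suc x_tendsto)
  then have "(\<lambda>k. d (Suc k)) \<longlonglongrightarrow> 0" by (simp add: d_def)
  then show ?thesis by (rule LIMSEQ_imp_Suc)
qed

lemma momentum_tendsto:
  assumes "\<And>k. 1 \<le> k \<Longrightarrow> \<bar>c k\<bar> \<le> C"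
  shows "momentum c x \<longlonglongrightarrow> xt"
proof -
  have "(\<lambda>k. C * norm (d k)) \<longlonglongrightarrow> C * norm (0::'a)" by (intro tendsto_intros d_tendsto)
  then have "(\<lambda>k. C * norm (d k)) \<longlonglongrightarrow> 0" by simp
  moreover have "\<forall>\<^sub>F k in sequentially. norm (c k *\<^sub>R d k) \<le> C * norm (d k)"
    using eventually_ge_at_top[of 1] by eventually_elim (use assms in \<open>auto intro: mult_right_mono\<close>)
  ultimately have "(\<lambda>k. c k *\<^sub>R d k) \<longlonglongrightarrow> 0" by (rule Lim_null_comparison[rotated])
  from tendsto_add[OF x_tendsto this] show ?thesis
    by (simp add: momentum_def[abs_def] d_def)
qed

lemma f_tendsto: "(\<lambda>k. f (x k)) \<longlonglongrightarrow> f xt"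
proof -
  have "isCont f xt"
    using cont_f cball_ball[OF xt_in] by (simp add: continuous_on_eq_continuous_at)
  then show ?thesis using x_tendsto by (rule isCont_tendsto_compose)
qed

lemma F_xt: "F xt = 0"
proof -
  have "(\<lambda>k. L * norm (x k - xt)) \<longlonglongrightarrow> L * norm (xt - xt)" by (intro tendsto_intros x_tendsto)
  then have "(\<lambda>k. L * norm (x k - xt)) \<longlonglongrightarrow> 0" by simp
  then have "(\<lambda>k. F (x k) - F xt) \<longlonglongrightarrow> 0"
    by (rule Lim_null_comparison[rotated])
      (use lipschitz[OF cball_ball[OF in_cball] cball_ball[OF xt_in]] in auto)
  then have lim: "(\<lambda>k. F (x k)) \<longlonglongrightarrow> F xt" by (simp add: LIM_zero_iff)
  have "(\<lambda>k. 3 / \<tau> * (norm (d k) + norm (d (Suc k)))) \<longlonglongrightarrow> 3 / \<tau> * (norm (0::'a) + norm (0::'a))"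
    by (intro tendsto_intros d_tendsto LIMSEQ_Suc)
  then have "(\<lambda>k. 3 / \<tau> * (norm (d k) + norm (d (Suc k)))) \<longlonglongrightarrow> 0" by simp
  moreover have "\<forall>\<^sub>F k in sequentially. norm (F (x k)) \<le> 3 / \<tau> * (norm (d k) + norm (d (Suc k)))"
    using eventually_ge_at_top[of 1]
  proof eventually_elim
    case (elim k)
    then show ?case using gradient_bound[OF elim in_cball in_cball] \<tau>(1) by (simp add: field_simps)
  qed
  ultimately have "(\<lambda>k. F (x k)) \<longlonglongrightarrow> 0" by (rule Lim_null_comparison[rotated])
  with lim show ?thesis by (rule LIMSEQ_unique)
qed

text \<open>The limit is critical with a value less than \<open>t0\<close> above
  \<open>f xb\<close>, and the desingularizing inequality from 0 leaves no other critical value in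
  that range.\<close>

lemma f_xt: "f xt = f xb"
proof -
  define u where "u = f xt - f xb"
  have u: "0 \<le> u" using f_ge[OF cball_ball[OF xt_in]] by (simp add: u_def)
  have "(\<lambda>k. f (x k) - f xb) \<longlonglongrightarrow> u" unfolding u_def by (intro tendsto_intros f_tendsto)
  moreover have "\<forall>\<^sub>F k in sequentially. f (x k) - f xb \<le> s 1"
    using eventually_ge_at_top[of 1]
  proof eventually_elim
    case (elim k)
    then show ?case using s_nonneg[OF cball_ball[OF in_cball], of k] s_antimono[of 1 k] by simp
  qed
  ultimately have "u \<le> s 1" by (rule tendsto_upperbound) simp
  then have "u - 0 \<le> (\<phi> u - \<phi> 0) * norm (F xt)"
    using u s1(3) xt_in by (intro \<phi>_des[where u = u]) (auto simp: u_def)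
  with u show ?thesis by (simp add: F_xt u_def)
qed

lemma s_tendsto: "s \<longlonglongrightarrow> 0"
proof -
  have "s \<longlonglongrightarrow> f xt - f xb + (1 - \<nu>) / (2 * \<tau>) * (norm (0::'a))\<^sup>2"
    unfolding s_def[abs_def] by (intro tendsto_intros f_tendsto d_tendsto)
  then show ?thesis by (simp add: f_xt)
qed

section \<open>Convergence rates from a Lojasiewicz exponent\<close>

context
  fixes c \<eta> q :: real
  assumes c: "0 < c" and \<eta>: "0 < \<eta>" and q: "1 / 2 \<le> q" "q < 1"
    and loj: "\<And>y. y \<in> cball xb \<rho> \<Longrightarrow> 0 < f y - f xb \<Longrightarrow> f y - f xb < \<eta> \<Longrightarrow> c * (f y - f xb) powr q \<le> norm (F y)"
begin

text \<open>The function gap obeys the Lojasiewicz inequality; the momentum term obeys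
  \<open>((norm (d k))\<^sup>2) powr q \<le> norm (d k)\<close> for small displacements because
  \<open>2 * q \<ge> 1\<close>. For this reason exponents below 1/2 are later raised to 1/2.\<close>

lemma s_powr_le: "\<exists>C>0. \<forall>\<^sub>F k in sequentially. s k powr q \<le> C * (norm (d k) + norm (d (Suc k)))"
proof -
  define \<kappa> where "\<kappa> = (1 - \<nu>) / (2 * \<tau>)"
  have \<kappa>: "0 < \<kappa>" using \<nu> \<tau>(1) by (simp add: \<kappa>_def)
  define C where "C = 2 * (3 / (\<tau> * c) + \<kappa> powr q)"
  have C: "0 < C" using \<kappa> c \<tau>(1) by (auto simp: C_def intro!: add_pos_nonneg)
  have "\<forall>\<^sub>F k in sequentially. s k < \<eta>" using order_tendstoD(2)[OF s_tendsto \<eta>] .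
  moreover have "\<forall>\<^sub>F k in sequentially. norm (d k) < 1"
    using order_tendstoD(2)[OF tendsto_norm_zero[OF d_tendsto], of 1] by simp
  ultimately have "\<forall>\<^sub>F k in sequentially. s k powr q \<le> C * (norm (d k) + norm (d (Suc k)))"
    using eventually_ge_at_top[of 1]
  proof eventually_elim
    case (elim k)
    define u where "u = f (x k) - f xb"
    define S where "S = norm (d k) + norm (d (Suc k))"
    have S: "norm (d k) \<le> S" "0 \<le> S" by (auto simp: S_def)
    have u: "0 \<le> u" "u < \<eta>"
      using f_ge[OF cball_ball[OF in_cball], of k] s_nonneg[OF cball_ball[OF in_cball], of k] elim
      by (auto simp: u_def)
    have "c * u powr q \<le> norm (F (x k))"
      using loj[OF in_cball, of k] u by (cases "u = 0") (auto simp: u_def)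
    then have "\<tau> * (c * u powr q) \<le> \<tau> * norm (F (x k))" using \<tau>(1) by (intro mult_left_mono) auto
    also have "\<dots> \<le> 3 * S" unfolding S_def by (rule gradient_bound[OF elim(3) in_cball in_cball])
    finally have 1: "u powr q \<le> 3 / (\<tau> * c) * S" using c \<tau>(1) by (simp add: field_simps)
    have "(\<kappa> * (norm (d k))\<^sup>2) powr q = \<kappa> powr q * ((norm (d k))\<^sup>2) powr q"
      using \<kappa> by (simp add: powr_mult)
    also have "\<dots> \<le> \<kappa> powr q * norm (d k)"
    proof (rule mult_left_mono)
      show "((norm (d k))\<^sup>2) powr q \<le> norm (d k)"
      proof (cases "d k = 0")
        case False
        then have "((norm (d k))\<^sup>2) powr q = norm (d k) powr (2 * q)"
          by (simp add: powr_powr flip: powr_numeral)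
        also have "\<dots> \<le> norm (d k) powr 1" using elim(2) q False by (intro powr_mono') auto
        finally show ?thesis by simp
      qed simp
    qed simp
    also have "\<kappa> powr q * norm (d k) \<le> \<kappa> powr q * S" using S by (intro mult_left_mono) auto
    finally have 2: "(\<kappa> * (norm (d k))\<^sup>2) powr q \<le> \<kappa> powr q * S" .
    have "s k powr q = (u + \<kappa> * (norm (d k))\<^sup>2) powr q" by (simp add: s_def u_def \<kappa>_def)
    also have "\<dots> \<le> 2 * (u powr q + (\<kappa> * (norm (d k))\<^sup>2) powr q)"
      using u \<kappa> q by (intro powr_add_le_two) auto
    also have "\<dots> \<le> 2 * (3 / (\<tau> * c) * S + \<kappa> powr q * S)" using 1 2 by simp
    also have "\<dots> = C * S" by (simp add: C_def algebra_simps)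
    finally show ?case by (simp add: S_def)
  qed
  with C show ?thesis by blast
qed

text \<open>With \<open>S\<close> the sum of two displacements, \<open>s k\<close> drops by a
  multiple of the square of \<open>S\<close>, while \<open>s k powr q \<le> C * S\<close>. Squaring
  the latter gives the recursion. By concavity of the power \<open>1 - q\<close>, the drop of
  \<open>s k powr (1 - q)\<close> dominates a multiple of \<open>S\<close>, so the tail length
  telescopes.\<close>

lemma rate_bounds:
  obtains C K k0 where "0 < C" "0 \<le> K" "1 \<le> k0" "\<And>k. k0 \<le> k \<Longrightarrow> s (Suc k) \<le> s k - C * s k powr (2 * q)"
    "\<And>k. k0 \<le> k \<Longrightarrow> norm (x k - xt) \<le> K * s k powr (1 - q)"
proof -
  obtain C k0 where C: "0 < C" "\<And>k. k0 \<le> k \<Longrightarrow> s k powr q \<le> C * (norm (d k) + norm (d (Suc k)))"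
    using s_powr_le unfolding eventually_sequentially by blast
  define k1 where "k1 = max 1 k0"
  define A where "A = \<sigma> / (8 * \<tau>)"
  have A: "0 < A" using \<sigma> \<tau>(1) by (simp add: A_def)
  define K where "K = C / (A * (1 - q))"
  have K: "0 < K" using A C q by (simp add: K_def)
  have step: "A * (norm (d k) + norm (d (Suc k)))\<^sup>2 \<le> s k - s (Suc k)" if "k1 \<le> k" for k
    using square_decrease[OF _ in_cball in_cball, of k] that by (simp add: A_def k1_def)
  have 1: "s (Suc k) \<le> s k - A / C\<^sup>2 * s k powr (2 * q)" if k: "k1 \<le> k" for k
  proof -
    have "s k powr (2 * q) = (s k powr q)\<^sup>2" by (simp add: power2_eq_square flip: powr_add)
    also have "\<dots> \<le> (C * (norm (d k) + norm (d (Suc k))))\<^sup>2" using C(2)[of k] k by (intro power_mono) (auto simp: k1_def)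
    finally have "A / C\<^sup>2 * s k powr (2 * q) \<le> A / C\<^sup>2 * (C * (norm (d k) + norm (d (Suc k))))\<^sup>2"
      using A by (intro mult_left_mono) auto
    also have "\<dots> = A * (norm (d k) + norm (d (Suc k)))\<^sup>2" using C(1) by (simp add: power_mult_distrib)
    finally show ?thesis using step[OF k] by linarith
  qed
  have 2: "norm (d (Suc k)) \<le> K * s k powr (1 - q) - K * s (Suc k) powr (1 - q)" if k: "k1 \<le> k" for k
  proof -
    define S where "S = norm (d k) + norm (d (Suc k))"
    have kk: "1 \<le> k" "k0 \<le> k" using k by (auto simp: k1_def)
    have S: "0 < S" "norm (d (Suc k)) \<le> S" using moving[OF kk(1) in_cball in_cball] by (auto simp: S_def)
    have sp: "0 < s k" "0 < s (Suc k)" "s (Suc k) \<le> s k"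
      using s_pos[of k] s_pos[of "Suc k"] s_antimono[of k "Suc k"] kk by auto
    have inv: "1 / (C * S) \<le> s k powr (- q)"
    proof -
      have "1 / (C * S) \<le> 1 / s k powr q" using C(2)[OF kk(2)] sp S C(1) by (intro divide_left_mono) (auto simp: S_def)
      then show ?thesis by (simp add: powr_minus_divide)
    qed
    have "(1 - q) * (1 / (C * S)) * (A * S\<^sup>2) \<le> (1 - q) * s k powr (- q) * (s k - s (Suc k))"
      using inv step[OF k] q A S C(1) by (intro mult_mono mult_left_mono) (auto simp: S_def)
    also have "\<dots> \<le> s k powr (1 - q) - s (Suc k) powr (1 - q)"
      using sp q by (intro powr_diff_concave) auto
    finally have "(1 - q) * (1 / (C * S)) * (A * S\<^sup>2) \<le> s k powr (1 - q) - s (Suc k) powr (1 - q)" .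
    moreover have "(1 - q) * (1 / (C * S)) * (A * S\<^sup>2) = S / K"
      using S C(1) A q by (simp add: K_def power2_eq_square)
    ultimately have "K * (S / K) \<le> K * (s k powr (1 - q) - s (Suc k) powr (1 - q))"
      using K by (intro mult_left_mono) auto
    then show ?thesis using K S(2) by (simp add: algebra_simps)
  qed
  have 3: "norm (x k - xt) \<le> K * s k powr (1 - q)" if k: "k1 \<le> k" for k
  proof (rule LIMSEQ_le_const2)
    show "(\<lambda>n. norm (x k - x n)) \<longlonglongrightarrow> norm (x k - xt)" by (intro tendsto_intros x_tendsto)
    have "norm (x k - x n) \<le> K * s k powr (1 - q)" if n: "k \<le> n" for n
    proof -
      have "norm (x n - x k) \<le> K * s k powr (1 - q) - K * s n powr (1 - q)"
        using telescope[of k "\<lambda>k. K * s k powr (1 - q)" n] 2 k n by simp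
      moreover have "0 \<le> K * s n powr (1 - q)" using K by simp
      ultimately show ?thesis by (simp add: norm_minus_commute)
    qed
    then show "\<exists>N. \<forall>n\<ge>N. norm (x k - x n) \<le> K * s k powr (1 - q)" by blast
  qed
  show ?thesis using that[of "A / C\<^sup>2" K k1] A C(1) K 1 3 by (auto simp: k1_def)
qed

lemma rate_linear:
  assumes "q = 1 / 2"
  shows "\<exists>\<mu>. 0 < \<mu> \<and> \<mu> < 1 \<and> (\<lambda>k. norm (x k - xt)) \<in> O(\<lambda>k. \<mu> ^ k)"
proof -
  obtain C K k0 where C: "0 < C" "0 \<le> K" "1 \<le> k0" "\<And>k. k0 \<le> k \<Longrightarrow> s (Suc k) \<le> s k - C * s k powr (2 * q)"
    "\<And>k. k0 \<le> k \<Longrightarrow> norm (x k - xt) \<le> K * s k powr (1 - q)" using rate_bounds by blast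
  have pos: "0 < s k" if "k0 \<le> k" for k using s_pos[of k] that C(3) by simp
  have st: "s (Suc k) \<le> s k - C * s k" if "k0 \<le> k" for k
    using C(4)[OF that] pos[OF that] assms by simp
  then obtain D \<mu> where D: "0 < D" "0 < \<mu>" "\<mu> < 1" "\<And>k. k0 \<le> k \<Longrightarrow> s k \<le> D * \<mu> ^ k"
    using linear_decay[of C k0 s, OF C(1) pos st] by blast
  have "norm (x k - xt) \<le> K * sqrt D * sqrt \<mu> ^ k" if k: "k0 \<le> k" for k
  proof -
    have "norm (x k - xt) \<le> K * sqrt (s k)" using C(5)[OF k] pos[OF k] assms by (simp add: powr_half_sqrt)
    also have "\<dots> \<le> K * sqrt (D * \<mu> ^ k)" using D(4)[OF k] C(2) by (intro mult_left_mono) auto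
    also have "\<dots> = K * sqrt D * sqrt \<mu> ^ k" by (simp add: real_sqrt_mult real_sqrt_power)
    finally show ?thesis .
  qed
  then have "(\<lambda>k. norm (x k - xt)) \<in> O(\<lambda>k. sqrt \<mu> ^ k)"
    using D(2) by (intro bigoI[of _ "K * sqrt D"]) (auto simp: eventually_sequentially)
  with D show ?thesis by (intro exI[of _ "sqrt \<mu>"]) auto
qed

text \<open>The recursion has exponent \<open>1 + \<alpha>\<close> with
  \<open>\<alpha> = 2 * q - 1\<close>, so \<open>s k\<close> is of order
  \<open>k powr (- 1 / \<alpha>)\<close>, and the distance is of order
  \<open>s k powr (1 - q)\<close>.\<close>

lemma rate_sublinear:
  assumes "1 / 2 < q"
  shows "(\<lambda>k. norm (x k - xt)) \<in> O(\<lambda>k. real k powr (- ((1 - q) / (2 * q - 1))))"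
proof -
  obtain C K k0 where C: "0 < C" "0 \<le> K" "1 \<le> k0" "\<And>k. k0 \<le> k \<Longrightarrow> s (Suc k) \<le> s k - C * s k powr (2 * q)"
    "\<And>k. k0 \<le> k \<Longrightarrow> norm (x k - xt) \<le> K * s k powr (1 - q)" using rate_bounds by blast
  have pos: "0 < s k" if "k0 \<le> k" for k using s_pos[of k] that C(3) by simp
  have st: "s (Suc k) \<le> s k - C * s k powr (1 + (2 * q - 1))" if "k0 \<le> k" for k using C(4)[OF that] by simp
  then obtain D k1 where D: "0 < D" "k0 \<le> k1" "\<And>k. k1 \<le> k \<Longrightarrow> s k \<le> D * real k powr (- 1 / (2 * q - 1))"
    using sublinear_decay[of C "2 * q - 1" k0 s, OF C(1) _ pos st] assms by auto
  have "norm (x k - xt) \<le> K * D powr (1 - q) * real k powr (- ((1 - q) / (2 * q - 1)))" if k: "k1 \<le> k" for k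
  proof -
    have k0: "k0 \<le> k" using k D(2) by simp
    have "norm (x k - xt) \<le> K * s k powr (1 - q)" by (rule C(5)[OF k0])
    also have "\<dots> \<le> K * (D * real k powr (- 1 / (2 * q - 1))) powr (1 - q)"
      using D(3)[OF k] pos[OF k0] C(2) q by (intro mult_left_mono powr_mono2) auto
    also have "\<dots> = K * (D powr (1 - q) * real k powr (- 1 / (2 * q - 1) * (1 - q)))"
      using D(1) by (simp add: powr_mult powr_powr)
    also have "- 1 / (2 * q - 1) * (1 - q) = - ((1 - q) / (2 * q - 1))" by simp
    finally show ?thesis by simp
  qed
  then show ?thesis
    by (intro bigoI[of _ "K * D powr (1 - q)"]) (auto simp: eventually_sequentially)
qed

end

end

section \<open>The inexact proximal point method\<close>

lemma semialgebraic_function_imp_semialg: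
  assumes "semialgebraic_function h"
  shows "semialg (\<lambda>z. h (fst z) = ereal (snd z))"
  using semialgebraic_set_imp_semialg[OF assms[unfolded semialgebraic_function_def]]
  by (simp add: case_prod_unfold)

context prox_setting
begin

text \<open>Minimality is expressed over finite values of \<open>h\<close>, which makes it a
  first-order formula about the graph.\<close>

lemma Prox_iff:
  "y \<in> Prox h lam x \<longleftrightarrow> (\<exists>t. h y = ereal t \<and> (\<forall>w s. h w = ereal s \<longrightarrow>
     t + 1 / (2 * lam) * (norm (y - x))\<^sup>2 \<le> s + 1 / (2 * lam) * (norm (w - x))\<^sup>2))"
proof
  assume y: "y \<in> Prox h lam x"
  then obtain t where t: "h y = ereal t" using Prox_value by blast
  have "t + 1 / (2 * lam) * (norm (y - x))\<^sup>2 \<le> s + 1 / (2 * lam) * (norm (w - x))\<^sup>2" if "h w = ereal s" for w s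
    using y that t by (auto simp: Prox_def prox_objective_def dest: spec[of _ w])
  with t show "\<exists>t. h y = ereal t \<and> (\<forall>w s. h w = ereal s \<longrightarrow>
     t + 1 / (2 * lam) * (norm (y - x))\<^sup>2 \<le> s + 1 / (2 * lam) * (norm (w - x))\<^sup>2)" by blast
next
  assume "\<exists>t. h y = ereal t \<and> (\<forall>w s. h w = ereal s \<longrightarrow>
     t + 1 / (2 * lam) * (norm (y - x))\<^sup>2 \<le> s + 1 / (2 * lam) * (norm (w - x))\<^sup>2)"
  then obtain t where t: "h y = ereal t" "\<And>w s. h w = ereal s \<Longrightarrow>
     t + 1 / (2 * lam) * (norm (y - x))\<^sup>2 \<le> s + 1 / (2 * lam) * (norm (w - x))\<^sup>2" by blast
  have "prox_objective h lam x y \<le> prox_objective h lam x w" for w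
    using t(2)[of w] not_minfty[of w] by (cases "h w") (auto simp: prox_objective_def t(1))
  then show "y \<in> Prox h lam x" by (simp add: Prox_def)
qed

lemma semialg_graph_E_F:
  assumes "semialgebraic_function h" "0 < R" "R < r"
  shows "semialg (\<lambda>z. fst z \<in> cball xb R \<and> fst (snd z) = E (fst z) \<and> snd (snd z) = F (fst z))"
proof -
  define H where "H y t \<longleftrightarrow> h y = ereal t" for y t
  have H: "semialg (\<lambda>z. H (fst z) (snd z))"
    unfolding H_def by (rule semialgebraic_function_imp_semialg[OF assms(1)])
  \<comment> \<open>The vector equation \<open>lam *\<^sub>R v = x - y\<close> is written as a
    vanishing squared norm to become a polynomial equation.\<close>
  define Q where "Q x c v \<longleftrightarrow> (norm (x - xb))\<^sup>2 \<le> R * R \<and> (\<exists>y t. H y t \<and> (\<forall>w s. H w s \<longrightarrow>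
      t + 1 / (2 * lam) * (norm (y - x))\<^sup>2 \<le> s + 1 / (2 * lam) * (norm (w - x))\<^sup>2) \<and>
      c = t + 1 / (2 * lam) * (norm (y - x))\<^sup>2 \<and> (norm (lam *\<^sub>R v - (x - y)))\<^sup>2 = 0)" for x c v
  have "semialg (\<lambda>z. Q (fst z) (fst (snd z)) (snd (snd z)))"
    unfolding Q_def
    by (intro semialg_intros semialg_compose2[OF H] polynomial_intros polynomial_function_cmul)
  moreover have "Q x c v \<longleftrightarrow> x \<in> cball xb R \<and> c = E x \<and> v = F x" for x c v
  proof (cases "x \<in> cball xb R")
    case True
    then have x: "x \<in> ball xb r" using assms(3) by auto
    have R: "(norm (x - xb))\<^sup>2 \<le> R * R"
      using True assms(2) by (simp add: power2_eq_square[symmetric] dist_norm norm_minus_commute)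
    obtain t where t: "h (P x) = ereal t" "E x = t + 1 / (2 * lam) * (norm (P x - x))\<^sup>2"
      using E_value[OF x] by blast
    have "F x = v" if "lam *\<^sub>R v = x - P x" using lam by (simp add: F_def flip: that)
    moreover have "lam *\<^sub>R F x = x - P x" using lam by (simp add: F_def)
    ultimately have v: "(norm (lam *\<^sub>R v - (x - P x)))\<^sup>2 = 0 \<longleftrightarrow> v = F x" by auto
    have min_iff: "(H y s \<and> (\<forall>w s'. H w s' \<longrightarrow>
        s + 1 / (2 * lam) * (norm (y - x))\<^sup>2 \<le> s' + 1 / (2 * lam) * (norm (w - x))\<^sup>2)) \<longleftrightarrow> y = P x \<and> s = t" for y s
    proof -
      have "y \<in> Prox h lam x \<longleftrightarrow> y = P x" using Prox_eq[OF x] by simp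
      with Prox_iff[of y x] Prox_iff[of "P x" x] t(1) show ?thesis unfolding H_def by auto
    qed
    have "Q x c v \<longleftrightarrow> (\<exists>y s. (H y s \<and> (\<forall>w s'. H w s' \<longrightarrow>
        s + 1 / (2 * lam) * (norm (y - x))\<^sup>2 \<le> s' + 1 / (2 * lam) * (norm (w - x))\<^sup>2)) \<and>
        c = s + 1 / (2 * lam) * (norm (y - x))\<^sup>2 \<and> (norm (lam *\<^sub>R v - (x - y)))\<^sup>2 = 0)"
      unfolding Q_def using R by blast
    also have "\<dots> \<longleftrightarrow> c = E x \<and> v = F x"
      unfolding min_iff t(2) v[symmetric] by blast
    finally show ?thesis using True by blast
  next
    case False
    then have "\<not> (norm (x - xb))\<^sup>2 \<le> R * R"
      using assms(2) by (simp add: power2_eq_square[symmetric] dist_norm norm_minus_commute)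
    with False show ?thesis by (simp add: Q_def)
  qed
  ultimately show ?thesis by simp
qed

lemma continuous_on_E: "continuous_on (ball xb r) E"
proof -
  have "isCont E x" if "x \<in> ball xb r" for x
    using GDERIV_E[OF that] unfolding gderiv_def by (rule has_derivative_continuous)
  then show ?thesis by (simp add: continuous_at_imp_continuous_on)
qed

text \<open>The constant \<open>1 / lam\<close> is weakened to \<open>3 / lam\<close> so that one
  \<open>L\<close> serves for both descent and Lipschitz continuity.\<close>

lemma E_descent:
  assumes "x \<in> ball xb r" "y \<in> ball xb r"
  shows "E y \<le> E x + F x \<bullet> (y - x) + (3 / lam) / 2 * (norm (y - x))\<^sup>2"
proof -
  have "1 / (2 * lam) * (norm (y - x))\<^sup>2 \<le> (3 / lam) / 2 * (norm (y - x))\<^sup>2"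
    using lam by (intro mult_right_mono) (auto simp: field_simps)
  with E_upper[OF assms] show ?thesis by linarith
qed

lemma smooth_near_min_E: "smooth_near_min E F xb r (3 / lam)"
  using r(1) lam E_descent F_Lipschitz F_xb E_ge E_xb continuous_on_E by unfold_locales auto

lemma semialg_gradient_E:
  assumes "semialgebraic_function h"
  shows "semialg_gradient E F xb (r / 2) (3 / lam)"
proof
  have sub: "cball xb (r / 2) \<subseteq> ball xb r" using r(1) by auto
  show "0 < r / 2" "0 \<le> 3 / lam" using r(1) lam by auto
  show "E y \<le> E x + F x \<bullet> (y - x) + 3 / lam / 2 * (norm (y - x))\<^sup>2"
    if "x \<in> cball xb (r / 2)" "y \<in> cball xb (r / 2)" for x y
    using that sub by (intro E_descent) auto
  show "continuous_on (cball xb (r / 2)) E" using continuous_on_E sub by (rule continuous_on_subset)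
  show "continuous_on (cball xb (r / 2)) F" using continuous_on_F sub by (rule continuous_on_subset)
  show "semialg (\<lambda>z. fst z \<in> cball xb (r / 2) \<and> fst (snd z) = E (fst z) \<and> snd (snd z) = F (fst z))"
    using assms r(1) by (intro semialg_graph_E_F) auto
qed

text \<open>The derivative of \<open>M * t powr (1 - q)\<close> is
  \<open>M * (1 - q) * t powr (- q)\<close>, so the PLK inequality becomes a power bound with
  \<open>c = 1 / (M * (1 - q))\<close>.\<close>

lemma PLK_imp_lojasiewicz:
  assumes "PLK E xb (\<lambda>t. M * t powr (1 - q))" "0 < M" "0 \<le> q" "q < 1"
  shows "\<exists>R c \<eta>. 0 < R \<and> R \<le> r / 2 \<and> 0 < c \<and> 0 < \<eta> \<and> (\<forall>x\<in>cball xb R. 0 < E x - E xb \<and> E x - E xb < \<eta> \<longrightarrow>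
    c * (E x - E xb) powr q \<le> norm (F x))"
proof -
  obtain \<epsilon>0 :: ereal and U where U: "0 < \<epsilon>0" "xb \<in> U" "C1_on E U"
    "\<And>x. x \<in> U \<Longrightarrow> E xb < E x \<Longrightarrow> ereal (E x) < ereal (E xb) + \<epsilon>0 \<Longrightarrow>
       deriv (\<lambda>t. M * t powr (1 - q)) (E x - E xb) * norm (gradient E x) \<ge> 1"
    using assms(1) unfolding PLK_def by blast
  have "open U" using U(3) by (simp add: C1_on_def)
  then obtain R' where R': "0 < R'" "cball xb R' \<subseteq> U" using U(2) open_contains_cball by blast
  define R where "R = min R' (r / 2)"
  have R: "0 < R" "R \<le> r / 2" "cball xb R \<subseteq> U" "cball xb R \<subseteq> ball xb r"
    using R' r(1) by (auto simp: R_def)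
  \<comment> \<open>The height in the PLK condition may be infinite; a finite one below it
    suffices.\<close>
  obtain \<eta> where \<eta>: "0 < \<eta>" "ereal \<eta> \<le> \<epsilon>0"
    using ereal_dense2[OF U(1)] by (auto simp: zero_ereal_def intro: less_imp_le)
  define c where "c = 1 / (M * (1 - q))"
  have c: "0 < c" using assms by (simp add: c_def)
  have "c * (E x - E xb) powr q \<le> norm (F x)"
    if x: "x \<in> cball xb R" "0 < E x - E xb" "E x - E xb < \<eta>" for x
  proof -
    define t where "t = E x - E xb"
    have t: "0 < t" using x by (simp add: t_def)
    have "((\<lambda>t. M * t powr (1 - q)) has_real_derivative M * ((1 - q) * t powr (1 - q - 1))) (at t)"
      using t by (auto intro!: derivative_eq_intros has_real_derivative_powr)
    then have d: "deriv (\<lambda>t. M * t powr (1 - q)) t = M * ((1 - q) * t powr (- q))"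
      by (simp add: DERIV_imp_deriv)
    have "ereal (E x) < ereal (E xb) + ereal \<eta>" using x(3) by simp
    also have "\<dots> \<le> ereal (E xb) + \<epsilon>0" using \<eta>(2) by (rule add_left_mono)
    finally have "1 \<le> deriv (\<lambda>t. M * t powr (1 - q)) t * norm (gradient E x)"
      using U(4)[of x] R(3) x by (auto simp: t_def)
    also have "gradient E x = F x" using x(1) R(4) by (intro gradient_E) auto
    finally have "1 \<le> M * (1 - q) * norm (F x) * t powr (- q)" by (simp add: d mult_ac)
    then have "1 * t powr q \<le> (M * (1 - q) * norm (F x) * t powr (- q)) * t powr q"
      by (rule mult_right_mono) simp
    also have "\<dots> = M * (1 - q) * norm (F x)" using t by (simp add: powr_minus)
    finally show ?thesis using assms by (simp add: c_def t_def field_simps)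
  qed
  with R \<eta>(1) c show ?thesis by blast
qed

end

lemma (in semialg_gradient) lojasiewicz_exponent_mono:
  assumes "lojasiewicz R q" "q \<le> q'"
  shows "lojasiewicz R q'"
proof -
  obtain c \<eta> where c: "0 < c" "0 < \<eta>"
    "\<And>x. x \<in> cball xb R \<Longrightarrow> 0 < f x - f xb \<Longrightarrow> f x - f xb < \<eta> \<Longrightarrow> c * (f x - f xb) powr q \<le> norm (F x)"
    using assms(1) unfolding lojasiewicz_def by blast
  have "c * (f x - f xb) powr q' \<le> norm (F x)"
    if x: "x \<in> cball xb R" "0 < f x - f xb" "f x - f xb < min \<eta> 1" for x
  proof -
    have "(f x - f xb) powr q' \<le> (f x - f xb) powr q" using x assms(2) by (intro powr_mono') auto
    then have "c * (f x - f xb) powr q' \<le> c * (f x - f xb) powr q" using c by (intro mult_left_mono) auto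
    also have "\<dots> \<le> norm (F x)" using c(3)[of x] x by simp
    finally show ?thesis .
  qed
  with c(1,2) show ?thesis unfolding lojasiewicz_def
    by (intro exI[of _ c] conjI exI[of _ "min \<eta> 1"]) auto
qed

text \<open>A third of \<open>\<rho>\<close> is reserved for each of \<open>\<xi>\<close>, the
  \<open>\<phi>\<close> term and the square root.\<close>

lemma start_radius_exists:
  fixes \<phi> :: "real \<Rightarrow> real"
  assumes "0 < t0" "0 < L" "0 < K" "0 < \<rho>" and small: "\<And>e. 0 < e \<Longrightarrow> \<exists>\<delta>>0. \<forall>t. 0 \<le> t \<and> t < \<delta> \<longrightarrow> \<phi> t < e"
  shows "\<exists>\<xi>>0. L / 2 * \<xi>\<^sup>2 < t0 \<and> \<xi> + K * (\<phi> (L / 2 * \<xi>\<^sup>2 / 2) + sqrt (L / 2 * \<xi>\<^sup>2)) \<le> \<rho>"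
proof -
  define e where "e = \<rho> / (3 * K)"
  have e: "0 < e" "K * e = \<rho> / 3" using assms by (auto simp: e_def)
  obtain \<delta> where \<delta>: "0 < \<delta>" "\<And>t. 0 \<le> t \<Longrightarrow> t < \<delta> \<Longrightarrow> \<phi> t < e" using small[OF e(1)] by blast
  define w where "w = min (min t0 \<delta>) (e\<^sup>2)"
  have w: "0 < w" "w \<le> t0" "w \<le> \<delta>" "w \<le> e\<^sup>2" using assms(1) \<delta>(1) e(1) by (auto simp: w_def)
  define \<xi> where "\<xi> = min (\<rho> / 3) (sqrt (w / L))"
  have \<xi>: "0 < \<xi>" "\<xi> \<le> \<rho> / 3" using assms w by (auto simp: \<xi>_def)
  have "\<xi>\<^sup>2 \<le> (sqrt (w / L))\<^sup>2" using \<xi> by (intro power_mono) (auto simp: \<xi>_def)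
  also have "\<dots> = w / L" using w assms(2) by simp
  finally have "L * \<xi>\<^sup>2 \<le> w" using assms(2) by (simp add: field_simps)
  moreover have "0 < L * \<xi>\<^sup>2" using assms(2) \<xi> by simp
  ultimately have v: "0 < L / 2 * \<xi>\<^sup>2" "L / 2 * \<xi>\<^sup>2 < w" by auto
  have "sqrt (L / 2 * \<xi>\<^sup>2) \<le> sqrt (e\<^sup>2)" by (rule real_sqrt_le_mono) (use v w in linarith)
  then have "sqrt (L / 2 * \<xi>\<^sup>2) \<le> e" using e by simp
  moreover have "\<phi> (L / 2 * \<xi>\<^sup>2 / 2) < e" using v w by (intro \<delta>(2)) auto
  ultimately have "K * (\<phi> (L / 2 * \<xi>\<^sup>2 / 2) + sqrt (L / 2 * \<xi>\<^sup>2)) \<le> K * (2 * e)"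
    using assms(3) by (intro mult_left_mono) auto
  also have "\<dots> = 2 * (\<rho> / 3)" using e(2) by simp
  finally have "\<xi> + K * (\<phi> (L / 2 * \<xi>\<^sup>2 / 2) + sqrt (L / 2 * \<xi>\<^sup>2)) \<le> \<rho>" using \<xi>(2) by simp
  with \<xi>(1) v(2) w(2) show ?thesis by (intro exI[of _ \<xi>]) auto
qed


section \<open>Choice of the radii and transfer to the proximal method\<close>

context prox_setting
begin

text \<open>The conclusion of the theorem in terms of \<open>E\<close> and \<open>P\<close>; it is
  unfolded again in the final step.\<close>

definition limit_with_rates :: "(nat \<Rightarrow> real) \<Rightarrow> (nat \<Rightarrow> real) \<Rightarrow> (nat \<Rightarrow> 'a) \<Rightarrow> 'a \<Rightarrow> bool" where
  "limit_with_rates \<beta> \<gamma> x xt \<longleftrightarrow> local_minimizer h xt \<and> h xt = h xb \<and>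
     x \<longlonglongrightarrow> xt \<and> momentum \<beta> x \<longlonglongrightarrow> xt \<and> momentum \<gamma> x \<longlonglongrightarrow> xt \<and>
     (\<forall>M>0. \<forall>q\<in>{0..<1}.
        PLK E xb (\<lambda>t. M * t powr (1 - q)) \<longrightarrow>
        (\<forall>\<^sub>F k in sequentially. is_singleton (Prox h lam (x k))) \<and>
        (q \<le> 1 / 2 \<longrightarrow> converges_linearly x xt \<and> converges_linearly (\<lambda>k. x k - P (x k)) 0) \<and>
        (q > 1 / 2 \<longrightarrow>
           (\<lambda>k. norm (x k - xt)) \<in> O(\<lambda>k. real k powr (- ((1 - q) / (2 * q - 1)))) \<and>
           (\<lambda>k. norm (x k - P (x k))) \<in> O(\<lambda>k. real k powr (- ((1 - q) / (2 * q - 1))))))"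

text \<open>Divided by \<open>lam\<close>, the inexactness criterion for \<open>p\<close> becomes a
  relative error of \<open>g\<close> with respect to the gradient \<open>F\<close>.\<close>

lemma momentum_method_IPPm:
  assumes x: "IPPm h (ball xb r) lam \<tau> \<nu> \<beta> \<gamma> x"
    and noncrit: "\<forall>k\<ge>1. 0 \<notin> limiting_subdiff h (momentum \<gamma> x k)"
  obtains g where "\<And>k. 1 \<le> k \<Longrightarrow> x (Suc k) = momentum \<beta> x k - \<tau> *\<^sub>R g k"
    "\<And>k. 1 \<le> k \<Longrightarrow> momentum \<gamma> x k \<in> ball xb r \<Longrightarrow>
      norm (g k - F (momentum \<gamma> x k)) \<le> \<nu> * norm (g k) \<and> F (momentum \<gamma> x k) \<noteq> 0"
proof -
  obtain p where p: "\<And>k. 1 \<le> k \<Longrightarrow> momentum \<gamma> x k \<in> ball xb r \<Longrightarrow>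
      norm (p k - P (momentum \<gamma> x k)) \<le> \<nu> * norm (p k - momentum \<gamma> x k)"
    "\<And>k. 1 \<le> k \<Longrightarrow> x (k + 1) = momentum \<beta> x k - \<tau> *\<^sub>R (inverse lam *\<^sub>R (momentum \<gamma> x k - p k))"
    using x unfolding IPPm_def Let_def by blast
  define g where "g k = inverse lam *\<^sub>R (momentum \<gamma> x k - p k)" for k
  have "norm (g k - F (momentum \<gamma> x k)) \<le> \<nu> * norm (g k)"
    if k: "1 \<le> k" "momentum \<gamma> x k \<in> ball xb r" for k
  proof -
    have "g k - F (momentum \<gamma> x k) = inverse lam *\<^sub>R (P (momentum \<gamma> x k) - p k)"
      by (simp add: g_def F_def flip: scaleR_diff_right)
    then have "norm (g k - F (momentum \<gamma> x k)) = inverse lam * norm (p k - P (momentum \<gamma> x k))"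
      using lam by (simp add: norm_minus_commute)
    also have "\<dots> \<le> inverse lam * (\<nu> * norm (p k - momentum \<gamma> x k))"
      using lam by (intro mult_left_mono p k) auto
    also have "\<dots> = \<nu> * norm (g k)" using lam by (simp add: g_def norm_minus_commute)
    finally show ?thesis .
  qed
  moreover have "F (momentum \<gamma> x k) \<noteq> 0" if "1 \<le> k" "momentum \<gamma> x k \<in> ball xb r" for k
    using critical_subdiff[OF that(2)] noncrit that(1) by blast
  moreover have "x (Suc k) = momentum \<beta> x k - \<tau> *\<^sub>R g k" if "1 \<le> k" for k
    using p(2)[OF that] by (simp add: g_def)
  ultimately show ?thesis using that by blast
qed

lemma IPPm_limit:
  assumes semialg: "semialgebraic_function h" and \<nu>: "0 < \<nu>" "\<nu> < 1" and \<delta>bar: "0 \<le> \<delta>bar"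
  shows "\<exists>\<xi>>0. \<exists>T>0. \<forall>x0\<in>ball xb \<xi>. \<forall>\<tau>\<in>{0<..T}. \<forall>\<beta> \<gamma> x.
    (\<forall>k\<ge>1. 0 \<le> \<beta> k \<and> 0 \<le> \<gamma> k) \<and>
    bdd_above (\<beta> ` {1..}) \<and> (SUP k\<in>{1..}. \<beta> k) \<in> {0..<1 - \<nu>} \<and>
    bdd_above ((\<lambda>k. \<bar>\<beta> k - \<gamma> k\<bar>) ` {1..}) \<and> (SUP k\<in>{1..}. \<bar>\<beta> k - \<gamma> k\<bar>) = \<delta>bar \<and>
    x 0 = x0 \<and> x 1 = x0 \<and>
    IPPm h (ball xb r) lam \<tau> \<nu> \<beta> \<gamma> x \<and>
    (\<forall>k\<ge>1. 0 \<notin> limiting_subdiff h (momentum \<gamma> x k)) \<longrightarrow>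
    (\<exists>xt. limit_with_rates \<beta> \<gamma> x xt)"
proof -
  interpret G: semialg_gradient E F xb "r / 2" "3 / lam"
    by (rule semialg_gradient_E[OF semialg])
  interpret smooth_near_min E F xb r "3 / lam" by (rule smooth_near_min_E)
  obtain \<phi> t0 where des: "G.desingularizing \<phi> t0" using G.desingularizing_exists by blast
  \<comment> \<open>\<open>R1\<close> is fixed before any \<open>M\<close> and \<open>q\<close>
    appear: an exponent valid in some smaller ball is valid in this one.\<close>
  obtain R1 where R1: "0 < R1" "R1 \<le> r / 2"
    "\<And>R q. 0 < R \<Longrightarrow> R \<le> r / 2 \<Longrightarrow> G.lojasiewicz R q \<Longrightarrow> G.lojasiewicz R1 q"
    using G.lojasiewicz_uniform by blast
  have des': "0 < t0" "\<phi> 0 = 0" "\<And>s t. 0 \<le> s \<Longrightarrow> s \<le> t \<Longrightarrow> t < t0 \<Longrightarrow> \<phi> s \<le> \<phi> t"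
    "\<And>e. 0 < e \<Longrightarrow> \<exists>\<delta>>0. \<forall>t. 0 \<le> t \<and> t < \<delta> \<longrightarrow> \<phi> t < e"
    using des unfolding G.desingularizing_def by blast+
  define L where "L = 3 / lam"
  have L: "0 < L" using lam by (simp add: L_def)
  \<comment> \<open>The extrapolation is bounded because
    \<open>\<gamma> k \<le> \<beta> k + \<delta>bar\<close> and
    \<open>\<beta> k < 1\<close>.\<close>
  define \<Gamma> where "\<Gamma> = 1 + \<delta>bar"
  have \<Gamma>: "1 \<le> \<Gamma>" using \<delta>bar by (simp add: \<Gamma>_def)
  define \<rho>1 where "\<rho>1 = min R1 (r / (8 * (1 + \<Gamma>)))"
  have "4 * (1 + \<Gamma>) * \<rho>1 \<le> 4 * (1 + \<Gamma>) * (r / (8 * (1 + \<Gamma>)))"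
    using \<Gamma> by (intro mult_left_mono) (auto simp: \<rho>1_def)
  also have "\<dots> = r / 2" using \<Gamma> by (simp add: field_simps)
  also have "\<dots> < r" using r(1) by simp
  finally have \<rho>1_r: "4 * (1 + \<Gamma>) * \<rho>1 < r" .
  have \<rho>1: "0 < \<rho>1" "\<rho>1 \<le> R1" using R1(1) r(1) \<Gamma> by (auto simp: \<rho>1_def)
  define T where "T = min 1 (min (\<nu> * (1 - \<nu>) / 2 / (L * (\<Gamma> + 1))) ((1 - \<nu>) / (L * (1 + 2 * \<Gamma>))))"
  have T: "0 < T" using \<nu> L \<Gamma> by (simp add: T_def)
  have K: "0 < 48 / (\<nu> * (1 - \<nu>))" using \<nu> by simp
  obtain \<xi> where \<xi>: "0 < \<xi>" "L / 2 * \<xi>\<^sup>2 < t0"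
    "\<xi> + 48 / (\<nu> * (1 - \<nu>)) * (\<phi> (L / 2 * \<xi>\<^sup>2 / 2) + sqrt (L / 2 * \<xi>\<^sup>2)) \<le> \<rho>1"
    using start_radius_exists[OF des'(1) L K \<rho>1(1) des'(4)] by blast
  have "\<exists>xt. limit_with_rates \<beta> \<gamma> x xt"
    if x0: "x 0 \<in> ball xb \<xi>" "x 1 = x 0" and \<tau>: "0 < \<tau>" "\<tau> \<le> T"
      and nonneg: "\<And>k. 1 \<le> k \<Longrightarrow> 0 \<le> \<beta> k \<and> 0 \<le> \<gamma> k"
      and \<beta>: "bdd_above (\<beta> ` {1..})" "(SUP k\<in>{1..}. \<beta> k) < 1 - \<nu>"
      and \<gamma>: "bdd_above ((\<lambda>k. \<bar>\<beta> k - \<gamma> k\<bar>) ` {1..})" "(SUP k\<in>{1..}. \<bar>\<beta> k - \<gamma> k\<bar>) = \<delta>bar"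
      and x: "IPPm h (ball xb r) lam \<tau> \<nu> \<beta> \<gamma> x"
        "\<forall>k\<ge>1. 0 \<notin> limiting_subdiff h (momentum \<gamma> x k)" for \<tau> \<beta> \<gamma> x
  proof -
    obtain g where g: "\<And>k. 1 \<le> k \<Longrightarrow> x (Suc k) = momentum \<beta> x k - \<tau> *\<^sub>R g k"
      "\<And>k. 1 \<le> k \<Longrightarrow> momentum \<gamma> x k \<in> ball xb r \<Longrightarrow>
        norm (g k - F (momentum \<gamma> x k)) \<le> \<nu> * norm (g k) \<and> F (momentum \<gamma> x k) \<noteq> 0"
      using momentum_method_IPPm[OF x] by blast
    have \<beta>_le: "\<beta> k \<le> 1 - \<nu>" if "1 \<le> k" for k
      using cSUP_upper[OF _ \<beta>(1), of k] \<beta>(2) that by simp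
    have \<gamma>_le: "\<gamma> k \<le> \<Gamma>" if "1 \<le> k" for k
      using cSUP_upper[OF _ \<gamma>(1), of k] \<gamma>(2) \<beta>_le[OF that] that \<nu> by (simp add: \<Gamma>_def)
    interpret M: momentum_method E F xb r "3 / lam" \<phi> t0 \<rho>1 \<nu> \<Gamma> \<tau> \<xi> \<beta> \<gamma> x g
    proof
      show "\<tau> \<le> 1" using \<tau>(2) by (simp add: T_def)
      have "\<tau> \<le> \<nu> * (1 - \<nu>) / 2 / (L * (\<Gamma> + 1))" using \<tau>(2) by (simp add: T_def)
      then have "\<tau> * (L * (\<Gamma> + 1)) \<le> \<nu> * (1 - \<nu>) / 2" using L \<Gamma> by (subst (asm) pos_le_divide_eq) auto
      then show "\<tau> * (3 / lam) * (\<Gamma> + 1) \<le> \<nu> * (1 - \<nu>) / 2" by (simp only: L_def mult.assoc)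
      have "\<tau> \<le> (1 - \<nu>) / (L * (1 + 2 * \<Gamma>))" using \<tau>(2) by (simp add: T_def)
      then have "\<tau> * (L * (1 + 2 * \<Gamma>)) \<le> 1 - \<nu>" using L \<Gamma> by (subst (asm) pos_le_divide_eq) auto
      then show "\<tau> * (3 / lam) * (1 + 2 * \<Gamma>) \<le> 1 - \<nu>" by (simp only: L_def mult.assoc)
      show "norm (x 0 - xb) \<le> \<xi>" using x0(1) by (simp add: dist_norm norm_minus_commute)
      show "3 / lam / 2 * \<xi>\<^sup>2 < t0" using \<xi>(2) by (simp add: L_def)
      show "\<xi> + 48 / (\<nu> * (1 - \<nu>)) * (\<phi> (3 / lam / 2 * \<xi>\<^sup>2 / 2) + sqrt (3 / lam / 2 * \<xi>\<^sup>2)) \<le> \<rho>1"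
        using \<xi>(3) by (simp only: L_def)
      show "t - s \<le> (\<phi> t - \<phi> s) * norm (F y)"
        if "0 \<le> s" "s \<le> t" "t \<le> u" "u < t0" "y \<in> cball xb \<rho>1" "E y = E xb + u" for s t u y
        using that R1(2) \<rho>1(2) by (intro G.desingularizing_level[OF des]) (auto simp: G.level_def)
    qed (use \<nu> \<Gamma> \<rho>1 \<rho>1_r \<tau> x0 nonneg \<beta>_le \<gamma>_le g des' in auto)
    have in_ball: "x k \<in> ball xb r" for k by (rule M.cball_ball[OF M.in_cball])
    have xt: "M.xt \<in> ball xb r" by (rule M.cball_ball[OF M.xt_in])
    have min: "local_minimizer h M.xt" "h M.xt = h xb"
      using critical_local_minimizer[OF xt M.F_xt] M.f_xt E_xb by auto
    have "\<bar>\<beta> k\<bar> \<le> 1" "\<bar>\<gamma> k\<bar> \<le> \<Gamma>" if "1 \<le> k" for k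
      using nonneg[OF that] \<beta>_le[OF that] \<gamma>_le[OF that] \<nu> by auto
    then have mom: "momentum \<beta> x \<longlonglongrightarrow> M.xt" "momentum \<gamma> x \<longlonglongrightarrow> M.xt"
      using M.momentum_tendsto[of \<beta> 1] M.momentum_tendsto[of \<gamma> \<Gamma>] by blast+
    \<comment> \<open>\<open>x k - P (x k)\<close> is \<open>lam\<close> times a Lipschitz gradient
      that vanishes at the limit, so it inherits every rate of the iterates.\<close>
    have residual: "(\<lambda>k. norm (x k - P (x k))) \<in> O(\<lambda>k. norm (x k - M.xt))"
    proof (rule bigoI[of _ 3], rule always_eventually, rule allI)
      fix k
      have "x k - P (x k) = lam *\<^sub>R F (x k)" using lam by (simp add: F_def)
      then have "norm (x k - P (x k)) = lam * norm (F (x k) - F M.xt)" using lam by (simp add: M.F_xt)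
      also have "\<dots> \<le> lam * (3 / lam * norm (x k - M.xt))"
        using lam by (intro mult_left_mono F_Lipschitz in_ball xt) auto
      finally show "norm (norm (x k - P (x k))) \<le> 3 * norm (norm (x k - M.xt))" using lam by simp
    qed
    have rates: "(\<forall>\<^sub>F k in sequentially. is_singleton (Prox h lam (x k))) \<and>
        (q \<le> 1 / 2 \<longrightarrow> converges_linearly x M.xt \<and> converges_linearly (\<lambda>k. x k - P (x k)) 0) \<and>
        (q > 1 / 2 \<longrightarrow>
           (\<lambda>k. norm (x k - M.xt)) \<in> O(\<lambda>k. real k powr (- ((1 - q) / (2 * q - 1)))) \<and>
           (\<lambda>k. norm (x k - P (x k))) \<in> O(\<lambda>k. real k powr (- ((1 - q) / (2 * q - 1)))))"
      if M: "0 < M" and q: "q \<in> {0..<1}" and PLK: "PLK E xb (\<lambda>t. M * t powr (1 - q))" for M q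
    proof -
      define q' where "q' = max q (1 / 2)"
      have q': "1 / 2 \<le> q'" "q' < 1" using q by (auto simp: q'_def)
      \<comment> \<open>The exponent passes from the ball of the PLK condition to \<open>R1\<close>,
        and then to the trajectory ball \<open>\<rho>1\<close> inside it.\<close>
      obtain R where R: "0 < R" "R \<le> r / 2" "G.lojasiewicz R q"
        using PLK_imp_lojasiewicz[OF PLK M] q unfolding G.lojasiewicz_def by auto
      from R(3) have "G.lojasiewicz R q'" by (rule G.lojasiewicz_exponent_mono) (simp add: q'_def)
      then have "G.lojasiewicz R1 q'" using R1(3) R(1,2) by blast
      then have "G.lojasiewicz \<rho>1 q'" using \<rho>1(2) by (rule G.lojasiewicz_antimono)
      then obtain c \<eta> where c: "0 < c" "0 < \<eta>"
        "\<And>y. y \<in> cball xb \<rho>1 \<Longrightarrow> 0 < E y - E xb \<Longrightarrow> E y - E xb < \<eta> \<Longrightarrow> c * (E y - E xb) powr q' \<le> norm (F y)"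
        unfolding G.lojasiewicz_def by blast
      have "\<forall>\<^sub>F k in sequentially. is_singleton (Prox h lam (x k))"
        by (rule always_eventually) (simp add: Prox_eq[OF in_ball])
      moreover have "converges_linearly x M.xt \<and> converges_linearly (\<lambda>k. x k - P (x k)) 0" if "q \<le> 1 / 2"
      proof -
        have "q' = 1 / 2" using that by (simp add: q'_def)
        from M.rate_linear[OF c(1,2) q' c(3) this] obtain \<mu> where
          \<mu>: "0 < \<mu>" "\<mu> < 1" "(\<lambda>k. norm (x k - M.xt)) \<in> O(\<lambda>k. \<mu> ^ k)" by blast
        with landau_o.big_trans[OF residual \<mu>(3)] show ?thesis
          unfolding converges_linearly_def by auto
      qed
      moreover have "(\<lambda>k. norm (x k - M.xt)) \<in> O(\<lambda>k. real k powr (- ((1 - q) / (2 * q - 1)))) \<and>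
           (\<lambda>k. norm (x k - P (x k))) \<in> O(\<lambda>k. real k powr (- ((1 - q) / (2 * q - 1))))" if "q > 1 / 2"
      proof -
        have "q' = q" using that by (simp add: q'_def)
        with M.rate_sublinear[OF c(1,2) q' c(3)] that
        have "(\<lambda>k. norm (x k - M.xt)) \<in> O(\<lambda>k. real k powr (- ((1 - q) / (2 * q - 1))))" by simp
        with landau_o.big_trans[OF residual this] show ?thesis by blast
      qed
      ultimately show ?thesis by blast
    qed
    have "limit_with_rates \<beta> \<gamma> x M.xt"
      unfolding limit_with_rates_def using min M.x_tendsto mom rates by blast
    then show ?thesis by blast
  qed
  with \<xi>(1) T show ?thesis by (intro exI[of _ \<xi>] conjI exI[of _ T]) auto
qed

end

theorem theorem4p12:
  fixes h :: "real ^ 'n \<Rightarrow> ereal" and xbar :: "real ^ 'n"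
  assumes "proper h" and "lsc h" and "prox_bounded h" and "semialgebraic_function h"
    and "local_minimizer h xbar"
    and "prox_regular h xbar 0"
  shows "\<exists>lambar>0. \<forall>lam\<in>{0<..lambar}. \<exists>r>0.
    (\<forall>x\<in>ball xbar r. is_singleton (Prox h lam x) \<and> \<bar>moreau_env h lam x\<bar> \<noteq> \<infinity>) \<and>
    C1_on (\<lambda>x. real_of_ereal (moreau_env h lam x)) (ball xbar r) \<and>
    (\<forall>\<nu>\<in>{0<..<1}. \<forall>\<delta>bar\<ge>0. \<exists>\<xi>>0. \<exists>T>0. \<forall>x0\<in>ball xbar \<xi>. \<forall>\<tau>\<in>{0<..T}. \<forall>\<beta> \<gamma> x.
       (\<forall>k\<ge>1. 0 \<le> \<beta> k \<and> 0 \<le> \<gamma> k) \<and>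
       bdd_above (\<beta> ` {1..}) \<and> (SUP k\<in>{1..}. \<beta> k) \<in> {0..<1 - \<nu>} \<and>
       bdd_above ((\<lambda>k. \<bar>\<beta> k - \<gamma> k\<bar>) ` {1..}) \<and> (SUP k\<in>{1..}. \<bar>\<beta> k - \<gamma> k\<bar>) = \<delta>bar \<and>
       x 0 = x0 \<and> x 1 = x0 \<and>
       IPPm h (ball xbar r) lam \<tau> \<nu> \<beta> \<gamma> x \<and>
       (\<forall>k\<ge>1. 0 \<notin> limiting_subdiff h (momentum \<gamma> x k)) \<longrightarrow>
       (\<exists>xt. local_minimizer h xt \<and> h xt = h xbar \<and>
          x \<longlonglongrightarrow> xt \<and> momentum \<beta> x \<longlonglongrightarrow> xt \<and> momentum \<gamma> x \<longlonglongrightarrow> xt \<and>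
          (\<forall>M>0. \<forall>q\<in>{0..<1}.
             PLK (\<lambda>x. real_of_ereal (moreau_env h lam x)) xbar (\<lambda>t. M * t powr (1 - q)) \<longrightarrow>
             (\<forall>\<^sub>F k in sequentially. is_singleton (Prox h lam (x k))) \<and>
             (q \<le> 1 / 2 \<longrightarrow>
                converges_linearly x xt \<and>
                converges_linearly (\<lambda>k. x k - prox_point h lam (x k)) 0) \<and>
             (q > 1 / 2 \<longrightarrow>
                (\<lambda>k. norm (x k - xt)) \<in> O(\<lambda>k. real k powr (- ((1 - q) / (2 * q - 1)))) \<and>
                (\<lambda>k. norm (x k - prox_point h lam (x k)))
                  \<in> O(\<lambda>k. real k powr (- ((1 - q) / (2 * q - 1))))))))"
proof -
  obtain hb where hb: "h xbar = ereal hb"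
    using assms(1,5) by (cases "h xbar") (auto simp: proper_def local_minimizer_def edom_def)
  obtain a \<delta> where a: "0 \<le> a" "0 < \<delta>" "\<And>y. y \<in> ball xbar \<delta> \<Longrightarrow> ereal hb \<le> h y"
    "\<And>y. ereal (hb - a * (norm (y - xbar))\<^sup>2) \<le> h y"
    using prox_bounded_quadratic_minorant[OF assms(3,5) hb] by metis
  obtain \<epsilon> \<rho> where \<epsilon>: "0 < \<epsilon>" "0 \<le> \<rho>" and pr: "\<forall>x\<in>ball xbar \<epsilon>. \<forall>u\<in>ball xbar \<epsilon>. \<forall>v\<in>limiting_subdiff h u \<inter> ball 0 \<epsilon>.
      h u < h xbar + ereal \<epsilon> \<longrightarrow> h x \<ge> h u + ereal (v \<bullet> (x - u) - \<rho> / 2 * (norm (x - u))\<^sup>2)"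
    using assms(6) unfolding prox_regular_def by blast
  \<comment> \<open>\<open>8 * a\<close> and \<open>2 * \<rho>\<close> produce the two smallness
    conditions on \<open>lam\<close>; the 1 keeps the denominator positive.\<close>
  define lambar where "lambar = 1 / (8 * a + 2 * \<rho> + 1)"
  have lambar: "0 < lambar" using a(1) \<epsilon>(2) by (simp add: lambar_def add_nonneg_pos)
  \<comment> \<open>\<open>?A\<close> captures the body of the statement, so that the witnesses can
    be supplied without writing it out again.\<close>
  let "\<exists>lambar>0. \<forall>lam\<in>{0<..lambar}. \<exists>r>0. ?A lam r" = ?thesis
  show ?thesis
  proof (rule exI[of _ lambar], rule conjI[OF lambar], rule ballI)
    fix lam assume "lam \<in> {0<..lambar}"
    then have lam: "0 < lam" "lam * (8 * a + 2 * \<rho> + 1) \<le> 1"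
      using a(1) \<epsilon>(2) by (auto simp: lambar_def pos_le_divide_eq add_nonneg_pos)
    have nn: "0 \<le> lam * a" "0 \<le> lam * \<rho>" using lam(1) a(1) \<epsilon>(2) by auto
    interpret S: prox_setting h xbar hb a \<delta> \<epsilon> \<rho> lam
    proof
      have "lam * (8 * a + 2 * \<rho> + 1) = 8 * (lam * a) + 2 * (lam * \<rho>) + lam" by (simp add: algebra_simps)
      with lam nn have "8 * (lam * a) \<le> 1" "2 * (lam * \<rho>) \<le> 1" by linarith+
      then show "8 * a * lam \<le> 1" "2 * lam * \<rho> \<le> 1" by (simp_all add: mult_ac)
      show "h u + ereal (v \<bullet> (x - u) - \<rho> / 2 * (norm (x - u))\<^sup>2) \<le> h x"
        if "x \<in> ball xbar \<epsilon>" "u \<in> ball xbar \<epsilon>" "v \<in> limiting_subdiff h u" "norm v < \<epsilon>" "h u < ereal (hb + \<epsilon>)"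
        for x u v
      proof -
        have "v \<in> limiting_subdiff h u \<inter> ball 0 \<epsilon>" "h u < h xbar + ereal \<epsilon>" using that by (auto simp: hb)
        with pr that(1,2) show ?thesis by blast
      qed
    qed (use assms(1,2) hb a \<epsilon> lam in auto)
    have E: "(\<lambda>x. real_of_ereal (moreau_env h lam x)) = S.E" by (simp add: S.E_def[abs_def])
    show "\<exists>r>0. ?A lam r"
    proof (rule exI[of _ S.r], rule conjI[OF S.r(1)], unfold E, intro conjI ballI allI impI)
      show "is_singleton (Prox h lam x)" if "x \<in> ball xbar S.r" for x
        by (simp add: S.Prox_eq[OF that])
      show "\<bar>moreau_env h lam x\<bar> \<noteq> \<infinity>" if "x \<in> ball xbar S.r" for x
        by (rule S.moreau_finite[OF that])
      show "C1_on S.E (ball xbar S.r)" by (rule S.C1_on_E)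
    qed (rule S.IPPm_limit[OF assms(4), unfolded S.limit_with_rates_def], simp_all)
  qed
qed

end
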